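(* Let $G$ be a connected semisimple Lie group with finite center, $H$ a symmetric subgroup of $G$, and $\Gamma$ an irreducible lattice in $G$ such that the orbit $H\Gamma$ is closed in $G/\Gamma$ and supports an $H$-invariant probability measure $\mu_H$. Let $g_n\in G$ be a sequence tending to infinity in $G/H$ and satisfying: (1) there exists a constant $\lambda>0$ such that for all $n\ge1$, $\|\mathrm{Ad}(g_n)\|=O(e^{\lambda n})$; (2) writing $g_n=k_na_nh_n$ according to the decomposition $G=KAH$, the quantity $\|\mathrm{Ad}(h_n^{-1})\|$ is uniformly bounded for all $n$. Then $(g_n)$ contains a Ratner sequence for $H$ as a subsequence.
   Context: $H$ is a symmetric subgroup if it is the fixed point set of an involution $\sigma:G\to G$. Let $\mathfrak g=\mathfrak h\oplus\mathfrak p$ be the decomposition of the Lie algebra of $G$ into the $+1$ and $-1$ eigenspaces of the differential of $\sigma$ ($\mathfrak h=\mathrm{Lie}(H)$). Let $\theta$ be a Cartan involution of $G$ commuting with $\sigma$, with $\mathfrak g=\mathfrak k\oplus\mathfrak q$ the decomposition into $+1$ and $-1$ eigenspaces of its differential; $K$ is the maximal compact subgroup with Lie algebra $\mathfrak k$. Let $\mathfrak a$ be a maximal abelian subspace of $\mathfrak p\cap\mathfrak q$ and $A=\exp(\mathfrak a)$. Then $G=KAH$, and in a decomposition $g=kah$ the element $h$ is unique up to left multiplication by elements of the compact group $H\cap K$. Fix a norm $\|\cdot\|$ on $\mathrm{Lie}(G)$; $\|\mathrm{Ad}(g)\|$ is the induced operator norm. An element $u\in G$ is $\mathrm{Ad}$-unipotent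 if $\mathrm{Ad}(u)$ is unipotent. A sequence $g_n\in G$ is a Ratner sequence for (with respect to) $H$ if there exists a non-trivial $\mathrm{Ad}$-unipotent element $u\in G$ such that for $\mu_H$-almost every $x\in G/\Gamma$, any weak-$*$ limit point of the sequence of empirical measures $\frac1N\sum_{n=1}^N\delta_{g_nx}$ is invariant by $u$ (weak-$*$ convergence: convergence of integrals of all continuous compactly supported functions). *)

theory Defs
  imports "HOL-Analysis.Analysis" "HOL-Probability.Probability" "HOL-Algebra.Coset" "HOL-Algebra.Left_Coset"
begin

section \<open>Smooth maps between Euclidean spaces\<close>

text \<open>These notions are meant for open sets \<open>S\<close>.\<close>

primrec Ck_on :: "nat \<Rightarrow> ('a::real_normed_vector \<Rightarrow> 'b::real_normed_vector) \<Rightarrow> 'a set \<Rightarrow> bool" where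
  "Ck_on 0 f S \<longleftrightarrow> continuous_on S f"
| "Ck_on (Suc k) f S \<longleftrightarrow> (\<forall>x\<in>S. f differentiable (at x)) \<and>
     (\<forall>v. Ck_on k (\<lambda>x. frechet_derivative f (at x) v) S)"

definition smooth_on :: "('a::real_normed_vector \<Rightarrow> 'b::real_normed_vector) \<Rightarrow> 'a set \<Rightarrow> bool" where
  "smooth_on f S \<longleftrightarrow> (\<forall>k. Ck_on k f S)"


section \<open>Lie groups\<close>

text \<open>A chart is a pair of its domain and its coordinate map; the map is irrelevant off the domain.
  The type \<open>'e\<close> is the model space, so the dimension of the group is \<open>DIM('e)\<close>.\<close>

record ('g, 'e) lie_data = "'g monoid" +
  topol :: "'g topology"
  atlas :: "('g set \<times> ('g \<Rightarrow> 'e)) set"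

definition smooth_atlas :: "'g topology \<Rightarrow> ('g set \<times> ('g \<Rightarrow> 'e::euclidean_space)) set \<Rightarrow> bool" where
  "smooth_atlas T \<A> \<longleftrightarrow>
     (\<Union>(U, \<phi>)\<in>\<A>. U) = topspace T \<and>
     (\<forall>(U, \<phi>)\<in>\<A>. openin T U \<and> open (\<phi> ` U) \<and>
        homeomorphic_map (subtopology T U) (top_of_set (\<phi> ` U)) \<phi>) \<and>
     (\<forall>(U, \<phi>)\<in>\<A>. \<forall>(V, \<psi>)\<in>\<A>. smooth_on (\<lambda>a. \<psi> (inv_into U \<phi> a)) (\<phi> ` (U \<inter> V)))"

definition smooth_fun :: "('g, 'e::euclidean_space) lie_data \<Rightarrow> ('g \<Rightarrow> real) \<Rightarrow> bool" where
  "smooth_fun G f \<longleftrightarrow> (\<forall>(U, \<phi>)\<in>atlas G. smooth_on (\<lambda>a. f (inv_into U \<phi> a)) (\<phi> ` U))"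

definition smooth_self_map :: "('g, 'e::euclidean_space) lie_data \<Rightarrow> ('g \<Rightarrow> 'g) \<Rightarrow> bool" where
  "smooth_self_map G f \<longleftrightarrow> continuous_map (topol G) (topol G) f \<and>
     (\<forall>(U, \<phi>)\<in>atlas G. \<forall>(V, \<psi>)\<in>atlas G.
        smooth_on (\<lambda>a. \<psi> (f (inv_into U \<phi> a))) (\<phi> ` {x\<in>U. f x \<in> V}))"

definition smooth_mult :: "('g, 'e::euclidean_space) lie_data \<Rightarrow> bool" where
  "smooth_mult G \<longleftrightarrow>
     continuous_map (prod_topology (topol G) (topol G)) (topol G) (\<lambda>(x, y). x \<otimes>\<^bsub>G\<^esub> y) \<and>
     (\<forall>(U, \<phi>)\<in>atlas G. \<forall>(V, \<psi>)\<in>atlas G. \<forall>(W, \<omega>)\<in>atlas G.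
        smooth_on (\<lambda>(a, b). \<omega> (inv_into U \<phi> a \<otimes>\<^bsub>G\<^esub> inv_into V \<psi> b))
          {(\<phi> x, \<psi> y) | x y. x \<in> U \<and> y \<in> V \<and> x \<otimes>\<^bsub>G\<^esub> y \<in> W})"

definition lie_group :: "('g, 'e::euclidean_space) lie_data \<Rightarrow> bool" where
  "lie_group G \<longleftrightarrow> group G \<and> topspace (topol G) = carrier G \<and> Hausdorff_space (topol G) \<and>
     (\<exists>\<B>. countable \<B> \<and> (\<forall>B\<in>\<B>. openin (topol G) B) \<and>
        (\<forall>U x. openin (topol G) U \<and> x \<in> U \<longrightarrow> (\<exists>B\<in>\<B>. x \<in> B \<and> B \<subseteq> U))) \<and>
     smooth_atlas (topol G) (atlas G) \<and> smooth_mult G \<and> smooth_self_map G (\<lambda>x. inv\<^bsub>G\<^esub> x)"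


section \<open>The Lie algebra\<close>

text \<open>A fixed chart around the identity identifies the tangent space there with \<open>'e\<close>,
  so the Lie algebra is the type \<open>'e\<close> with the bracket defined below. Another chart gives an
  isomorphic Lie algebra. The inner product of \<open>'e\<close> has no significance.\<close>

definition id_chart :: "('g, 'e::euclidean_space) lie_data \<Rightarrow> 'g set \<times> ('g \<Rightarrow> 'e)" where
  "id_chart G = (SOME c. c \<in> atlas G \<and> \<one>\<^bsub>G\<^esub> \<in> fst c)"

definition coord :: "('g, 'e::euclidean_space) lie_data \<Rightarrow> 'g \<Rightarrow> 'e" where
  "coord G = snd (id_chart G)"

definition uncoord :: "('g, 'e::euclidean_space) lie_data \<Rightarrow> 'e \<Rightarrow> 'g" where
  "uncoord G = inv_into (fst (id_chart G)) (coord G)"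

text \<open>The left-invariant vector field with value \<open>v\<close> at the identity, acting on functions.\<close>

definition left_field :: "('g, 'e::euclidean_space) lie_data \<Rightarrow> 'e \<Rightarrow> ('g \<Rightarrow> real) \<Rightarrow> 'g \<Rightarrow> real" where
  "left_field G v f x = deriv (\<lambda>t::real. f (x \<otimes>\<^bsub>G\<^esub> uncoord G (coord G \<one>\<^bsub>G\<^esub> + t *\<^sub>R v))) 0"

definition bracket :: "('g, 'e::euclidean_space) lie_data \<Rightarrow> 'e \<Rightarrow> 'e \<Rightarrow> 'e" where
  "bracket G v w = (THE z. \<forall>f. smooth_fun G f \<longrightarrow> (\<forall>x\<in>carrier G.
     left_field G z f x = left_field G v (left_field G w f) x - left_field G w (left_field G v f) x))"

definition lie_exp :: "('g, 'e::euclidean_space) lie_data \<Rightarrow> 'e \<Rightarrow> 'g" where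
  "lie_exp G v = (THE y. \<exists>\<gamma>::real \<Rightarrow> 'g.
     continuous_map euclideanreal (topol G) \<gamma> \<and> (\<forall>s t. \<gamma> (s + t) = \<gamma> s \<otimes>\<^bsub>G\<^esub> \<gamma> t) \<and>
     ((\<lambda>t. coord G (\<gamma> t)) has_vector_derivative v) (at 0) \<and> y = \<gamma> 1)"

text \<open>The differential at the identity of a map fixing the identity.\<close>

definition differential :: "('g, 'e::euclidean_space) lie_data \<Rightarrow> ('g \<Rightarrow> 'g) \<Rightarrow> 'e \<Rightarrow> 'e" where
  "differential G \<sigma> = frechet_derivative (\<lambda>a. coord G (\<sigma> (uncoord G a))) (at (coord G \<one>\<^bsub>G\<^esub>))"

definition Ad :: "('g, 'e::euclidean_space) lie_data \<Rightarrow> 'g \<Rightarrow> 'e \<Rightarrow> 'e" where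
  "Ad G g = differential G (\<lambda>x. g \<otimes>\<^bsub>G\<^esub> x \<otimes>\<^bsub>G\<^esub> inv\<^bsub>G\<^esub> g)"

definition Ad_unipotent :: "('g, 'e::euclidean_space) lie_data \<Rightarrow> 'g \<Rightarrow> bool" where
  "Ad_unipotent G u \<longleftrightarrow> (\<exists>m. \<forall>v. ((\<lambda>w. Ad G u w - w) ^^ m) v = 0)"

definition lie_ideal :: "('g, 'e::euclidean_space) lie_data \<Rightarrow> 'e set \<Rightarrow> bool" where
  "lie_ideal G I \<longleftrightarrow> subspace I \<and> (\<forall>v. \<forall>w\<in>I. bracket G v w \<in> I)"

primrec derived_series :: "('g, 'e::euclidean_space) lie_data \<Rightarrow> 'e set \<Rightarrow> nat \<Rightarrow> 'e set" where
  "derived_series G I 0 = I"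
| "derived_series G I (Suc k) =
     span {bracket G v w | v w. v \<in> derived_series G I k \<and> w \<in> derived_series G I k}"

definition semisimple :: "('g, 'e::euclidean_space) lie_data \<Rightarrow> bool" where
  "semisimple G \<longleftrightarrow> (\<forall>I. lie_ideal G I \<and> (\<exists>k. derived_series G I k = {0}) \<longrightarrow> I = {0})"

definition lie_trace :: "('e::euclidean_space \<Rightarrow> 'e) \<Rightarrow> real" where
  "lie_trace T = (\<Sum>b\<in>Basis. T b \<bullet> b)"

definition killing_form :: "('g, 'e::euclidean_space) lie_data \<Rightarrow> 'e \<Rightarrow> 'e \<Rightarrow> real" where
  "killing_form G v w = lie_trace (\<lambda>z. bracket G v (bracket G w z))"

definition lie_algebra_of :: "('g, 'e::euclidean_space) lie_data \<Rightarrow> 'g set \<Rightarrow> 'e set" where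
  "lie_algebra_of G K = {v. \<forall>t::real. lie_exp G (t *\<^sub>R v) \<in> K}"


section \<open>Subgroups and involutions\<close>

definition group_center :: "('g, 'm) monoid_scheme \<Rightarrow> 'g set" where
  "group_center G = {z \<in> carrier G. \<forall>x\<in>carrier G. z \<otimes>\<^bsub>G\<^esub> x = x \<otimes>\<^bsub>G\<^esub> z}"

definition group_involution :: "('g, 'e::euclidean_space) lie_data \<Rightarrow> ('g \<Rightarrow> 'g) \<Rightarrow> bool" where
  "group_involution G \<sigma> \<longleftrightarrow> \<sigma> \<in> hom G G \<and> smooth_self_map G \<sigma> \<and> (\<forall>x\<in>carrier G. \<sigma> (\<sigma> x) = x)"

definition cartan_involution :: "('g, 'e::euclidean_space) lie_data \<Rightarrow> ('g \<Rightarrow> 'g) \<Rightarrow> bool" where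
  "cartan_involution G \<theta> \<longleftrightarrow> group_involution G \<theta> \<and>
     (\<forall>v. v \<noteq> 0 \<longrightarrow> - killing_form G v (differential G \<theta> v) > 0)"

definition eigenspace :: "real \<Rightarrow> ('e::real_vector \<Rightarrow> 'e) \<Rightarrow> 'e set" where
  "eigenspace c T = {v. T v = c *\<^sub>R v}"

definition maximal_compact_subgroup :: "('g, 'e::euclidean_space) lie_data \<Rightarrow> 'g set \<Rightarrow> bool" where
  "maximal_compact_subgroup G K \<longleftrightarrow> subgroup K G \<and> compactin (topol G) K \<and>
     (\<forall>L. subgroup L G \<and> compactin (topol G) L \<and> K \<subseteq> L \<longrightarrow> L = K)"

definition abelian_subspace :: "('g, 'e::euclidean_space) lie_data \<Rightarrow> 'e set \<Rightarrow> bool" where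
  "abelian_subspace G \<aa> \<longleftrightarrow> subspace \<aa> \<and> (\<forall>v\<in>\<aa>. \<forall>w\<in>\<aa>. bracket G v w = 0)"

definition maximal_abelian_in :: "('g, 'e::euclidean_space) lie_data \<Rightarrow> 'e set \<Rightarrow> 'e set \<Rightarrow> bool" where
  "maximal_abelian_in G S \<aa> \<longleftrightarrow> abelian_subspace G \<aa> \<and> \<aa> \<subseteq> S \<and>
     (\<forall>\<bb>. abelian_subspace G \<bb> \<and> \<bb> \<subseteq> S \<and> \<aa> \<subseteq> \<bb> \<longrightarrow> \<bb> = \<aa>)"


section \<open>Norms\<close>

definition is_norm :: "('e::real_vector \<Rightarrow> real) \<Rightarrow> bool" where
  "is_norm N \<longleftrightarrow> (\<forall>v. 0 \<le> N v) \<and> (\<forall>v. N v = 0 \<longleftrightarrow> v = 0) \<and>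
     (\<forall>c v. N (c *\<^sub>R v) = \<bar>c\<bar> * N v) \<and> (\<forall>v w. N (v + w) \<le> N v + N w)"

definition op_norm :: "('e::real_vector \<Rightarrow> real) \<Rightarrow> ('e \<Rightarrow> 'e) \<Rightarrow> real" where
  "op_norm N T = (SUP v\<in>{v. N v \<le> 1}. N (T v))"


section \<open>Homogeneous spaces and measures on them\<close>

text \<open>The space of left cosets with the quotient topology. The group acts on it by
  \<open>x \<mapsto> g <#\<^bsub>G\<^esub> x\<close>.\<close>

definition coset_space :: "('g, 'e::euclidean_space) lie_data \<Rightarrow> 'g set \<Rightarrow> 'g set topology" where
  "coset_space G H = topology (\<lambda>V. V \<subseteq> lcosets\<^bsub>G\<^esub> H \<and>
     openin (topol G) {x \<in> topspace (topol G). x <#\<^bsub>G\<^esub> H \<in> V})"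

lemma openin_coset_space:
  "openin (coset_space G H) V \<longleftrightarrow> V \<subseteq> lcosets\<^bsub>G\<^esub> H \<and>
     openin (topol G) {x \<in> topspace (topol G). x <#\<^bsub>G\<^esub> H \<in> V}"
proof -
  let ?p = "\<lambda>V. {x \<in> topspace (topol G). x <#\<^bsub>G\<^esub> H \<in> V}"
  have *: "?p (S \<inter> T) = ?p S \<inter> ?p T" "?p (\<Union>\<K>) = \<Union>(?p ` \<K>)" for S T \<K>
    by auto
  have "istopology (\<lambda>V. V \<subseteq> lcosets\<^bsub>G\<^esub> H \<and> openin (topol G) (?p V))"
    unfolding istopology_def * by (auto intro: openin_Union)
  then show ?thesis
    by (simp add: coset_space_def topology_inverse')
qed

lemma topspace_coset_space:
  assumes "lie_group G"
  shows "topspace (coset_space G H) = lcosets\<^bsub>G\<^esub> H"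
proof -
  have "{x \<in> topspace (topol G). x <#\<^bsub>G\<^esub> H \<in> lcosets\<^bsub>G\<^esub> H} = topspace (topol G)"
    using assms by (auto simp: lie_group_def LCOSETS_def)
  then have "openin (coset_space G H) (lcosets\<^bsub>G\<^esub> H)"
    by (simp add: openin_coset_space)
  then show ?thesis
    by (meson openin_coset_space openin_subset openin_topspace subset_antisym)
qed

definition borel_of :: "'x topology \<Rightarrow> 'x measure" where
  "borel_of X = sigma (topspace X) {U. openin X U}"

definition invariant_under :: "('g, 'm) monoid_scheme \<Rightarrow> 'g \<Rightarrow> 'g set measure \<Rightarrow> bool" where
  "invariant_under G g \<mu> \<longleftrightarrow> distr \<mu> \<mu> (\<lambda>x. g <#\<^bsub>G\<^esub> x) = \<mu>"

definition discrete_subgroup :: "('g, 'e::euclidean_space) lie_data \<Rightarrow> 'g set \<Rightarrow> bool" where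
  "discrete_subgroup G \<Gamma> \<longleftrightarrow> subgroup \<Gamma> G \<and> subtopology (topol G) \<Gamma> = discrete_topology \<Gamma>"

definition lattice_in :: "('g, 'e::euclidean_space) lie_data \<Rightarrow> 'g set \<Rightarrow> bool" where
  "lattice_in G \<Gamma> \<longleftrightarrow> discrete_subgroup G \<Gamma> \<and>
     (\<exists>\<nu>. prob_space \<nu> \<and> sets \<nu> = sets (borel_of (coset_space G \<Gamma>)) \<and>
        (\<forall>g\<in>carrier G. invariant_under G g \<nu>))"

text \<open>This definition of irreducibility also makes sense when the group has compact factors.\<close>

definition irreducible_lattice :: "('g, 'e::euclidean_space) lie_data \<Rightarrow> 'g set \<Rightarrow> bool" where
  "irreducible_lattice G \<Gamma> \<longleftrightarrow> lattice_in G \<Gamma> \<and>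
     (\<forall>N. N \<lhd> G \<and> closedin (topol G) N \<and> \<not> compactin (topol G) N \<longrightarrow>
        topol G closure_of (\<Gamma> <#>\<^bsub>G\<^esub> N) = carrier G)"

definition tends_to_infinity :: "'x topology \<Rightarrow> (nat \<Rightarrow> 'x) \<Rightarrow> bool" where
  "tends_to_infinity X s \<longleftrightarrow> (\<forall>C. compactin X C \<longrightarrow> (\<forall>\<^sub>F n in sequentially. s n \<notin> C))"

definition Cc_fun :: "'x topology \<Rightarrow> ('x \<Rightarrow> real) \<Rightarrow> bool" where
  "Cc_fun X f \<longleftrightarrow> continuous_map X euclideanreal f \<and>
     (\<exists>C. compactin X C \<and> (\<forall>x\<in>topspace X - C. f x = 0))"

definition weak_star_limit :: "'x topology \<Rightarrow> (nat \<Rightarrow> 'x measure) \<Rightarrow> 'x measure \<Rightarrow> bool" where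
  "weak_star_limit X M \<nu> \<longleftrightarrow>
     (\<forall>f. Cc_fun X f \<longrightarrow> (\<lambda>n. integral\<^sup>L (M n) f) \<longlonglongrightarrow> integral\<^sup>L \<nu> f)"

text \<open>Limits of probability measures have mass at most \<open>1\<close> but mass can escape,
  so the limit points range over finite Borel measures.\<close>

definition weak_star_limit_point :: "'x topology \<Rightarrow> (nat \<Rightarrow> 'x measure) \<Rightarrow> 'x measure \<Rightarrow> bool" where
  "weak_star_limit_point X M \<nu> \<longleftrightarrow> finite_measure \<nu> \<and> sets \<nu> = sets (borel_of X) \<and>
     (\<exists>r. strict_mono r \<and> weak_star_limit X (\<lambda>j. M (r j)) \<nu>)"

text \<open>The sequence starts at index \<open>1\<close>.\<close>

definition empirical_measure :: "'x topology \<Rightarrow> (nat \<Rightarrow> 'x) \<Rightarrow> nat \<Rightarrow> 'x measure" where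
  "empirical_measure X s N = distr (uniform_count_measure {1..N}) (borel_of X) s"

definition ratner_sequence ::
  "('g, 'e::euclidean_space) lie_data \<Rightarrow> 'g set \<Rightarrow> 'g set measure \<Rightarrow> (nat \<Rightarrow> 'g) \<Rightarrow> bool" where
  "ratner_sequence G \<Gamma> \<mu> g \<longleftrightarrow>
     (\<exists>u\<in>carrier G. u \<noteq> \<one>\<^bsub>G\<^esub> \<and> Ad_unipotent G u \<and>
        (AE x in \<mu>. \<forall>\<nu>. weak_star_limit_point (coset_space G \<Gamma>)
             (empirical_measure (coset_space G \<Gamma>) (\<lambda>n. g n <#\<^bsub>G\<^esub> x)) \<nu> \<longrightarrow>
           invariant_under G u \<nu>))"

end

(* A direction of the Lie algebra h of H is expanded by g_n = k_n a_n h_n without bound: writing a_n = exp X_n,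
   the operators Ad(exp (t X_n)) are symmetric for the inner product -B(v, theta w), and
   f(t) = <Ad(exp (t X_n)) v, v> has f'' >= |[X_n, v]|^2 for v in h, while |[X_n, v]| >= kappa |X_n| for some
   v in h of norm at most 1, because <X, X> = tr (ad X)^2 is twice the trace over h. Exponentials of small
   multiples of such directions give y_n -> 1 in H with u_n = g_n y_n g_n^-1 -> u <> 1 along a subsequence.
   Ad u is unipotent since the traces of (Ad u_n - 1)^k equal those of (Ad y_n - 1)^k and tend to 0.
   Finally f(u g_n x) - f(g_n x) is uniformly close to f(g_n y_n x) - f(g_n x), and H-invariance of the measure
   makes such functions asymptotically uncorrelated, so their averages along a sparse subsequence
   tend to 0 almost everywhere, for countably many f that determine measures. *)
theory Submission
  imports Defs "HOL-Library.Discrete_Functions"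
begin

section \<open>Smooth maps\<close>

text \<open>The elements u_n have to stay in a compact set and away from the identity although
  Ad(g_n) is unbounded. The expanded direction is therefore rescaled so that u_n is the exponential
  of a vector of fixed norm \<delta>, small enough for a coordinate estimate to control it. The
  scaling factor tends to 0, and the bound on Ad(h_n^-1) turns this into y_n -> 1. That the
  direction lies in the +1 eigenspace of \<sigma> puts y_n into H, which is where invariance of the
  measure enters. Conjugation by unbounded elements destroys all estimates on Ad y_n other than
  conjugation invariants, hence the traces. The decorrelation comes without a rate, so the indices
  are chosen recursively, each almost uncorrelated with all earlier ones. One null set has to serve
  all limit measures at once, hence the countable family of test functions. The Lie theory is built
  on the group law in a single chart at the identity: Ad, the bracket and the exponential are
  reached through the left- and right-invariant fields in that chart.\<close>

lemma linear_representation: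
  fixes A :: "'e::euclidean_space \<Rightarrow> 'f::real_vector"
  assumes "linear A"
  shows "A u = (\<Sum>i\<in>Basis. (u \<bullet> i) *\<^sub>R A i)"
proof -
  have "A u = A (\<Sum>i\<in>Basis. (u \<bullet> i) *\<^sub>R i)" by (simp add: euclidean_representation)
  also have "\<dots> = (\<Sum>i\<in>Basis. (u \<bullet> i) *\<^sub>R A i)"
    by (simp only: linear_sum[OF assms] linear_cmul[OF assms])
  finally show ?thesis .
qed

text \<open>Derivatives are taken in the full neighbourhood filter of a point, so agreement on
  \<open>S\<close> passes to them because \<open>S\<close> is open.\<close>

lemma Ck_on_cong:
  assumes "open S" "\<And>x. x \<in> S \<Longrightarrow> f x = g x" "Ck_on k f S"
  shows "Ck_on k g S"
  using assms(2,3)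
proof (induction k arbitrary: f g)
  case 0
  then show ?case by (simp cong: continuous_on_cong)
next
  case (Suc k)
  have d: "(g has_derivative frechet_derivative f (at x)) (at x)" if "x \<in> S" for x
    using Suc.prems that assms(1)
    by (intro has_derivative_transform_within_open[of f _ x UNIV S g])
       (auto simp: frechet_derivative_works[symmetric])
  have e: "frechet_derivative f (at x) = frechet_derivative g (at x)" if "x \<in> S" for x
    using that by (rule frechet_derivative_at[OF d])
  have "Ck_on k (\<lambda>x. frechet_derivative g (at x) v) S" for v
    by (rule Suc.IH[of "\<lambda>x. frechet_derivative f (at x) v"]) (use Suc.prems e in auto)
  then show ?case using d by (auto simp: differentiable_def)
qed

text \<open>Any explicit derivative may replace the one chosen by \<open>frechet_derivative\<close>;
  most closure properties below go through this rule.\<close>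

lemma Ck_on_SucI:
  assumes "open S" "\<And>x. x \<in> S \<Longrightarrow> (f has_derivative f' x) (at x)"
    "\<And>v. Ck_on k (\<lambda>x. f' x v) S"
  shows "Ck_on (Suc k) f S"
proof -
  have "frechet_derivative f (at x) = f' x" if "x \<in> S" for x
    using frechet_derivative_at[OF assms(2)[OF that]] by simp
  then have "Ck_on k (\<lambda>x. frechet_derivative f (at x) v) S" for v
    by (intro Ck_on_cong[OF assms(1) _ assms(3)]) simp
  then show ?thesis using assms(2) by (auto simp: differentiable_def)
qed

lemma Ck_on_Suc_has_derivative:
  "Ck_on (Suc k) f S \<Longrightarrow> x \<in> S \<Longrightarrow> (f has_derivative frechet_derivative f (at x)) (at x)"
  by (simp add: frechet_derivative_works[symmetric])

lemma Ck_on_SucD: "Ck_on (Suc k) f S \<Longrightarrow> Ck_on k (\<lambda>x. frechet_derivative f (at x) v) S"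
  by simp

lemma Ck_on_Suc_imp: "Ck_on (Suc k) f S \<Longrightarrow> Ck_on k f S"
proof (induction k arbitrary: f)
  case 0
  then show ?case
    by (auto intro!: continuous_at_imp_continuous_on differentiable_imp_continuous_within)
next
  case (Suc k)
  then show ?case by (metis Ck_on.simps(2))
qed

lemma Ck_on_imp_continuous_on: "Ck_on k f S \<Longrightarrow> continuous_on S f"
  by (induction k) (use Ck_on_Suc_imp in auto)

lemma Ck_on_const: "Ck_on k (\<lambda>x. c) S"
  by (induction k arbitrary: c) auto

lemma Ck_on_linear:
  assumes L: "bounded_linear L" shows "Ck_on k L S"
proof (cases k)
  case 0
  then show ?thesis using linear_continuous_on[OF L] by simp
next
  case (Suc m)
  have "frechet_derivative L (at x) = L" for x
    using frechet_derivative_at[OF bounded_linear_imp_has_derivative[OF L]] by simp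
  then show ?thesis using Suc bounded_linear_imp_differentiable[OF L]
    by (simp add: Ck_on_const)
qed

lemma Ck_on_linear_compose:
  assumes "bounded_linear L" "open S" "Ck_on k f S"
  shows "Ck_on k (\<lambda>x. L (f x)) S"
  using assms(3)
proof (induction k arbitrary: f)
  case 0
  then show ?case using bounded_linear.continuous_on[OF assms(1)] by simp
next
  case (Suc k)
  show ?case
    by (rule Ck_on_SucI[OF assms(2) bounded_linear.has_derivative[OF assms(1)
          Ck_on_Suc_has_derivative[OF Suc.prems]]])
       (use Suc in auto)
qed

lemma Ck_on_add:
  assumes "open S" "Ck_on k f S" "Ck_on k g S"
  shows "Ck_on k (\<lambda>x. f x + g x) S"
  using assms(2,3)
proof (induction k arbitrary: f g)
  case 0
  then show ?case by (simp add: continuous_on_add)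
next
  case (Suc k)
  show ?case
    by (rule Ck_on_SucI[OF assms(1) has_derivative_add[OF
          Ck_on_Suc_has_derivative[OF Suc.prems(1)] Ck_on_Suc_has_derivative[OF Suc.prems(2)]]])
       (use Suc in auto)
qed

lemma Ck_on_bilinear:
  assumes B: "bounded_bilinear B" and "open S" "Ck_on k f S" "Ck_on k g S"
  shows "Ck_on k (\<lambda>x. B (f x) (g x)) S"
  using assms(3,4)
proof (induction k arbitrary: f g)
  case 0
  then show ?case using bounded_bilinear.continuous_on[OF B] by simp
next
  case (Suc k)
  have "Ck_on k f S" "Ck_on k g S"
    using Suc.prems[THEN Ck_on_Suc_imp] by auto
  then show ?case
    by (intro Ck_on_SucI[OF assms(2) bounded_bilinear.FDERIV[OF B
          Ck_on_Suc_has_derivative[OF Suc.prems(1)] Ck_on_Suc_has_derivative[OF Suc.prems(2)]]]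
          Ck_on_add assms Suc.IH)
       (use Suc in auto)
qed

lemma Ck_on_sum:
  assumes "open S" "\<And>i. i \<in> I \<Longrightarrow> Ck_on k (f i) S"
  shows "Ck_on k (\<lambda>x. \<Sum>i\<in>I. f i x) S"
  using assms(2)
  by (induction I rule: infinite_finite_induct) (auto intro: Ck_on_const Ck_on_add assms(1))

text \<open>\<open>Ck_on\<close> speaks of derivatives in a fixed direction, while in the chain rule
  the direction \<open>?f' x v\<close> moves with x. Expanding it in the basis turns the derivative
  into a finite sum of products of derivatives in fixed directions, to which the induction
  hypothesis applies.\<close>

lemma Ck_on_compose:
  fixes f :: "'a::real_normed_vector \<Rightarrow> 'b::euclidean_space" and g :: "'b \<Rightarrow> 'c::real_normed_vector"
  assumes S: "open S" and f: "Ck_on k f S" and fT: "f ` S \<subseteq> T" and g: "Ck_on k g T"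
  shows "Ck_on k (\<lambda>x. g (f x)) S"
  using f g
proof (induction k arbitrary: g)
  case 0
  then show ?case using continuous_on_compose2[of T g S f] fT by simp
next
  case (Suc k)
  let ?f' = "\<lambda>x. frechet_derivative f (at x)" and ?g' = "\<lambda>y. frechet_derivative g (at y)"
  have fk: "Ck_on k f S" using Suc.prems(1) by (rule Ck_on_Suc_imp)
  have lin: "linear (?g' y)" if "y \<in> T" for y
    using Ck_on_Suc_has_derivative[OF Suc.prems(2) that] has_derivative_linear by blast
  have d: "((\<lambda>x. g (f x)) has_derivative (\<lambda>v. \<Sum>i\<in>Basis. (?f' x v \<bullet> i) *\<^sub>R ?g' (f x) i)) (at x)"
    if "x \<in> S" for x
  proof -
    have fx: "f x \<in> T" using fT that by auto
    have "?g' (f x) w = (\<Sum>i\<in>Basis. (w \<bullet> i) *\<^sub>R ?g' (f x) i)" for w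
      by (rule linear_representation[OF lin[OF fx]])
    moreover have "((\<lambda>x. g (f x)) has_derivative (\<lambda>v. ?g' (f x) (?f' x v))) (at x)"
      by (rule has_derivative_compose[OF Ck_on_Suc_has_derivative[OF Suc.prems(1) that]
            Ck_on_Suc_has_derivative[OF Suc.prems(2) fx]])
    moreover from calculation(1)
    have "(\<lambda>v. ?g' (f x) (?f' x v)) = (\<lambda>v. \<Sum>i\<in>Basis. (?f' x v \<bullet> i) *\<^sub>R ?g' (f x) i)" by blast
    ultimately show ?thesis by argo
  qed
  show ?case
  proof (rule Ck_on_SucI[OF S d])
    fix v
    show "Ck_on k (\<lambda>x. \<Sum>i\<in>Basis. (?f' x v \<bullet> i) *\<^sub>R ?g' (f x) i) S"
    proof (intro Ck_on_sum[OF S] Ck_on_bilinear[OF bounded_bilinear_scaleR S]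
        Ck_on_linear_compose[OF bounded_linear_inner_left S])
      show "Ck_on k (\<lambda>x. ?f' x v) S" by (rule Ck_on_SucD[OF Suc.prems(1)])
      show "Ck_on k (\<lambda>x. ?g' (f x) i) S" for i
        using Suc.IH[OF fk Ck_on_SucD[OF Suc.prems(2), of i]] .
    qed
  qed
qed

lemma Ck_on_Un:
  assumes "open S" "open T" "Ck_on k f S" "Ck_on k f T"
  shows "Ck_on k f (S \<union> T)"
  using assms(3,4)
  by (induction k arbitrary: f) (auto intro: continuous_on_open_Un[OF assms(1,2)])

text \<open>The second difference is the increment over [0, t] of the difference of f along two
  parallel lines in direction v. The mean value theorem makes it t times a difference of first
  derivatives in direction v, and differentiability of that derivative at x gives the limit.\<close>

lemma second_difference_limit:
  fixes f :: "'a::real_normed_vector \<Rightarrow> real"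
  assumes S: "open S" "x \<in> S" and f: "Ck_on 2 f S"
  shows "((\<lambda>t. (f (x + t *\<^sub>R v + t *\<^sub>R w) - f (x + t *\<^sub>R v) - f (x + t *\<^sub>R w) + f x) / t^2) \<longlongrightarrow>
     frechet_derivative (\<lambda>y. frechet_derivative f (at y) v) (at x) w) (at_right 0)"
proof -
  define g where "g = (\<lambda>y. frechet_derivative f (at y) v)"
  define L where "L = frechet_derivative g (at x)"
  have f2: "Ck_on (Suc (Suc 0)) f S" using f by (simp only: numeral_2_eq_2)
  have "(g has_derivative L) (at x)"
    unfolding L_def g_def
    by (rule Ck_on_Suc_has_derivative[of 0 _ S]) (use f2 S(2) in auto)
  then have L: "bounded_linear L" "\<And>e. e > 0 \<Longrightarrow> \<exists>d>0. \<forall>y. norm (y - x) < d \<longrightarrow> 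
      norm (g y - g x - L (y - x)) \<le> e * norm (y - x)"
    by (auto simp: has_derivative_at_alt)
  let ?D = "\<lambda>t. f (x + t *\<^sub>R v + t *\<^sub>R w) - f (x + t *\<^sub>R v) - f (x + t *\<^sub>R w) + f x"
  have "\<forall>\<^sub>F t in at_right 0. dist (?D t / t^2) (L w) < e" if "e > 0" for e
  proof -
    \<comment> \<open>\<open>M\<close> bounds the sum of the two displacements from x in units of t;
      the 1 keeps it positive for v = w = 0. The accuracy \<open>e / (2 * M)\<close> then leaves e /
      2, hence a strict inequality.\<close>
    define M where "M = 2 * norm v + norm w + 1"
    have M: "M > 0" unfolding M_def by (smt (verit) norm_ge_zero)
    obtain d where d: "d > 0" "\<And>y. norm (y - x) < d \<Longrightarrow>
        norm (g y - g x - L (y - x)) \<le> e / (2 * M) * norm (y - x)"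
      using L(2)[of "e / (2 * M)"] \<open>e > 0\<close> M by auto
    obtain r where r: "r > 0" "ball x r \<subseteq> S" using S open_contains_ball by blast
    have "dist (?D t / t^2) (L w) < e" if t: "0 < t" "t < min d r / M" for t
    proof -
      have tM: "t * M < d" "t * M < r" using t M by (auto simp: field_simps)
      have nb: "norm (s *\<^sub>R v + q *\<^sub>R w) \<le> t * (norm v + norm w)" if "0 \<le> s" "s \<le> t" "0 \<le> q" "q \<le> t" for s q
      proof -
        have "norm (s *\<^sub>R v + q *\<^sub>R w) \<le> s * norm v + q * norm w"
          using norm_triangle_ineq[of "s *\<^sub>R v" "q *\<^sub>R w"] that by simp
        also have "\<dots> \<le> t * norm v + t * norm w"
          using that by (intro add_mono mult_right_mono) auto
        finally show ?thesis by (simp add: algebra_simps)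
      qed
      have tm2: "t * (norm v + norm w) < t * M" using t(1) by (simp add: M_def add_nonneg_pos)
      have inS: "x + s *\<^sub>R v + q *\<^sub>R w \<in> S" if "0 \<le> s" "s \<le> t" "0 \<le> q" "q \<le> t" for s q
      proof (rule subsetD[OF r(2)])
        have "dist x (x + (s *\<^sub>R v + q *\<^sub>R w)) = norm (s *\<^sub>R v + q *\<^sub>R w)"
          by (metis add_diff_cancel_left' dist_commute dist_norm)
        then show "x + s *\<^sub>R v + q *\<^sub>R w \<in> ball x r"
          using nb[OF that] tM tm2 by (simp only: mem_ball add.assoc)
      qed
      have lin: "linear (frechet_derivative f (at y))" if "y \<in> S" for y
        using Ck_on_Suc_has_derivative[OF f2 that] has_derivative_linear by blast
      let ?p = "\<lambda>s. f (x + s *\<^sub>R v + t *\<^sub>R w) - f (x + s *\<^sub>R v)"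
      have dd: "((\<lambda>s. f (x + s *\<^sub>R v + q *\<^sub>R w)) has_real_derivative g (x + s *\<^sub>R v + q *\<^sub>R w)) (at s)"
        if "0 \<le> s" "s \<le> t" "0 \<le> q" "q \<le> t" for s q
      proof -
        have "((\<lambda>s. x + s *\<^sub>R v + q *\<^sub>R w) has_derivative (\<lambda>h. h *\<^sub>R v)) (at s)"
          by (auto intro!: derivative_eq_intros)
        from has_derivative_compose[OF this Ck_on_Suc_has_derivative[OF f2 inS[OF that]]]
        have "((\<lambda>s. f (x + s *\<^sub>R v + q *\<^sub>R w)) has_derivative
            (\<lambda>h. frechet_derivative f (at (x + s *\<^sub>R v + q *\<^sub>R w)) (h *\<^sub>R v))) (at s)" .
        moreover have "(\<lambda>h. frechet_derivative f (at (x + s *\<^sub>R v + q *\<^sub>R w)) (h *\<^sub>R v)) =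
            times (g (x + s *\<^sub>R v + q *\<^sub>R w))"
          by (rule ext) (simp add: linear_cmul[OF lin[OF inS[OF that]]] g_def)
        ultimately show ?thesis by (simp add: has_field_derivative_def)
      qed
      have "(?p has_real_derivative (g (x + s *\<^sub>R v + t *\<^sub>R w) - g (x + s *\<^sub>R v))) (at s)"
        if "0 \<le> s" "s \<le> t" for s
        using DERIV_diff[OF dd[of s t] dd[of s 0]] that t by simp
      from MVT2[OF t(1) this] obtain z where z: "0 < z" "z < t"
        "?p t - ?p 0 = t * (g (x + z *\<^sub>R v + t *\<^sub>R w) - g (x + z *\<^sub>R v))" by auto
      have g1: "\<bar>g (x + z *\<^sub>R v + t *\<^sub>R w) - g x - L (z *\<^sub>R v + t *\<^sub>R w)\<bar> \<le> e / (2 * M) * norm (z *\<^sub>R v + t *\<^sub>R w)"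
      proof -
        have "norm (z *\<^sub>R v + t *\<^sub>R w) < d" using nb[of z t] z(1,2) t(1) tM(1) tm2 by linarith
        then show ?thesis using d(2)[of "x + z *\<^sub>R v + t *\<^sub>R w"]
          by (simp only: add.assoc add_diff_cancel_left' real_norm_def)
      qed
      have g2: "\<bar>g (x + z *\<^sub>R v) - g x - L (z *\<^sub>R v)\<bar> \<le> e / (2 * M) * norm (z *\<^sub>R v)"
      proof -
        have "norm (z *\<^sub>R v + 0 *\<^sub>R w) < d" using nb[of z 0] z(1,2) t(1) tM(1) tm2 by linarith
        then show ?thesis using d(2)[of "x + z *\<^sub>R v"]
          by (simp only: add.assoc add_diff_cancel_left' real_norm_def scaleR_zero_left add_0_right)
      qed
      have n1: "norm (z *\<^sub>R v + t *\<^sub>R w) + norm (z *\<^sub>R v) \<le> t * M"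
      proof -
        have "norm (z *\<^sub>R v) \<le> t * norm v" using z by (simp add: mult_right_mono)
        moreover have "norm (z *\<^sub>R v + t *\<^sub>R w) \<le> t * (norm v + norm w)" using nb[of z t] z t by simp
        ultimately show ?thesis using t(1) by (simp add: M_def algebra_simps)
      qed
      have Lw: "L (z *\<^sub>R v + t *\<^sub>R w) - L (z *\<^sub>R v) = t * L w"
        using L(1) by (simp add: linear_simps)
      have "\<bar>(g (x + z *\<^sub>R v + t *\<^sub>R w) - g (x + z *\<^sub>R v)) - t * L w\<bar>
          \<le> e / (2 * M) * norm (z *\<^sub>R v + t *\<^sub>R w) + e / (2 * M) * norm (z *\<^sub>R v)"
        using g1 g2 Lw by linarith
      also have "\<dots> \<le> e / (2 * M) * (t * M)"
        unfolding distrib_left[symmetric] by (rule mult_left_mono[OF n1]) (use M \<open>e > 0\<close> in simp)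
      also have "\<dots> = t * (e / 2)" using M by simp
      finally have b: "\<bar>(g (x + z *\<^sub>R v + t *\<^sub>R w) - g (x + z *\<^sub>R v)) - t * L w\<bar> \<le> t * (e / 2)" .
      have D: "?D t = t * (g (x + z *\<^sub>R v + t *\<^sub>R w) - g (x + z *\<^sub>R v))"
        using z(3) by (simp add: algebra_simps)
      have "dist (?D t / t^2) (L w) = \<bar>((g (x + z *\<^sub>R v + t *\<^sub>R w) - g (x + z *\<^sub>R v)) - t * L w) / t\<bar>"
        unfolding D using t(1) by (simp add: dist_real_def power2_eq_square diff_divide_distrib)
      also have "\<dots> \<le> e / 2"
        using b t(1) by (simp add: abs_divide pos_divide_le_eq mult.commute)
      finally show ?thesis using \<open>e > 0\<close> by simp
    qed
    then show ?thesis
      unfolding eventually_at_right_field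
      by (intro exI[of _ "min d r / M"]) (use d(1) r(1) M in auto)
  qed
  then show ?thesis unfolding L_def g_def by (rule tendstoI)
qed

text \<open>The second difference is symmetric in v and w, so both iterated derivatives are limits
  of the same quotient.\<close>

lemma second_derivative_symmetric:
  fixes f :: "'a::real_normed_vector \<Rightarrow> real"
  assumes "open S" "x \<in> S" "Ck_on 2 f S"
  shows "frechet_derivative (\<lambda>y. frechet_derivative f (at y) v) (at x) w
       = frechet_derivative (\<lambda>y. frechet_derivative f (at y) w) (at x) v"
proof -
  have "((\<lambda>t. (f (x + t *\<^sub>R v + t *\<^sub>R w) - f (x + t *\<^sub>R v) - f (x + t *\<^sub>R w) + f x) / t^2) \<longlongrightarrow>
     frechet_derivative (\<lambda>y. frechet_derivative f (at y) w) (at x) v) (at_right 0)"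
    using second_difference_limit[OF assms, of w v] by (simp add: algebra_simps)
  with second_difference_limit[OF assms, of v w] show ?thesis
    using tendsto_unique trivial_limit_at_right_real by blast
qed

lemma second_derivative_symmetric_vector:
  fixes f :: "'a::real_normed_vector \<Rightarrow> 'b::real_inner"
  assumes S: "open S" "x \<in> S" and f: "Ck_on 2 f S"
  shows "frechet_derivative (\<lambda>y. frechet_derivative f (at y) v) (at x) w
       = frechet_derivative (\<lambda>y. frechet_derivative f (at y) w) (at x) v"
proof (rule vector_eq_rdot[THEN iffD1, rule_format])
  fix z :: 'b
  have f2: "Ck_on (Suc (Suc 0)) f S" using f by (simp only: numeral_2_eq_2)
  have fz: "Ck_on 2 (\<lambda>y. f y \<bullet> z) S"
    by (rule Ck_on_linear_compose[OF bounded_linear_inner_left S(1) f])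
  have 1: "frechet_derivative (\<lambda>y. f y \<bullet> z) (at y) u = frechet_derivative f (at y) u \<bullet> z" if "y \<in> S" for y u
    using frechet_derivative_at[OF has_derivative_inner_left[OF Ck_on_Suc_has_derivative[OF f2 that], of z]]
    by metis
  have 2: "frechet_derivative (\<lambda>y. frechet_derivative (\<lambda>y. f y \<bullet> z) (at y) u) (at x) u'
     = frechet_derivative (\<lambda>y. frechet_derivative f (at y) u) (at x) u' \<bullet> z" for u u'
  proof -
    have "((\<lambda>y. frechet_derivative f (at y) u \<bullet> z) has_derivative
        (\<lambda>u'. frechet_derivative (\<lambda>y. frechet_derivative f (at y) u) (at x) u' \<bullet> z)) (at x)"
      by (rule has_derivative_inner_left[OF Ck_on_Suc_has_derivative[OF Ck_on_SucD[OF f2] S(2)]])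
    then have "((\<lambda>y. frechet_derivative (\<lambda>y. f y \<bullet> z) (at y) u) has_derivative
        (\<lambda>u'. frechet_derivative (\<lambda>y. frechet_derivative f (at y) u) (at x) u' \<bullet> z)) (at x)"
      by (rule has_derivative_transform_within_open[OF _ S]) (simp add: 1)
    from frechet_derivative_at[OF this] show ?thesis by metis
  qed
  show "frechet_derivative (\<lambda>y. frechet_derivative f (at y) v) (at x) w \<bullet> z
       = frechet_derivative (\<lambda>y. frechet_derivative f (at y) w) (at x) v \<bullet> z"
    using second_derivative_symmetric[OF S fz] unfolding 2 .
qed

text \<open>The powers of 1/x make the family closed under differentiation, so that smoothness of
  \<open>flat 0\<close>, the classical exp (-1/x) extended by 0, is an induction for all k at
  once.\<close>

definition flat :: "nat \<Rightarrow> real \<Rightarrow> real" where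
  "flat k x = (if x > 0 then inverse x ^ k * exp (- inverse x) else 0)"

lemma flat_tendsto_0: "(flat k \<longlongrightarrow> 0) (at 0)"
proof -
  have "((\<lambda>x. inverse x ^ k / exp (inverse x)) \<longlongrightarrow> 0) (at_right (0::real))"
    using filterlim_compose[OF tendsto_power_div_exp_0 filterlim_inverse_at_top_right] .
  then have r: "(flat k \<longlongrightarrow> 0) (at_right 0)"
    by (rule tendsto_cong[THEN iffD1, rotated])
       (auto simp: eventually_at_right_field flat_def exp_minus divide_inverse intro!: exI[of _ 1])
  have l: "(flat k \<longlongrightarrow> 0) (at_left 0)"
    by (rule tendsto_eventually) (auto simp: eventually_at_left_field flat_def intro!: exI[of _ "-1"])
  show ?thesis using l r by (simp add: filterlim_at_split)
qed

lemma flat_has_derivative: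
  "(flat k has_real_derivative (- real k * flat (Suc k) x + flat (Suc (Suc k)) x)) (at x)"
proof -
  consider "x > 0" | "x < 0" | "x = 0" by linarith
  then show ?thesis
  proof cases
    case 1
    have "((\<lambda>x. inverse x ^ k * exp (- inverse x)) has_real_derivative 
        (- real k * flat (Suc k) x + flat (Suc (Suc k)) x)) (at x)"
    proof -
      have "((\<lambda>x. inverse x ^ k * exp (- inverse x)) has_real_derivative
        (real k * - (inverse x * inverse x) * inverse x ^ (k - 1)) * exp (- inverse x)
          + exp (- inverse x) * (inverse x * inverse x) * inverse x ^ k) (at x)"
        using 1 by (auto intro!: derivative_eq_intros)
      moreover have "real k * inverse x * inverse x ^ (k - 1) = real k * inverse x ^ k"
        by (cases k) auto
      ultimately show ?thesis
        using 1 by (auto simp: flat_def algebra_simps elim!: DERIV_cong)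
    qed
    then show ?thesis
      by (rule has_field_derivative_transform_within_open[of _ _ _ "{0<..}"]) (auto simp: flat_def 1)
  next
    case 2
    have "((\<lambda>x. 0) has_real_derivative 0) (at x)" by simp
    then have "(flat k has_real_derivative 0) (at x)"
      by (rule has_field_derivative_transform_within_open[of _ _ _ "{..<0}"]) (auto simp: flat_def 2)
    then show ?thesis using 2 by (simp add: flat_def)
  next
    case 3
    \<comment> \<open>At the origin the difference quotient is again a member of the family, whose
      limit is already known to be 0.\<close>
    have "(flat k y - flat k 0) / (y - 0) = flat (Suc k) y" for y
      by (simp add: flat_def divide_inverse)
    then have "(flat k has_real_derivative 0) (at 0)"
      using flat_tendsto_0[of "Suc k"] by (simp add: has_field_derivative_iff)
    then show ?thesis using 3 by (simp add: flat_def)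
  qed
qed

lemma Ck_on_flat: "Ck_on n (flat k) UNIV"
proof (induction n arbitrary: k)
  case 0
  have "isCont (flat k) x" for x using flat_has_derivative DERIV_isCont by blast
  then show ?case by (simp add: continuous_at_imp_continuous_on)
next
  case (Suc n)
  show ?case
    by (rule Ck_on_SucI[OF open_UNIV flat_has_derivative[unfolded has_field_derivative_def]])
       (intro Ck_on_bilinear[OF bounded_bilinear_mult] Ck_on_const Ck_on_add Suc open_UNIV)
qed

section \<open>Charts and continuity\<close>

locale lie_grp = group G for G :: "('g, 'e::euclidean_space) lie_data" (structure) +
  assumes lie_group: "lie_group G"
begin

abbreviation T where "T \<equiv> topol G"

lemma topspace_T [simp]: "topspace T = carrier G"
  using lie_group by (simp add: lie_group_def)

lemma Hausdorff_T: "Hausdorff_space T"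
  using lie_group by (simp add: lie_group_def)

lemma continuous_mult:
  assumes "continuous_map X T f" "continuous_map X T g"
  shows "continuous_map X T (\<lambda>x. f x \<otimes> g x)"
proof -
  have "continuous_map (prod_topology T T) T (\<lambda>(x, y). x \<otimes> y)"
    using lie_group by (simp add: lie_group_def smooth_mult_def)
  from continuous_map_compose[OF _ this, of X "\<lambda>x. (f x, g x)"] show ?thesis
    using assms by (simp add: continuous_map_pairedI o_def)
qed

lemma continuous_inv:
  assumes "continuous_map X T f"
  shows "continuous_map X T (\<lambda>x. inv f x)"
proof -
  have "continuous_map T T (\<lambda>x. inv x)"
    using lie_group by (simp add: lie_group_def smooth_self_map_def)
  from continuous_map_compose[OF assms this] show ?thesis by (simp add: o_def)
qed

lemma continuous_const_map: "x \<in> carrier G \<Longrightarrow> continuous_map X T (\<lambda>_. x)"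
  by simp

lemma limitin_mult:
  assumes "limitin T x l F" "limitin T y k F"
  shows "limitin T (\<lambda>n. x n \<otimes> y n) (l \<otimes> k) F"
proof -
  have "continuous_map (prod_topology T T) T (\<lambda>(x, y). x \<otimes> y)"
    using lie_group by (simp add: lie_group_def smooth_mult_def)
  moreover have "limitin (prod_topology T T) (\<lambda>n. (x n, y n)) (l, k) F"
    using assms by (simp add: limitin_pairwise o_def)
  ultimately show ?thesis
    using continuous_map_limit[of "prod_topology T T" T "\<lambda>(x, y). x \<otimes> y" "\<lambda>n. (x n, y n)" "(l,k)" F]
    by (simp add: o_def)
qed

lemma limitin_inv:
  assumes "limitin T x l F"
  shows "limitin T (\<lambda>n. inv x n) (inv l) F"
  using continuous_map_limit[OF continuous_inv[OF continuous_map_id] , of x l F] assms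
  by (simp add: o_def)

lemma chart:
  assumes "(U, \<phi>) \<in> atlas G"
  shows chart_openin: "openin T U" and chart_carrier: "U \<subseteq> carrier G" and chart_open: "open (\<phi> ` U)"
    and chart_inj: "inj_on \<phi> U"
    and chart_cont: "continuous_map (subtopology T U) euclidean \<phi>"
    and chart_inv_cont: "continuous_map (top_of_set (\<phi> ` U)) T (inv_into U \<phi>)"
proof -
  have *: "openin T U \<and> open (\<phi> ` U) \<and> homeomorphic_map (subtopology T U) (top_of_set (\<phi> ` U)) \<phi>"
    using lie_group assms by (auto simp: lie_group_def smooth_atlas_def)
  then show "openin T U" "open (\<phi> ` U)" by auto
  show U: "U \<subseteq> carrier G" using * openin_subset by fastforce
  then have tU: "topspace (subtopology T U) = U" by auto
  have h: "homeomorphic_map (subtopology T U) (top_of_set (\<phi> ` U)) \<phi>" using * by auto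
  show inj: "inj_on \<phi> U" using h tU by (simp add: homeomorphic_eq_everything_map)
  show "continuous_map (subtopology T U) euclidean \<phi>"
    using h continuous_map_in_subtopology by (metis homeomorphic_imp_continuous_map)
  obtain k where k: "homeomorphic_maps (subtopology T U) (top_of_set (\<phi> ` U)) \<phi> k"
    using h by (auto simp: homeomorphic_map_maps)
  then have "continuous_map (top_of_set (\<phi> ` U)) T k"
    unfolding homeomorphic_maps_def using continuous_map_in_subtopology by blast
  then show "continuous_map (top_of_set (\<phi> ` U)) T (inv_into U \<phi>)"
    by (rule continuous_map_eq) (use k tU inj in \<open>auto simp: homeomorphic_maps_def\<close>)
qed

lemma chart_image_open:
  assumes c: "(U, \<phi>) \<in> atlas G" and "openin T S" "S \<subseteq> U"
  shows "open (\<phi> ` S)"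
proof -
  have "homeomorphic_map (subtopology T U) (top_of_set (\<phi> ` U)) \<phi>"
    using lie_group c by (auto simp: lie_group_def smooth_atlas_def)
  then have "openin (top_of_set (\<phi> ` U)) (\<phi> ` S)"
    using assms homeomorphic_map_openness_eq openin_subset_topspace_eq
    by (metis openin_open_subtopology chart_openin)
  then show ?thesis using chart_open[OF c] openin_open_eq by blast
qed

lemma chart_exists: "x \<in> carrier G \<Longrightarrow> \<exists>U \<phi>. (U, \<phi>) \<in> atlas G \<and> x \<in> U"
proof -
  assume "x \<in> carrier G"
  moreover have "(\<Union>(U, \<phi>)\<in>atlas G. U) = carrier G"
    using lie_group by (simp add: lie_group_def smooth_atlas_def)
  ultimately show ?thesis by blast
qed

lemma chart_preimage_openin:
  assumes "(U, \<phi>) \<in> atlas G" "open S"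
  shows "openin T {x \<in> U. \<phi> x \<in> S}"
proof -
  have "openin (subtopology T U) {x \<in> topspace (subtopology T U). \<phi> x \<in> S}"
    using openin_continuous_map_preimage[OF chart_cont[OF assms(1)]] assms(2) by simp
  moreover have "topspace (subtopology T U) = U" using chart_carrier[OF assms(1)] by auto
  moreover have "{x \<in> topspace (subtopology T U). \<phi> x \<in> S} = {x \<in> U. \<phi> x \<in> S}"
    using chart_carrier[OF assms(1)] by auto
  ultimately show ?thesis using chart_openin[OF assms(1)] by (metis openin_open_subtopology)
qed

lemma chart_limit:
  assumes c: "(U, \<phi>) \<in> atlas G" and l: "limitin T x l F" "l \<in> U"
  shows "((\<lambda>n. \<phi> (x n)) \<longlongrightarrow> \<phi> l) F"
proof (rule topological_tendstoI)
  fix S assume "open S" "\<phi> l \<in> S"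
  then have "openin T {x \<in> U. \<phi> x \<in> S}" "l \<in> {x \<in> U. \<phi> x \<in> S}"
    using chart_preimage_openin[OF c] l(2) by auto
  then have "\<forall>\<^sub>F n in F. x n \<in> {x \<in> U. \<phi> x \<in> S}" using l(1) unfolding limitin_def by blast
  then show "\<forall>\<^sub>F n in F. \<phi> (x n) \<in> S" by (rule eventually_mono) simp
qed

lemma chart_inv_limit:
  assumes c: "(U, \<phi>) \<in> atlas G" and l: "(y \<longlongrightarrow> b) F" "b \<in> \<phi> ` U"
  shows "limitin T (\<lambda>n. inv_into U \<phi> (y n)) (inv_into U \<phi> b) F"
proof -
  have ev: "\<forall>\<^sub>F n in F. y n \<in> \<phi> ` U"
    using l chart_open[OF c] topological_tendstoD by blast
  have "limitin (top_of_set (\<phi> ` U)) y b F"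
    using l ev by (simp add: limitin_subtopology)
  then show ?thesis using continuous_map_limit[OF chart_inv_cont[OF c]] by (simp add: o_def)
qed

text \<open>\<open>Ck_on\<close> is meant for open sets, and the smoothness axiom for the product
  uses this set as a domain; its openness comes from continuity of the product.\<close>

lemma mult_domain_open:
  assumes U: "(U, \<phi>) \<in> atlas G" and V: "(V, \<psi>) \<in> atlas G" and W: "(W, \<omega>) \<in> atlas G"
  shows "open {(\<phi> x, \<psi> y) | x y. x \<in> U \<and> y \<in> V \<and> x \<otimes> y \<in> W}" (is "open ?D")
proof (subst open_prod_def, intro ballI)
  fix p assume "p \<in> ?D"
  then obtain x y where p: "p = (\<phi> x, \<psi> y)" "x \<in> U" "y \<in> V" "x \<otimes> y \<in> W" by auto
  have cont: "continuous_map (prod_topology T T) T (\<lambda>(x, y). x \<otimes> y)"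
    using lie_group by (simp add: lie_group_def smooth_mult_def)
  have "openin (prod_topology T T) {q \<in> topspace (prod_topology T T). (case q of (x, y) \<Rightarrow> x \<otimes> y) \<in> W}"
    using openin_continuous_map_preimage[OF cont chart_openin[OF W]] .
  moreover have "(x, y) \<in> {q \<in> topspace (prod_topology T T). (case q of (x, y) \<Rightarrow> x \<otimes> y) \<in> W}"
    using p chart_carrier[OF U] chart_carrier[OF V] by auto
  ultimately obtain A B where AB: "openin T A" "openin T B" "x \<in> A" "y \<in> B"
    "A \<times> B \<subseteq> {q \<in> topspace (prod_topology T T). (case q of (x, y) \<Rightarrow> x \<otimes> y) \<in> W}"
    unfolding openin_prod_topology_alt by meson
  have "open (\<phi> ` (A \<inter> U))" "open (\<psi> ` (B \<inter> V))"
    using chart_image_open[OF U] chart_image_open[OF V] AB chart_openin[OF U] chart_openin[OF V]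
    by auto
  moreover have "p \<in> \<phi> ` (A \<inter> U) \<times> \<psi> ` (B \<inter> V)" using p AB by auto
  moreover have "\<phi> ` (A \<inter> U) \<times> \<psi> ` (B \<inter> V) \<subseteq> ?D"
  proof safe
    fix x y assume "x \<in> A" "x \<in> U" "y \<in> B" "y \<in> V"
    moreover from this have "x \<otimes> y \<in> W" using AB(5) by auto
    ultimately show "\<exists>x' y'. (\<phi> x, \<psi> y) = (\<phi> x', \<psi> y') \<and> x' \<in> U \<and> y' \<in> V \<and> x' \<otimes> y' \<in> W" by blast
  qed
  ultimately show "\<exists>A B. open A \<and> open B \<and> p \<in> A \<times> B \<and> A \<times> B \<subseteq> ?D" by blast
qed

lemma mult_Ck:
  assumes "(U, \<phi>) \<in> atlas G" and "(V, \<psi>) \<in> atlas G" and "(W, \<omega>) \<in> atlas G"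
  shows "Ck_on k (\<lambda>(a, b). \<omega> (inv_into U \<phi> a \<otimes> inv_into V \<psi> b))
     {(\<phi> x, \<psi> y) | x y. x \<in> U \<and> y \<in> V \<and> x \<otimes> y \<in> W}"
  using lie_group assms unfolding lie_group_def smooth_mult_def smooth_on_def by blast

text \<open>Translation is a slice of multiplication: in coordinates it is multiplication composed
  with the affine map b -> (\<phi> g, b), and its domain is the preimage of the domain of
  multiplication.\<close>

lemma left_translation_Ck:
  assumes g: "g \<in> carrier G" and V: "(V, \<psi>) \<in> atlas G" and W: "(W, \<omega>) \<in> atlas G"
  shows "open {\<psi> y | y. y \<in> V \<and> g \<otimes> y \<in> W}"
    and "Ck_on k (\<lambda>b. \<omega> (g \<otimes> inv_into V \<psi> b)) {\<psi> y | y. y \<in> V \<and> g \<otimes> y \<in> W}"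
proof -
  obtain U \<phi> where U: "(U, \<phi>) \<in> atlas G" "g \<in> U" using chart_exists[OF g] by blast
  let ?D = "{(\<phi> x, \<psi> y) | x y. x \<in> U \<and> y \<in> V \<and> x \<otimes> y \<in> W}"
  let ?S = "{\<psi> y | y. y \<in> V \<and> g \<otimes> y \<in> W}"
  have eq: "?S = (\<lambda>b. (\<phi> g, b)) -` ?D"
    using U inj_onD[OF chart_inj[OF U(1)]] by auto
  show S: "open ?S"
    unfolding eq by (intro open_vimage mult_domain_open[OF U(1) V W] continuous_intros)
  have "Ck_on k (\<lambda>b. (\<phi> g, 0) + (0, b)) ?S"
    by (intro Ck_on_add S Ck_on_const Ck_on_linear bounded_linear_Pair bounded_linear_zero bounded_linear_ident)
  then have "Ck_on k (\<lambda>b. (\<phi> g, b)) ?S" by simp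
  from Ck_on_compose[OF S this _ mult_Ck[OF U(1) V W]]
  have "Ck_on k (\<lambda>b. \<omega> (inv_into U \<phi> (\<phi> g) \<otimes> inv_into V \<psi> b)) ?S"
    unfolding eq by auto
  then show "Ck_on k (\<lambda>b. \<omega> (g \<otimes> inv_into V \<psi> b)) ?S"
    using inv_into_f_f[OF chart_inj[OF U(1)] U(2)] by simp
qed

lemma right_translation_Ck:
  assumes g: "g \<in> carrier G" and V: "(V, \<psi>) \<in> atlas G" and W: "(W, \<omega>) \<in> atlas G"
  shows "open {\<psi> y | y. y \<in> V \<and> y \<otimes> g \<in> W}"
    and "Ck_on k (\<lambda>b. \<omega> (inv_into V \<psi> b \<otimes> g)) {\<psi> y | y. y \<in> V \<and> y \<otimes> g \<in> W}"
proof -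
  obtain U \<phi> where U: "(U, \<phi>) \<in> atlas G" "g \<in> U" using chart_exists[OF g] by blast
  let ?D = "{(\<psi> x, \<phi> y) | x y. x \<in> V \<and> y \<in> U \<and> x \<otimes> y \<in> W}"
  let ?S = "{\<psi> y | y. y \<in> V \<and> y \<otimes> g \<in> W}"
  have eq: "?S = (\<lambda>b. (b, \<phi> g)) -` ?D"
    using U inj_onD[OF chart_inj[OF U(1)]] by auto
  show S: "open ?S"
    unfolding eq by (intro open_vimage mult_domain_open[OF V U(1) W] continuous_intros)
  have "Ck_on k (\<lambda>b. (0, \<phi> g) + (b, 0)) ?S"
    by (intro Ck_on_add S Ck_on_const Ck_on_linear bounded_linear_Pair bounded_linear_zero bounded_linear_ident)
  then have "Ck_on k (\<lambda>b. (b, \<phi> g)) ?S" by simp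
  from Ck_on_compose[OF S this _ mult_Ck[OF V U(1) W]]
  have "Ck_on k (\<lambda>b. \<omega> (inv_into V \<psi> b \<otimes> inv_into U \<phi> (\<phi> g))) ?S"
    unfolding eq by auto
  then show "Ck_on k (\<lambda>b. \<omega> (inv_into V \<psi> b \<otimes> g)) ?S"
    using inv_into_f_f[OF chart_inj[OF U(1)] U(2)] by simp
qed

section \<open>Coordinates at the identity\<close>

definition U0 where "U0 = fst (id_chart G)"
abbreviation c where "c \<equiv> uncoord G"
abbreviation crd where "crd \<equiv> coord G"
text \<open>The chart is not normalised, so the identity need not have coordinate 0: all expansions
  are around \<open>E\<close> and concern differences \<open>b - E\<close>.\<close>

definition E where "E = coord G \<one>"
definition dom where "dom = crd ` U0"

lemma id_chart: "(U0, crd) \<in> atlas G" and one_U0: "\<one> \<in> U0"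
proof -
  have "\<exists>p. p \<in> atlas G \<and> \<one> \<in> fst p" using chart_exists[OF one_closed] by fastforce
  from someI_ex[OF this] have "id_chart G \<in> atlas G \<and> \<one> \<in> fst (id_chart G)"
    unfolding id_chart_def .
  then show "(U0, crd) \<in> atlas G" "\<one> \<in> U0" by (auto simp: U0_def coord_def)
qed

lemma uncoord_eq: "c = inv_into U0 crd"
  by (simp add: uncoord_def U0_def)

lemma U0_carrier: "x \<in> U0 \<Longrightarrow> x \<in> carrier G"
  using chart_carrier[OF id_chart] by auto

lemma c_crd [simp]: "x \<in> U0 \<Longrightarrow> c (crd x) = x"
  using chart_inj[OF id_chart] by (simp add: uncoord_eq)

lemma crd_c [simp]: "b \<in> dom \<Longrightarrow> crd (c b) = b"
  by (auto simp: dom_def)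

lemma c_U0: "b \<in> dom \<Longrightarrow> c b \<in> U0"
  by (auto simp: dom_def)

lemma c_carrier [simp]: "b \<in> dom \<Longrightarrow> c b \<in> carrier G"
  using c_U0 U0_carrier by auto

lemma crd_dom [simp]: "x \<in> U0 \<Longrightarrow> crd x \<in> dom"
  by (auto simp: dom_def)

lemma open_dom: "open dom"
  using chart_open[OF id_chart] by (simp add: dom_def)

lemma E_dom [simp]: "E \<in> dom"
  by (simp add: E_def one_U0)

lemma c_E [simp]: "c E = \<one>"
  by (simp add: E_def one_U0)

lemma crd_limit: "limitin T x l F \<Longrightarrow> l \<in> U0 \<Longrightarrow> ((\<lambda>n. crd (x n)) \<longlongrightarrow> crd l) F"
  by (rule chart_limit[OF id_chart])

lemma crd_limit_one: "limitin T x \<one> F \<Longrightarrow> ((\<lambda>n. crd (x n)) \<longlongrightarrow> E) F"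
  using crd_limit[OF _ one_U0] by (simp add: E_def)

lemma c_limit: "(y \<longlongrightarrow> b) F \<Longrightarrow> b \<in> dom \<Longrightarrow> limitin T (\<lambda>n. c (y n)) (c b) F"
  using chart_inv_limit[OF id_chart] by (simp add: uncoord_eq dom_def)

lemma limitin_eventually_U0: "limitin T x l F \<Longrightarrow> l \<in> U0 \<Longrightarrow> \<forall>\<^sub>F n in F. x n \<in> U0"
  using chart_openin[OF id_chart] by (simp add: limitin_def)

text \<open>The group law read in the identity chart. It is meaningful on the open set
  \<open>D\<close>, which contains all pairs with one entry \<open>E\<close>.\<close>

definition M :: "'e \<times> 'e \<Rightarrow> 'e" where "M p = crd (c (fst p) \<otimes> c (snd p))"
definition D where "D = {p. fst p \<in> dom \<and> snd p \<in> dom \<and> c (fst p) \<otimes> c (snd p) \<in> U0}"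

lemma D_eq: "D = {(crd x, crd y) | x y. x \<in> U0 \<and> y \<in> U0 \<and> x \<otimes> y \<in> U0}"
proof safe
  fix a b assume "(a, b) \<in> D"
  then have "a = crd (c a)" "b = crd (c b)" "c a \<in> U0" "c b \<in> U0" "c a \<otimes> c b \<in> U0"
    by (auto simp: D_def c_U0)
  then show "\<exists>x y. (a, b) = (crd x, crd y) \<and> x \<in> U0 \<and> y \<in> U0 \<and> x \<otimes> y \<in> U0" by metis
qed (auto simp: D_def)

lemma open_D: "open D"
  unfolding D_eq by (rule mult_domain_open) (rule id_chart)+

lemma M_Ck: "Ck_on k M D"
proof -
  have "M = (\<lambda>(a, b). crd (inv_into U0 crd a \<otimes> inv_into U0 crd b))"
    by (auto simp: M_def uncoord_eq)
  then show ?thesis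
    unfolding D_eq by (simp only: mult_Ck[OF id_chart id_chart id_chart])
qed

lemma D_left [simp]: "a \<in> dom \<Longrightarrow> (a, E) \<in> D" and D_right [simp]: "a \<in> dom \<Longrightarrow> (E, a) \<in> D"
  by (auto simp: D_def c_U0)

lemma M_left [simp]: "a \<in> dom \<Longrightarrow> M (a, E) = a" and M_right [simp]: "a \<in> dom \<Longrightarrow> M (E, a) = a"
  by (auto simp: M_def)

lemma M_dom: "p \<in> D \<Longrightarrow> M p \<in> dom" and c_M: "p \<in> D \<Longrightarrow> c (M p) = c (fst p) \<otimes> c (snd p)"
  by (auto simp: D_def M_def)

abbreviation M' where "M' p \<equiv> frechet_derivative M (at p)"

lemma M_deriv: "p \<in> D \<Longrightarrow> (M has_derivative M' p) (at p)"
  using Ck_on_Suc_has_derivative[OF M_Ck] .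

lemma M'_linear: "p \<in> D \<Longrightarrow> linear (M' p)"
  using M_deriv has_derivative_linear by blast

text \<open>In coordinates, \<open>Q\<close> is the left-invariant vector field with value w at the
  identity (the derivative of left translation by \<open>c a\<close>), and \<open>P\<close> is the
  right-invariant field with value v.\<close>

definition Q where "Q a w = M' (a, E) (0, w)"
definition P where "P b v = M' (E, b) (v, 0)"

lemma Q_linear: "a \<in> dom \<Longrightarrow> linear (Q a)"
  using M'_linear[of "(a, E)"] unfolding Q_def linear_iff
  by simp (metis add.right_neutral add_Pair scaleR_Pair scaleR_zero_right)

lemma P_linear: "a \<in> dom \<Longrightarrow> linear (P a)"
  using M'_linear[of "(E, a)"] unfolding P_def linear_iff
  by simp (metis add.right_neutral add_Pair scaleR_Pair scaleR_zero_right)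

lemma Q_Ck: "Ck_on k (\<lambda>a. Q a w) dom"
proof -
  have "Ck_on k (\<lambda>a. (a, 0) + (0, E)) dom"
    by (intro Ck_on_add open_dom Ck_on_const Ck_on_linear bounded_linear_Pair bounded_linear_zero bounded_linear_ident)
  then have "Ck_on k (\<lambda>a. (a, E)) dom" by simp
  from Ck_on_compose[OF open_dom this _ Ck_on_SucD[OF M_Ck, of _ "(0, w)"]]
  show ?thesis unfolding Q_def by (simp add: image_subset_iff)
qed

lemma P_Ck: "Ck_on k (\<lambda>a. P a w) dom"
proof -
  have "Ck_on k (\<lambda>a. (0, a) + (E, 0)) dom"
    by (intro Ck_on_add open_dom Ck_on_const Ck_on_linear bounded_linear_Pair bounded_linear_zero bounded_linear_ident)
  then have "Ck_on k (\<lambda>a. (E, a)) dom" by simp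
  from Ck_on_compose[OF open_dom this _ Ck_on_SucD[OF M_Ck, of _ "(w, 0)"]]
  show ?thesis unfolding P_def by (simp add: image_subset_iff)
qed

lemma M_deriv_snd:
  assumes p: "(a, b) \<in> D" and f: "(f has_derivative f') (at x within S)" "f x = b"
  shows "((\<lambda>x. M (a, f x)) has_derivative (\<lambda>h. M' (a, b) (0, f' h))) (at x within S)"
proof -
  have "((\<lambda>x. (a, f x)) has_derivative (\<lambda>h. (0, f' h))) (at x within S)"
    by (intro has_derivative_Pair f has_derivative_const)
  from has_derivative_compose[OF this] M_deriv[OF p] show ?thesis using f(2) by auto
qed

lemma M_deriv_fst:
  assumes p: "(a, b) \<in> D" and f: "(f has_derivative f') (at x within S)" "f x = a"
  shows "((\<lambda>x. M (f x, b)) has_derivative (\<lambda>h. M' (a, b) (f' h, 0))) (at x within S)"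
proof -
  have "((\<lambda>x. (f x, b)) has_derivative (\<lambda>h. (f' h, 0))) (at x within S)"
    by (intro has_derivative_Pair f has_derivative_const)
  from has_derivative_compose[OF this] M_deriv[OF p] show ?thesis using f(2) by auto
qed

lemma Q_E [simp]: "Q E w = w"
proof -
  have "((\<lambda>b. M (E, b)) has_derivative (\<lambda>h. M' (E, E) (0, h))) (at E)"
    by (rule M_deriv_snd) (auto intro: has_derivative_ident)
  moreover have "((\<lambda>b. M (E, b)) has_derivative (\<lambda>h. h)) (at E)"
    by (rule has_derivative_transform_within_open[OF has_derivative_ident open_dom]) auto
  ultimately show ?thesis unfolding Q_def using has_derivative_unique by metis
qed

lemma P_E [simp]: "P E w = w"
proof -
  have "((\<lambda>b. M (b, E)) has_derivative (\<lambda>h. M' (E, E) (h, 0))) (at E)"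
    by (rule M_deriv_fst) (auto intro: has_derivative_ident)
  moreover have "((\<lambda>b. M (b, E)) has_derivative (\<lambda>h. h)) (at E)"
    by (rule has_derivative_transform_within_open[OF has_derivative_ident open_dom]) auto
  ultimately show ?thesis unfolding P_def using has_derivative_unique by metis
qed

text \<open>Left invariance of the field \<open>Q\<close>: the associative law M (a, M (b, z)) = M
  (M (a, b), z) is differentiated at z = E.\<close>

lemma Q_M:
  assumes ab: "(a, b) \<in> D"
  shows "Q (M (a, b)) w = M' (a, b) (0, Q b w)"
proof -
  have d: "a \<in> dom" "b \<in> dom" using ab by (auto simp: D_def)
  have 1: "((\<lambda>z. M (b, z)) has_derivative (\<lambda>h. M' (b, E) (0, h))) (at E)"
    by (rule M_deriv_snd) (use d in \<open>auto intro: has_derivative_ident\<close>)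
  have 2: "((\<lambda>z. M (a, M (b, z))) has_derivative (\<lambda>h. M' (a, b) (0, M' (b, E) (0, h)))) (at E)"
    by (rule M_deriv_snd[OF ab 1]) (use d in auto)
  have 3: "((\<lambda>z. M (M (a, b), z)) has_derivative (\<lambda>h. M' (M (a, b), E) (0, h))) (at E)"
    by (rule M_deriv_snd) (use M_dom[OF ab] in \<open>auto intro: has_derivative_ident\<close>)
  have "((\<lambda>z. (b, z)) \<longlongrightarrow> (b, E)) (at E)" by (intro tendsto_intros)
  then have e1: "\<forall>\<^sub>F z in at E. (b, z) \<in> D"
    by (rule topological_tendstoD[OF _ open_D]) (use d in auto)
  have "((\<lambda>z. (a, M (b, z))) \<longlongrightarrow> (a, b)) (at E)"
    using has_derivative_continuous[OF 1] d by (intro tendsto_intros) (auto simp: continuous_within)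
  then have e2: "\<forall>\<^sub>F z in at E. (a, M (b, z)) \<in> D"
    by (rule topological_tendstoD[OF _ open_D]) (use ab in auto)
  have "((\<lambda>z. (M (a, b), z)) \<longlongrightarrow> (M (a, b), E)) (at E)" by (intro tendsto_intros)
  then have e3: "\<forall>\<^sub>F z in at E. (M (a, b), z) \<in> D"
    by (rule topological_tendstoD[OF _ open_D]) (use M_dom[OF ab] in auto)
  have e: "\<forall>\<^sub>F z in at E. M (a, M (b, z)) = M (M (a, b), z)"
    using e1 e2 e3
  proof eventually_elim
    case (elim z)
    have "c (M (b, z)) = c b \<otimes> c z" "c (M (a, b)) = c a \<otimes> c b"
      using c_M[OF elim(1)] c_M[OF ab] by auto
    moreover have "z \<in> dom" using elim(1) by (auto simp: D_def)
    ultimately show ?case using d by (simp add: M_def m_assoc)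
  qed
  have "((\<lambda>z. M (M (a, b), z)) has_derivative (\<lambda>h. M' (a, b) (0, M' (b, E) (0, h)))) (at E)"
    by (rule has_derivative_transform_eventually[OF 2 e]) (use d ab M_dom[OF ab] in auto)
  then show ?thesis using has_derivative_unique[OF 3] unfolding Q_def by metis
qed

end

lemma has_vector_derivative_at_0_iff:
  "(f has_vector_derivative B) (at (0::real)) \<longleftrightarrow> ((\<lambda>t. (f t - f 0) /\<^sub>R t) \<longlongrightarrow> B) (at 0)"
proof -
  have *: "norm (f t - f 0 - t *\<^sub>R B) / norm t = dist ((f t - f 0) /\<^sub>R t) B" if "t \<noteq> 0" for t
  proof -
    have "f t - f 0 - t *\<^sub>R B = t *\<^sub>R ((f t - f 0) /\<^sub>R t - B)" using that by (simp add: algebra_simps)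
    then show ?thesis using that by (simp add: dist_norm)
  qed
  have "(f has_vector_derivative B) (at 0) \<longleftrightarrow> ((\<lambda>t. norm (f t - f 0 - t *\<^sub>R B) / norm t) \<longlongrightarrow> 0) (at 0)"
    by (simp add: has_vector_derivative_def has_derivative_iff_norm bounded_linear_scaleR_left)
  also have "\<dots> \<longleftrightarrow> ((\<lambda>t. dist ((f t - f 0) /\<^sub>R t) B) \<longlongrightarrow> 0) (at 0)"
    by (rule tendsto_cong) (use * in \<open>simp add: eventually_at_filter\<close>)
  also have "\<dots> \<longleftrightarrow> ((\<lambda>t. (f t - f 0) /\<^sub>R t) \<longlongrightarrow> B) (at 0)"
    by (rule tendsto_dist_iff[symmetric])
  finally show ?thesis .
qed

context lie_grp
begin

section \<open>Differentials of endomorphisms and the adjoint representation\<close>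

text \<open>A common notion for involutions and conjugations. Differentiability at the identity is
  what \<open>differential\<close> is about and what carries one-parameter subgroups to
  one-parameter subgroups.\<close>

definition lie_hom :: "('g \<Rightarrow> 'g) \<Rightarrow> bool" where
  "lie_hom \<phi> \<longleftrightarrow> \<phi> \<in> hom G G \<and> continuous_map T T \<phi> \<and> (\<lambda>b. crd (\<phi> (c b))) differentiable at E"

lemma lie_hom_closed: "lie_hom \<phi> \<Longrightarrow> x \<in> carrier G \<Longrightarrow> \<phi> x \<in> carrier G"
  and lie_hom_mult: "lie_hom \<phi> \<Longrightarrow> x \<in> carrier G \<Longrightarrow> y \<in> carrier G \<Longrightarrow> \<phi> (x \<otimes> y) = \<phi> x \<otimes> \<phi> y"
  by (auto simp: lie_hom_def hom_def)

lemma lie_hom_group_hom: "lie_hom \<phi> \<Longrightarrow> group_hom G G \<phi>"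
  by (simp add: lie_hom_def group_hom_def group_hom_axioms_def is_group)

lemma lie_hom_one [simp]: "lie_hom \<phi> \<Longrightarrow> \<phi> \<one> = \<one>"
  using lie_hom_group_hom group_hom.hom_one by fastforce

lemma lie_hom_inv: "lie_hom \<phi> \<Longrightarrow> x \<in> carrier G \<Longrightarrow> \<phi> (inv x) = inv (\<phi> x)"
  using lie_hom_group_hom group_hom.hom_inv by fastforce

lemma lie_hom_limit: "lie_hom \<phi> \<Longrightarrow> limitin T x l F \<Longrightarrow> limitin T (\<lambda>n. \<phi> (x n)) (\<phi> l) F"
  using continuous_map_limit[of T T \<phi> x l F] by (simp add: lie_hom_def o_def)

lemma lie_hom_has_derivative:
  assumes "lie_hom \<phi>"
  shows "((\<lambda>b. crd (\<phi> (c b))) has_derivative differential G \<phi>) (at E)"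
  using assms frechet_derivative_works unfolding lie_hom_def differential_def E_def by blast

lemma differential_linear: "lie_hom \<phi> \<Longrightarrow> linear (differential G \<phi>)"
  using lie_hom_has_derivative has_derivative_linear by blast

lemma c_tendsto_one: "(y \<longlongrightarrow> E) F \<Longrightarrow> limitin T (\<lambda>n. c (y n)) \<one> F"
  using c_limit[of y E F] by simp

lemma lie_hom_eventually_U0:
  assumes "lie_hom \<phi>"
  shows "\<forall>\<^sub>F b in nhds E. b \<in> dom \<and> \<phi> (c b) \<in> U0"
proof -
  have 1: "\<forall>\<^sub>F b in nhds E. b \<in> dom" by (rule eventually_nhds_in_open[OF open_dom E_dom])
  have "limitin T (\<lambda>b. c b) \<one> (nhds E)" by (rule c_tendsto_one) (simp add: filterlim_ident)
  from lie_hom_limit[OF assms this] have "\<forall>\<^sub>F b in nhds E. \<phi> (c b) \<in> U0"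
    by (rule limitin_eventually_U0) (simp add: assms one_U0)
  with 1 show ?thesis by eventually_elim simp
qed

lemma lie_hom_curve:
  assumes \<phi>: "lie_hom \<phi>" and \<gamma>: "limitin T \<gamma> \<one> (at x)" "\<gamma> x = \<one>"
    and d: "((\<lambda>t. crd (\<gamma> t)) has_derivative g') (at x)"
  shows "((\<lambda>t. crd (\<phi> (\<gamma> t))) has_derivative (\<lambda>h. differential G \<phi> (g' h))) (at x)"
proof -
  have "((\<lambda>b. crd (\<phi> (c b))) has_derivative differential G \<phi>) (at (crd (\<gamma> x)))"
    using lie_hom_has_derivative[OF \<phi>] \<gamma> by (simp add: E_def)
  from has_derivative_compose[OF d this]
  have *: "((\<lambda>t. crd (\<phi> (c (crd (\<gamma> t))))) has_derivative (\<lambda>h. differential G \<phi> (g' h))) (at x)" .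
  have "\<forall>\<^sub>F t in at x. \<gamma> t \<in> U0"
    by (rule limitin_eventually_U0[OF \<gamma>(1) one_U0])
  then have "\<forall>\<^sub>F t in at x. crd (\<phi> (c (crd (\<gamma> t)))) = crd (\<phi> (\<gamma> t))"
    by eventually_elim simp
  moreover have "crd (\<phi> (c (crd (\<gamma> x)))) = crd (\<phi> (\<gamma> x))" using \<gamma> one_U0 by simp
  ultimately show ?thesis
    by (intro has_derivative_transform_eventually[OF *]) simp_all
qed

lemma lie_hom_compose:
  assumes \<phi>: "lie_hom \<phi>" and \<psi>: "lie_hom \<psi>"
  shows "lie_hom (\<lambda>x. \<phi> (\<psi> x))"
    and "differential G (\<lambda>x. \<phi> (\<psi> x)) v = differential G \<phi> (differential G \<psi> v)"
proof -
  have l: "limitin T (\<lambda>b. \<psi> (c b)) \<one> (at E)"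
    using lie_hom_limit[OF \<psi>, of c \<one> "at E"] c_tendsto_one[of "\<lambda>b. b" "at E"] \<psi>
    by simp
  have d: "((\<lambda>b. crd (\<phi> (\<psi> (c b)))) has_derivative (\<lambda>h. differential G \<phi> (differential G \<psi> h))) (at E)"
    by (rule lie_hom_curve[OF \<phi> l _ lie_hom_has_derivative[OF \<psi>]]) (simp add: \<psi>)
  have "(\<lambda>x. \<phi> (\<psi> x)) \<in> hom G G"
    by (rule homI) (use \<phi> \<psi> in \<open>simp_all add: lie_hom_closed lie_hom_mult\<close>)
  moreover have "continuous_map T T (\<lambda>x. \<phi> (\<psi> x))"
    using \<phi> \<psi> continuous_map_compose[of T T \<psi> T \<phi>] by (simp add: lie_hom_def o_def)
  ultimately show "lie_hom (\<lambda>x. \<phi> (\<psi> x))"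
    using d by (auto simp: lie_hom_def differentiable_def)
  show "differential G (\<lambda>x. \<phi> (\<psi> x)) v = differential G \<phi> (differential G \<psi> v)"
    using frechet_derivative_at[OF d] unfolding differential_def E_def by metis
qed

lemma differential_cong:
  assumes "lie_hom \<phi>" "\<And>x. x \<in> carrier G \<Longrightarrow> \<phi> x = \<psi> x"
  shows "differential G \<phi> = differential G \<psi>"
proof -
  have "((\<lambda>b. crd (\<psi> (c b))) has_derivative differential G \<phi>) (at E)"
    by (rule has_derivative_transform_within_open[OF lie_hom_has_derivative[OF assms(1)] open_dom])
       (auto simp: assms(2))
  from frechet_derivative_at[OF this] show ?thesis unfolding differential_def E_def by metis
qed

lemma differential_id: "differential G (\<lambda>x. x) v = v"
proof -
  have "((\<lambda>b. crd (c b)) has_derivative (\<lambda>h. h)) (at E)"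
    by (rule has_derivative_transform_within_open[OF has_derivative_ident open_dom]) auto
  from frechet_derivative_at[OF this] show ?thesis unfolding differential_def E_def by metis
qed

lemma lie_hom_involution:
  assumes "group_involution G \<sigma>"
  shows "lie_hom \<sigma>"
proof -
  have h: "\<sigma> \<in> hom G G" and s: "smooth_self_map G \<sigma>" using assms by (auto simp: group_involution_def)
  interpret group_hom G G \<sigma>
    using h by (simp add: group_hom_def group_hom_axioms_def is_group)
  have "Ck_on (Suc 0) (\<lambda>a. crd (\<sigma> (inv_into U0 crd a))) (crd ` {x \<in> U0. \<sigma> x \<in> U0})"
    using s id_chart unfolding smooth_self_map_def smooth_on_def by blast
  moreover have "E \<in> crd ` {x \<in> U0. \<sigma> x \<in> U0}" using one_U0 by (auto simp: E_def intro!: image_eqI[of _ _ \<one>])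
  ultimately have "(\<lambda>a. crd (\<sigma> (c a))) differentiable at E"
    unfolding uncoord_eq using Ck_on_Suc_has_derivative differentiable_def by blast
  then show ?thesis using h s by (simp add: lie_hom_def smooth_self_map_def)
qed

lemma differential_involution:
  assumes "group_involution G \<sigma>"
  shows "differential G \<sigma> (differential G \<sigma> v) = v"
proof -
  have l: "lie_hom \<sigma>" by (rule lie_hom_involution[OF assms])
  have "differential G (\<lambda>x. \<sigma> (\<sigma> x)) = differential G (\<lambda>x. x)"
    by (rule differential_cong[OF lie_hom_compose(1)[OF l l]]) (use assms in \<open>simp add: group_involution_def\<close>)
  then show ?thesis using lie_hom_compose(2)[OF l l] differential_id by metis
qed

lemma lie_hom_conj:
  assumes g: "g \<in> carrier G"
  shows "lie_hom (\<lambda>x. g \<otimes> x \<otimes> inv g)"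
proof -
  have h: "(\<lambda>x. g \<otimes> x \<otimes> inv g) \<in> hom G G"
  proof (rule homI)
    fix x y assume "x \<in> carrier G" "y \<in> carrier G"
    then show "g \<otimes> (x \<otimes> y) \<otimes> inv g = g \<otimes> x \<otimes> inv g \<otimes> (g \<otimes> y \<otimes> inv g)"
      using g by (simp add: m_assoc) (simp add: m_assoc[symmetric] )
  qed (use g in simp)
  have ct: "continuous_map T T (\<lambda>x. g \<otimes> x \<otimes> inv g)"
    by (intro continuous_mult continuous_const_map continuous_map_id[unfolded id_def]) (use g in auto)
  \<comment> \<open>The product of g with a point near the identity leaves the identity chart. A
    chart around g holds this intermediate point between left translation by g and right translation
    by its inverse.\<close>
  obtain V \<psi> where V: "(V, \<psi>) \<in> atlas G" "g \<in> V" using chart_exists[OF g] by blast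
  let ?L = "{crd y | y. y \<in> U0 \<and> g \<otimes> y \<in> V}" and ?R = "{\<psi> y | y. y \<in> V \<and> y \<otimes> inv g \<in> U0}"
  have L: "open ?L" "Ck_on (Suc 0) (\<lambda>b. \<psi> (g \<otimes> c b)) ?L"
    using left_translation_Ck[OF g id_chart V(1)] by (auto simp: uncoord_eq)
  have R: "Ck_on (Suc 0) (\<lambda>b. crd (inv_into V \<psi> b \<otimes> inv g)) ?R"
    by (rule right_translation_Ck[OF inv_closed[OF g] V(1) id_chart])
  have EL: "E \<in> ?L" using V g one_U0 by (auto simp: E_def intro!: exI[of _ \<one>])
  have gR: "\<psi> (g \<otimes> c E) \<in> ?R" using V g one_U0 by auto
  from has_derivative_compose[OF Ck_on_Suc_has_derivative[OF L(2) EL] Ck_on_Suc_has_derivative[OF R gR]]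
  have "(\<lambda>b. crd (inv_into V \<psi> (\<psi> (g \<otimes> c b)) \<otimes> inv g)) differentiable at E"
    by (rule differentiableI)
  moreover have "crd (inv_into V \<psi> (\<psi> (g \<otimes> c b)) \<otimes> inv g) = crd (g \<otimes> c b \<otimes> inv g)" if "b \<in> ?L" for b
  proof -
    have "g \<otimes> c b \<in> V" using that by auto
    then show ?thesis using inv_into_f_f[OF chart_inj[OF V(1)]] by simp
  qed
  ultimately have "(\<lambda>b. crd (g \<otimes> c b \<otimes> inv g)) differentiable at E"
    by (auto simp: differentiable_def intro: has_derivative_transform_within_open[OF _ L(1) EL])
  then show ?thesis using h ct by (simp add: lie_hom_def)
qed

lemma Ad_linear: "g \<in> carrier G \<Longrightarrow> linear (Ad G g)"
  using differential_linear[OF lie_hom_conj] by (simp add: Ad_def)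

lemma Ad_one: "Ad G \<one> v = v"
proof -
  have "differential G (\<lambda>x. \<one> \<otimes> x \<otimes> inv \<one>) = differential G (\<lambda>x. x)"
    by (rule differential_cong[OF lie_hom_conj]) auto
  then show ?thesis by (simp add: Ad_def differential_id)
qed

lemma Ad_mult:
  assumes "g \<in> carrier G" "h \<in> carrier G"
  shows "Ad G (g \<otimes> h) v = Ad G g (Ad G h v)"
proof -
  have "differential G (\<lambda>x. g \<otimes> (h \<otimes> x \<otimes> inv h) \<otimes> inv g) = differential G (\<lambda>x. (g \<otimes> h) \<otimes> x \<otimes> inv (g \<otimes> h))"
    by (rule differential_cong[OF lie_hom_compose(1)[OF lie_hom_conj lie_hom_conj]])
       (use assms in \<open>auto simp: m_assoc inv_mult_group\<close>)
  then show ?thesis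
    using lie_hom_compose(2)[OF lie_hom_conj[OF assms(1)] lie_hom_conj[OF assms(2)]]
    unfolding Ad_def by metis
qed

lemma Ad_inv_left: "g \<in> carrier G \<Longrightarrow> Ad G (inv g) (Ad G g v) = v"
  and Ad_inv_right: "g \<in> carrier G \<Longrightarrow> Ad G g (Ad G (inv g) v) = v"
  using Ad_mult[of "inv g" g v] Ad_mult[of g "inv g" v] Ad_one by auto

lemma lie_hom_Ad:
  assumes \<phi>: "lie_hom \<phi>" and g: "g \<in> carrier G"
  shows "differential G \<phi> (Ad G g v) = Ad G (\<phi> g) (differential G \<phi> v)"
proof -
  have "differential G (\<lambda>x. \<phi> (g \<otimes> x \<otimes> inv g)) = differential G (\<lambda>x. \<phi> g \<otimes> \<phi> x \<otimes> inv (\<phi> g))"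
    by (rule differential_cong[OF lie_hom_compose(1)[OF \<phi> lie_hom_conj[OF g]]])
       (use g in \<open>auto simp: lie_hom_mult[OF \<phi>] lie_hom_inv[OF \<phi>]\<close>)
  then show ?thesis
    using lie_hom_compose(2)[OF \<phi> lie_hom_conj[OF g]]
      lie_hom_compose(2)[OF lie_hom_conj[OF lie_hom_closed[OF \<phi> g]] \<phi>]
    unfolding Ad_def by metis
qed

text \<open>Both sides of b z = (b z b^-1) b are differentiated at z = 1. This expresses Ad
  implicitly by the smooth fields \<open>P\<close> and \<open>Q\<close>, and every regularity
  property of Ad below is drawn from it.\<close>

lemma P_Ad:
  assumes b: "b \<in> dom"
  shows "P b (Ad G (c b) v) = Q b v"
proof -
  let ?k = "\<lambda>z. c b \<otimes> c z \<otimes> inv (c b)"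
  have cb: "c b \<in> carrier G" using b by simp
  have dk: "((\<lambda>z. crd (?k z)) has_derivative Ad G (c b)) (at E)"
    using lie_hom_has_derivative[OF lie_hom_conj[OF cb]] unfolding Ad_def .
  have kE: "crd (?k E) = E" using cb c_E by (simp add: E_def[symmetric])
  have 1: "((\<lambda>z. M (crd (?k z), b)) has_derivative (\<lambda>h. M' (E, b) (Ad G (c b) h, 0))) (at E)"
    by (rule M_deriv_fst[OF _ dk kE]) (use b in simp)
  have 2: "((\<lambda>z. M (b, z)) has_derivative (\<lambda>h. M' (b, E) (0, h))) (at E)"
    by (rule M_deriv_snd) (use b in \<open>auto intro: has_derivative_ident\<close>)
  have "\<forall>\<^sub>F z in nhds E. z \<in> dom \<and> ?k z \<in> U0"
    by (rule lie_hom_eventually_U0[OF lie_hom_conj[OF cb]])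
  then have "\<forall>\<^sub>F z in nhds E. M (b, z) = M (crd (?k z), b)"
  proof eventually_elim
    case (elim z)
    have "?k z \<otimes> c b = c b \<otimes> c z" using cb elim by (simp add: m_assoc)
    moreover have "c (crd (?k z)) = ?k z" using elim by simp
    ultimately show ?case by (simp only: M_def fst_conv snd_conv)
  qed
  then have e: "\<forall>\<^sub>F z in at E. M (b, z) = M (crd (?k z), b)" "M (b, E) = M (crd (?k E), b)"
    by (auto simp: eventually_nhds eventually_at_filter)
  have "((\<lambda>z. M (crd (?k z), b)) has_derivative (\<lambda>h. M' (b, E) (0, h))) (at E)"
    by (rule has_derivative_transform_eventually[OF 2 e]) simp
  from has_derivative_unique[OF this 1] show ?thesis unfolding P_def Q_def by metis
qed

text \<open>A bound for the operator norm of \<open>P b - id\<close> that is continuous in b and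
  vanishes at \<open>E\<close>. Once it is at most 1/2, \<open>P b\<close> is bounded below, which
  takes the place of inverting it.\<close>

definition P_dev where "P_dev b = (\<Sum>i\<in>Basis. norm (P b i - i))"

lemma P_dev_bound: "b \<in> dom \<Longrightarrow> norm (P b w - w) \<le> P_dev b * norm w"
proof -
  assume b: "b \<in> dom"
  have "P b w = (\<Sum>i\<in>Basis. (w \<bullet> i) *\<^sub>R P b i)"
    by (rule linear_representation[OF P_linear[OF b]])
  moreover have "w = (\<Sum>i\<in>Basis. (w \<bullet> i) *\<^sub>R i)" by (simp add: euclidean_representation)
  ultimately have "P b w - w = (\<Sum>i\<in>Basis. (w \<bullet> i) *\<^sub>R P b i) - (\<Sum>i\<in>Basis. (w \<bullet> i) *\<^sub>R i)" by argo
  then have "P b w - w = (\<Sum>i\<in>Basis. (w \<bullet> i) *\<^sub>R (P b i - i))"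
    by (simp only: sum_subtractf scaleR_diff_right)
  also have "norm \<dots> \<le> (\<Sum>i\<in>Basis. norm w * norm (P b i - i))"
    by (intro sum_norm_le) (simp add: Basis_le_norm mult_right_mono)
  finally show ?thesis by (simp add: P_dev_def sum_distrib_left[symmetric] mult.commute)
qed

lemma dom_limit: "(y \<longlongrightarrow> b) F \<Longrightarrow> b \<in> dom \<Longrightarrow> \<forall>\<^sub>F n in F. y n \<in> dom"
  using open_dom topological_tendstoD by blast

lemma P_tendsto: "(y \<longlongrightarrow> b) F \<Longrightarrow> b \<in> dom \<Longrightarrow> ((\<lambda>n. P (y n) w) \<longlongrightarrow> P b w) F"
  and Q_tendsto: "(y \<longlongrightarrow> b) F \<Longrightarrow> b \<in> dom \<Longrightarrow> ((\<lambda>n. Q (y n) w) \<longlongrightarrow> Q b w) F"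
  using continuous_on_tendsto_compose[OF Ck_on_imp_continuous_on[OF P_Ck[of 0]]]
    continuous_on_tendsto_compose[OF Ck_on_imp_continuous_on[OF Q_Ck[of 0]]] dom_limit by blast+

lemma P_dev_tendsto: "(y \<longlongrightarrow> E) F \<Longrightarrow> ((\<lambda>n. P_dev (y n)) \<longlongrightarrow> 0) F"
proof -
  assume "(y \<longlongrightarrow> E) F"
  then have "((\<lambda>n. \<Sum>i\<in>Basis. norm (P (y n) i - i)) \<longlongrightarrow> (\<Sum>i\<in>Basis. norm (P E i - i))) F"
    by (intro tendsto_intros P_tendsto) simp_all
  then show ?thesis by (simp add: P_dev_def)
qed

lemma P_dev_small: "b \<in> dom \<Longrightarrow> P_dev b \<le> 1/2 \<Longrightarrow> norm w \<le> 2 * norm (P b w)"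
proof -
  assume b: "b \<in> dom" "P_dev b \<le> 1/2"
  have "norm w \<le> norm (P b w) + norm (P b w - w)"
    using norm_triangle_ineq4[of "P b w" "P b w - w"] by simp
  also have "norm (P b w - w) \<le> 1/2 * norm w"
    using P_dev_bound[OF b(1), of w] b(2) mult_right_mono[OF b(2) norm_ge_zero[of w]] by linarith
  finally show ?thesis by simp
qed

text \<open>From \<open>P b A = Q b v\<close> for A = Ad v, with \<open>P b\<close> close to the
  identity: A differs from \<open>Q b v\<close> by at most \<open>P_dev b\<close> times the norm of
  A, and that norm is at most twice the norm of \<open>Q b v\<close>, which tends to v.\<close>

lemma Ad_tendsto_one:
  assumes x: "limitin T x \<one> F"
  shows "((\<lambda>n. Ad G (x n) v) \<longlongrightarrow> v) F"
proof -
  let ?y = "\<lambda>n. crd (x n)"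
  have y: "(?y \<longlongrightarrow> E) F" by (rule crd_limit_one[OF x])
  have "((\<lambda>n. 2 * P_dev (?y n) * norm (Q (?y n) v) + norm (Q (?y n) v - v)) \<longlongrightarrow>
      2 * 0 * norm (Q E v) + norm (Q E v - v)) F"
    by (intro tendsto_intros P_dev_tendsto y Q_tendsto) simp_all
  then have lim: "((\<lambda>n. 2 * P_dev (?y n) * norm (Q (?y n) v) + norm (Q (?y n) v - v)) \<longlongrightarrow> 0) F" by simp
  have "\<forall>\<^sub>F n in F. P_dev (?y n) < 1/2"
    using order_tendstoD(2)[OF P_dev_tendsto[OF y], of "1/2"] by simp
  with limitin_eventually_U0[OF x one_U0]
  have "\<forall>\<^sub>F n in F. norm (Ad G (x n) v - v) \<le> 2 * P_dev (?y n) * norm (Q (?y n) v) + norm (Q (?y n) v - v)"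
  proof eventually_elim
    case (elim n)
    let ?A = "Ad G (x n) v"
    have d: "?y n \<in> dom" using elim by simp
    have eq: "P (?y n) ?A = Q (?y n) v" using P_Ad[OF d] elim by simp
    have pd: "0 \<le> P_dev (?y n)" unfolding P_dev_def by (simp add: sum_nonneg)
    have "norm (?A - v) \<le> norm (Q (?y n) v - ?A) + norm (Q (?y n) v - v)"
      using norm_triangle_ineq4[of "Q (?y n) v - v" "Q (?y n) v - ?A"] by simp
    moreover have "norm (Q (?y n) v - ?A) \<le> P_dev (?y n) * norm ?A"
      using P_dev_bound[OF d, of ?A] eq by simp
    moreover have "norm ?A \<le> 2 * norm (Q (?y n) v)"
      using P_dev_small[OF d, of ?A] elim eq by simp
    from mult_left_mono[OF this pd] have "P_dev (?y n) * norm ?A \<le> 2 * P_dev (?y n) * norm (Q (?y n) v)"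
      by simp
    ultimately show ?case by linarith
  qed
  from Lim_null_comparison[OF this lim] show ?thesis by (simp add: LIM_zero_iff)
qed

text \<open>Convergence at l reduces to convergence at the identity through Ad (x n) = Ad l Ad (inv
  l x n). The basis expansion takes care of the moving vector.\<close>

lemma Ad_tendsto:
  assumes x: "limitin T x l F" and v: "(v \<longlongrightarrow> w) F" and xc: "\<forall>\<^sub>F n in F. x n \<in> carrier G"
  shows "((\<lambda>n. Ad G (x n) (v n)) \<longlongrightarrow> Ad G l w) F"
proof -
  have l: "l \<in> carrier G" using limitin_topspace[OF x] by simp
  have "limitin T (\<lambda>n. inv l \<otimes> x n) (inv l \<otimes> l) F"
    by (intro limitin_mult x) (use l in simp)
  then have 1: "limitin T (\<lambda>n. inv l \<otimes> x n) \<one> F" using l by simp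
  have "((\<lambda>n. \<Sum>i\<in>Basis. (v n \<bullet> i) *\<^sub>R Ad G l (Ad G (inv l \<otimes> x n) i)) \<longlongrightarrow>
      (\<Sum>i\<in>Basis. (w \<bullet> i) *\<^sub>R Ad G l i)) F"
    by (intro tendsto_intros v Ad_tendsto_one 1
        bounded_linear.tendsto[OF linear_conv_bounded_linear[THEN iffD1, OF Ad_linear[OF l]]])
  moreover have rep: "Ad G g u = (\<Sum>i\<in>Basis. (u \<bullet> i) *\<^sub>R Ad G g i)" if "g \<in> carrier G" for g u
    by (rule linear_representation[OF Ad_linear[OF that]])
  moreover from xc have "\<forall>\<^sub>F n in F. (\<Sum>i\<in>Basis. (v n \<bullet> i) *\<^sub>R Ad G l (Ad G (inv l \<otimes> x n) i)) = Ad G (x n) (v n)"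
  proof eventually_elim
    case (elim n)
    have "Ad G l (Ad G (inv l \<otimes> x n) i) = Ad G (x n) i" for i
      using Ad_mult[of l "inv l \<otimes> x n" i] l elim by (simp add: m_assoc[symmetric])
    then show ?case using rep[OF elim, of "v n"] by simp
  qed
  ultimately show ?thesis
    unfolding rep[OF l, of w] by (simp only: tendsto_cong)
qed

text \<open>The mixed second derivative of the group law at the identity. Its antisymmetrisation is
  the bracket, by \<open>bracket_eq\<close>.\<close>

definition bet where "bet v w = frechet_derivative (\<lambda>a. Q a w) (at E) v"

lemma Q_deriv: "((\<lambda>a. Q a w) has_derivative (\<lambda>v. bet v w)) (at E)"
  unfolding bet_def using Ck_on_Suc_has_derivative[OF Q_Ck E_dom] by simp

lemma bet_M: "bet v w = frechet_derivative (\<lambda>p. M' p (0, w)) (at (E, E)) (v, 0)"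
proof -
  have "((\<lambda>a. (a, E)) has_derivative (\<lambda>h. (h, 0))) (at E)"
    by (intro has_derivative_Pair has_derivative_ident has_derivative_const)
  from has_derivative_compose[OF this Ck_on_Suc_has_derivative[OF Ck_on_SucD[OF M_Ck]], of "(0, w)"]
  have "((\<lambda>a. Q a w) has_derivative (\<lambda>v. frechet_derivative (\<lambda>p. M' p (0, w)) (at (E, E)) (v, 0))) (at E)"
    unfolding Q_def by simp
  from has_derivative_unique[OF this Q_deriv] show ?thesis by metis
qed

text \<open>Differentiating \<open>P\<close> takes the two partial derivatives of \<open>M\<close>
  in the other order than differentiating \<open>Q\<close>; symmetry of second derivatives gives the
  same bilinear map.\<close>

lemma P_deriv: "((\<lambda>b. P b v) has_derivative (\<lambda>x. bet v x)) (at E)"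
proof -
  have "((\<lambda>a. (E, a)) has_derivative (\<lambda>h. (0, h))) (at E)"
    by (intro has_derivative_Pair has_derivative_ident has_derivative_const)
  from has_derivative_compose[OF this Ck_on_Suc_has_derivative[OF Ck_on_SucD[OF M_Ck]], of "(v, 0)"]
  have "((\<lambda>b. P b v) has_derivative (\<lambda>x. frechet_derivative (\<lambda>p. M' p (v, 0)) (at (E, E)) (0, x))) (at E)"
    unfolding P_def by simp
  moreover have "frechet_derivative (\<lambda>p. M' p (v, 0)) (at (E, E)) (0, x) = bet v x" for x
    unfolding bet_M by (rule second_derivative_symmetric_vector[OF open_D _ M_Ck]) simp
  ultimately show ?thesis by simp
qed

lemma bet_linear: "linear (\<lambda>v. bet v w)" "linear (bet v)"
  using has_derivative_linear[OF Q_deriv] has_derivative_linear[OF P_deriv] by auto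

text \<open>By linearity \<open>P_Ad\<close> becomes P (Ad v - v) = Q v - P v. Dividing by t, the
  right side tends to bet X v - bet v X, while \<open>P\<close> tends to the identity and the
  quotients stay bounded.\<close>

lemma Ad_curve_derivative:
  assumes y: "(y has_vector_derivative X) (at 0)" and y0: "y 0 = E"
  shows "((\<lambda>t. Ad G (c (y t)) v) has_vector_derivative (bet X v - bet v X)) (at 0)"
proof -
  let ?B = "bet X v - bet v X"
  define q where "q = (\<lambda>t. Q (y t) v - P (y t) v)"
  have yt: "(y \<longlongrightarrow> E) (at 0)"
    using has_vector_derivative_continuous[OF y] y0 by (simp add: continuous_within)
  have "((\<lambda>t. Q (y t) v) has_vector_derivative bet X v) (at 0)"
    using has_derivative_compose[OF y[unfolded has_vector_derivative_def], of "\<lambda>a. Q a v" "\<lambda>w. bet w v"] Q_deriv y0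
    by (simp add: has_vector_derivative_def linear_cmul[OF bet_linear(1)])
  moreover have "((\<lambda>t. P (y t) v) has_vector_derivative bet v X) (at 0)"
    using has_derivative_compose[OF y[unfolded has_vector_derivative_def], of "\<lambda>a. P a v" "\<lambda>w. bet v w"] P_deriv y0
    by (simp add: has_vector_derivative_def linear_cmul[OF bet_linear(2)])
  ultimately have "(q has_vector_derivative ?B) (at 0)"
    unfolding q_def by (rule has_vector_derivative_diff)
  moreover have "q 0 = 0" by (simp add: q_def y0)
  ultimately have q: "((\<lambda>t. q t /\<^sub>R t) \<longlongrightarrow> ?B) (at 0)" by (simp add: has_vector_derivative_at_0_iff)
  have "((\<lambda>t. norm (q t /\<^sub>R t - ?B) + P_dev (y t) * (2 * norm (q t /\<^sub>R t))) \<longlongrightarrow>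
      norm (?B - ?B) + 0 * (2 * norm ?B)) (at 0)"
    by (intro tendsto_intros q P_dev_tendsto yt)
  then have lim: "((\<lambda>t. norm (q t /\<^sub>R t - ?B) + P_dev (y t) * (2 * norm (q t /\<^sub>R t))) \<longlongrightarrow> 0) (at 0)" by simp
  have "\<forall>\<^sub>F t in at 0. P_dev (y t) < 1/2"
    using order_tendstoD(2)[OF P_dev_tendsto[OF yt], of "1/2"] by simp
  moreover have "\<forall>\<^sub>F t in at 0. y t \<in> dom" by (rule dom_limit[OF yt]) simp
  ultimately have "\<forall>\<^sub>F t in at 0. norm ((Ad G (c (y t)) v - v) /\<^sub>R t - ?B)
      \<le> norm (q t /\<^sub>R t - ?B) + P_dev (y t) * (2 * norm (q t /\<^sub>R t))"
  proof eventually_elim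
    case (elim t)
    let ?A = "(Ad G (c (y t)) v - v) /\<^sub>R t"
    have "P (y t) ?A = q t /\<^sub>R t"
      using P_Ad[OF elim(2), of v]
      by (simp add: linear_cmul[OF P_linear[OF elim(2)]] linear_diff[OF P_linear[OF elim(2)]] q_def)
    then have 1: "norm (q t /\<^sub>R t - ?A) \<le> P_dev (y t) * norm ?A" "norm ?A \<le> 2 * norm (q t /\<^sub>R t)"
      using P_dev_bound[OF elim(2), of ?A] P_dev_small[OF elim(2), of ?A] elim(1) by auto
    have "0 \<le> P_dev (y t)" unfolding P_dev_def by (simp add: sum_nonneg)
    from mult_left_mono[OF 1(2) this] 1(1)
    have "norm (q t /\<^sub>R t - ?A) \<le> P_dev (y t) * (2 * norm (q t /\<^sub>R t))" by linarith
    moreover have "norm (?A - ?B) \<le> norm (q t /\<^sub>R t - ?B) + norm (q t /\<^sub>R t - ?A)"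
      using dist_triangle3[of ?A ?B "q t /\<^sub>R t"] unfolding dist_norm by linarith
    ultimately show ?case by linarith
  qed
  from Lim_null_comparison[OF this lim] show ?thesis
    by (simp add: has_vector_derivative_at_0_iff LIM_zero_iff y0 Ad_one)
qed

end

context lie_grp
begin

section \<open>The bracket\<close>

lemma smooth_fun_translate:
  assumes f: "smooth_fun G f" and x: "x \<in> carrier G"
  obtains S where "open S" "E \<in> S" "S \<subseteq> dom" "\<And>k. Ck_on k (\<lambda>b. f (x \<otimes> c b)) S"
proof -
  obtain V \<psi> where V: "(V, \<psi>) \<in> atlas G" "x \<in> V" using chart_exists[OF x] by blast
  let ?S = "{crd y | y. y \<in> U0 \<and> x \<otimes> y \<in> V}"
  have S: "open ?S" "\<And>k. Ck_on k (\<lambda>b. \<psi> (x \<otimes> c b)) ?S"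
    using left_translation_Ck[OF x id_chart V(1)] by (auto simp: uncoord_eq)
  have E: "E \<in> ?S" using V x one_U0 by (auto simp: E_def intro!: exI[of _ \<one>])
  have "Ck_on k (\<lambda>b. f (x \<otimes> c b)) ?S" for k
  proof (rule Ck_on_cong[OF S(1)])
    have "Ck_on k (\<lambda>a. f (inv_into V \<psi> a)) (\<psi> ` V)"
      using f V(1) unfolding smooth_fun_def smooth_on_def by blast
    then show "Ck_on k (\<lambda>b. f (inv_into V \<psi> (\<psi> (x \<otimes> c b)))) ?S"
      by (rule Ck_on_compose[OF S(1) S(2), rotated]) auto
    show "f (inv_into V \<psi> (\<psi> (x \<otimes> c b))) = f (x \<otimes> c b)" if "b \<in> ?S" for b
    proof -
      have "x \<otimes> c b \<in> V" using that by auto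
      then show ?thesis using inv_into_f_f[OF chart_inj[OF V(1)]] by simp
    qed
  qed
  with S(1) E show thesis by (intro that[of ?S]) auto
qed

text \<open>Chain rule: the point x c(a) c(E + t w) has coordinates M (a, E + t w) relative to x,
  whose velocity at t = 0 is \<open>Q a w\<close>.\<close>

lemma left_field_at:
  assumes S: "open S" "S \<subseteq> dom" and F: "Ck_on (Suc 0) (\<lambda>b. f (x \<otimes> c b)) S"
    and x: "x \<in> carrier G" and a: "a \<in> S"
  shows "left_field G w f (x \<otimes> c a) = frechet_derivative (\<lambda>b. f (x \<otimes> c b)) (at a) (Q a w)"
proof -
  let ?F = "\<lambda>b. f (x \<otimes> c b)"
  have ad: "a \<in> dom" using S a by auto
  have "((\<lambda>t. E + t *\<^sub>R w) has_derivative (\<lambda>h. h *\<^sub>R w)) (at 0)"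
    by (auto intro!: derivative_eq_intros)
  then have 1: "((\<lambda>t. M (a, E + t *\<^sub>R w)) has_derivative (\<lambda>h. M' (a, E) (0, h *\<^sub>R w))) (at 0)"
    by (rule M_deriv_snd[rotated]) (use ad in auto)
  have "((\<lambda>t. M (a, E + t *\<^sub>R w)) has_derivative (\<lambda>h. h *\<^sub>R Q a w)) (at 0)"
    using 1 linear_cmul[OF Q_linear[OF ad], of _ w] unfolding Q_def by simp
  moreover have "(?F has_derivative frechet_derivative ?F (at a)) (at (M (a, E + 0 *\<^sub>R w)))"
    using Ck_on_Suc_has_derivative[OF F a] ad by simp
  ultimately have 2: "((\<lambda>t. ?F (M (a, E + t *\<^sub>R w))) has_derivative
     (\<lambda>h. frechet_derivative ?F (at a) (h *\<^sub>R Q a w))) (at 0)"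
    by (rule has_derivative_compose)
  have lin: "linear (frechet_derivative ?F (at a))"
    using Ck_on_Suc_has_derivative[OF F a] has_derivative_linear by blast
  have "((\<lambda>t::real. (a, E + t *\<^sub>R w)) \<longlongrightarrow> (a, E + 0 *\<^sub>R w)) (nhds 0)"
    by (intro tendsto_intros) (simp add: filterlim_ident)
  then have "\<forall>\<^sub>F t in nhds 0. (a, E + t *\<^sub>R w) \<in> D"
    by (rule topological_tendstoD[OF _ open_D]) (use ad in auto)
  then have "\<forall>\<^sub>F t in nhds 0. ?F (M (a, E + t *\<^sub>R w)) = f (x \<otimes> c a \<otimes> c (E + t *\<^sub>R w))"
  proof eventually_elim
    case (elim t)
    then have "E + t *\<^sub>R w \<in> dom" by (simp add: D_def)
    then show ?case using c_M[OF elim] x ad by (simp add: m_assoc)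
  qed
  then have e: "\<forall>\<^sub>F t in at 0. ?F (M (a, E + t *\<^sub>R w)) = f (x \<otimes> c a \<otimes> c (E + t *\<^sub>R w))"
    "?F (M (a, E + 0 *\<^sub>R w)) = f (x \<otimes> c a \<otimes> c (E + 0 *\<^sub>R w))"
    by (auto simp: eventually_at_filter eventually_nhds_x_imp_x elim: eventually_mono dest: eventually_nhds_x_imp_x)
  have "((\<lambda>t. f (x \<otimes> c a \<otimes> c (E + t *\<^sub>R w))) has_derivative
     (\<lambda>h. frechet_derivative ?F (at a) (h *\<^sub>R Q a w))) (at 0)"
    by (rule has_derivative_transform_eventually[OF 2 e]) simp
  then have "((\<lambda>t. f (x \<otimes> c a \<otimes> c (E + t *\<^sub>R w))) has_real_derivative
     frechet_derivative ?F (at a) (Q a w)) (at 0)"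
    by (simp add: has_field_derivative_def linear_cmul[OF lin] mult.commute[of _ "frechet_derivative _ _ _"])
  then show ?thesis
    unfolding left_field_def using DERIV_imp_deriv by (simp add: E_def)
qed

text \<open>In coordinates each iterated derivative is the second derivative \<open>H v w\<close>
  plus a first-order term in \<open>bet v w\<close>, which comes from the variation of
  \<open>Q\<close>. The symmetric part \<open>H\<close> cancels in the commutator.\<close>

lemma left_field_commutator:
  assumes f: "smooth_fun G f" and x: "x \<in> carrier G"
  shows "left_field G v (left_field G w f) x - left_field G w (left_field G v f) x
     = left_field G (bet v w - bet w v) f x"
proof -
  obtain S where S: "open S" "E \<in> S" "S \<subseteq> dom" and F: "\<And>k. Ck_on k (\<lambda>b. f (x \<otimes> c b)) S"
    using smooth_fun_translate[OF f x] by blast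
  let ?F = "\<lambda>b. f (x \<otimes> c b)"
  define F' where "F' = (\<lambda>b. frechet_derivative ?F (at b))"
  have F'1: "Ck_on k (\<lambda>b. F' b w) S" for k w
    unfolding F'_def by (rule Ck_on_SucD[OF F])
  have lin: "linear (F' b)" if "b \<in> S" for b
    unfolding F'_def using Ck_on_Suc_has_derivative[OF F that] has_derivative_linear by blast
  define H where "H = (\<lambda>u w. frechet_derivative (\<lambda>b. F' b w) (at E) u)"
  have H: "((\<lambda>b. F' b w) has_derivative (\<lambda>u. H u w)) (at E)" for w
    unfolding H_def using Ck_on_Suc_has_derivative[OF F'1 S(2)] by simp
  have Hsym: "H u w = H w u" for u w
    unfolding H_def F'_def by (rule second_derivative_symmetric[OF S(1,2) F])
  have repF: "F' b w = (\<Sum>i\<in>Basis. (w \<bullet> i) *\<^sub>R F' b i)" if "b \<in> S" for b w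
    by (rule linear_representation[OF lin[OF that]])
  have linH: "linear (H u)" for u
  proof -
    have "H u = (\<lambda>i. H i u)" by (rule ext) (rule Hsym)
    then show ?thesis using has_derivative_linear[OF H[of u]] by (simp only:)
  qed
  have repH: "H u w = (\<Sum>i\<in>Basis. (w \<bullet> i) *\<^sub>R H u i)" for u w
    by (rule linear_representation[OF linH])
  have main: "left_field G v (left_field G w f) x = H v w + F' E (bet v w)" for v w
  proof -
    have "((\<lambda>a. \<Sum>i\<in>Basis. (Q a w \<bullet> i) *\<^sub>R F' a i) has_derivative
        (\<lambda>u. \<Sum>i\<in>Basis. (Q E w \<bullet> i) *\<^sub>R H u i + (bet u w \<bullet> i) *\<^sub>R F' E i)) (at E)"
      by (intro has_derivative_sum has_derivative_scaleR has_derivative_inner_left Q_deriv H)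
    moreover have "(\<Sum>i\<in>Basis. (Q E w \<bullet> i) *\<^sub>R H u i + (bet u w \<bullet> i) *\<^sub>R F' E i) = H u w + F' E (bet u w)" for u
      unfolding repH[of u w] repF[OF S(2), of "bet u w"] by (simp add: sum.distrib)
    ultimately have "((\<lambda>a. \<Sum>i\<in>Basis. (Q a w \<bullet> i) *\<^sub>R F' a i) has_derivative (\<lambda>u. H u w + F' E (bet u w))) (at E)"
      by simp
    then have "((\<lambda>a. left_field G w f (x \<otimes> c a)) has_derivative (\<lambda>u. H u w + F' E (bet u w))) (at E)"
    proof (rule has_derivative_transform_within_open[OF _ S(1,2)])
      fix a assume a: "a \<in> S"
      show "(\<Sum>i\<in>Basis. (Q a w \<bullet> i) *\<^sub>R F' a i) = left_field G w f (x \<otimes> c a)"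
        unfolding left_field_at[OF S(1,3) F x a] using repF[OF a, of "Q a w"] by (simp only: F'_def)
    qed
    then have d: "((\<lambda>a. left_field G w f (x \<otimes> c a)) has_derivative (\<lambda>u. H u w + F' E (bet u w)))
        (at (E + 0 *\<^sub>R v))" by simp
    have "((\<lambda>t. E + t *\<^sub>R v) has_derivative (\<lambda>h. h *\<^sub>R v)) (at 0)"
      by (auto intro!: derivative_eq_intros)
    from has_derivative_compose[OF this d]
    have d2: "((\<lambda>t. left_field G w f (x \<otimes> c (E + t *\<^sub>R v))) has_derivative
        (\<lambda>h. H (h *\<^sub>R v) w + F' E (bet (h *\<^sub>R v) w))) (at 0)" .
    have "linear (\<lambda>u. H u w + F' E (bet u w))"
      using has_derivative_linear[OF d] .
    from linear_cmul[OF this] have "(\<lambda>h. H (h *\<^sub>R v) w + F' E (bet (h *\<^sub>R v) w)) = times (H v w + F' E (bet v w))"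
      by (auto simp: fun_eq_iff)
    then have "((\<lambda>t. left_field G w f (x \<otimes> c (E + t *\<^sub>R v))) has_real_derivative
        (H v w + F' E (bet v w))) (at 0)"
      using d2 by (simp add: has_field_derivative_def)
    then show ?thesis
      unfolding left_field_def[of G v] using DERIV_imp_deriv by (simp add: E_def)
  qed
  have "left_field G (bet v w - bet w v) f x = F' E (bet v w - bet w v)"
    using left_field_at[OF S(1,3) F x S(2), of "bet v w - bet w v"] x by (simp add: F'_def)
  then show ?thesis
    unfolding main using Hsym[of v w] linear_diff[OF lin[OF S(2)]] by simp
qed

lemma compactin_c_cball:
  assumes "cball b r \<subseteq> dom"
  shows "compactin T (c ` cball b r)"
proof -
  have "compactin (top_of_set dom) (cball b r)"
    using assms by (simp add: compactin_subtopology compactin_euclidean_iff)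
  moreover have "continuous_map (top_of_set dom) T c"
    using chart_inv_cont[OF id_chart] by (simp add: uncoord_eq dom_def)
  ultimately show ?thesis by (rule image_compactin)
qed

text \<open>The bracket is defined by a description quantified over smooth functions on the whole
  group. Its uniqueness requires globally smooth functions whose derivatives at the identity
  separate vectors.\<close>

lemma exists_linear_test_function:
  "\<exists>f K. smooth_fun G f \<and> K > 0 \<and> (\<forall>z. left_field G z f \<one> = K * (z \<bullet> w))"
proof -
  obtain r where r: "r > 0" "cball E r \<subseteq> dom"
    using open_dom E_dom open_contains_cball by metis
  \<comment> \<open>A linear form cut off outside the ball of radius r. The linear form vanishes at
    \<open>E\<close>, so the derivative there is the form times \<open>flat 0 (r^2)\<close>.\<close>
  define q where "q = (\<lambda>b. ((b - E) \<bullet> w) * flat 0 (r^2 - (b - E) \<bullet> (b - E)))"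
  have lin: "Ck_on k (\<lambda>b. b - E) UNIV" for k
    using Ck_on_add[OF open_UNIV Ck_on_linear[OF bounded_linear_ident] Ck_on_const[of k "- E"]] by simp
  have "Ck_on k (\<lambda>b. r^2 + (-1) * ((b - E) \<bullet> (b - E))) UNIV" for k
    by (intro Ck_on_add Ck_on_const Ck_on_bilinear[OF bounded_bilinear_inner]
        Ck_on_bilinear[OF bounded_bilinear_mult] lin open_UNIV)
  then have "Ck_on k (\<lambda>b. r^2 - (b - E) \<bullet> (b - E)) UNIV" for k by simp
  from Ck_on_compose[OF open_UNIV this _ Ck_on_flat]
  have fl: "Ck_on k (\<lambda>b. flat 0 (r^2 - (b - E) \<bullet> (b - E))) UNIV" for k by simp
  have q: "Ck_on k q UNIV" for k
    unfolding q_def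
    by (intro Ck_on_bilinear[OF bounded_bilinear_mult] fl open_UNIV
        Ck_on_linear_compose[OF bounded_linear_inner_left] lin)
  have q0: "q b = 0" if "b \<notin> cball E r" for b
  proof -
    have "r < norm (b - E)" using that by (simp add: dist_norm norm_minus_commute)
    then have "r^2 < (b - E) \<bullet> (b - E)"
      using r(1) by (simp flip: power2_norm_eq_inner add: power_strict_mono)
    then show ?thesis by (simp add: q_def flat_def)
  qed
  define f where "f = (\<lambda>x. if x \<in> U0 then q (crd x) else 0)"
  have K: "closedin T (c ` cball E r)"
    by (rule compactin_imp_closedin[OF Hausdorff_T compactin_c_cball[OF r(2)]])
  have f0: "f x = 0" if "x \<notin> c ` cball E r" for x
  proof (cases "x \<in> U0")
    case True
    then have "crd x \<notin> cball E r" using that by (metis c_crd imageI)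
    then show ?thesis using q0 True by (simp add: f_def)
  qed (simp add: f_def)
  \<comment> \<open>Each chart domain is covered by two open pieces: its part in \<open>U0\<close>,
    where f is \<open>q\<close> in coordinates, and the complement of the compact set containing the
    support, where f is 0.\<close>
  have sm: "smooth_fun G f"
    unfolding smooth_fun_def smooth_on_def
  proof (safe)
    fix V \<psi> k assume V: "(V, \<psi>) \<in> atlas G"
    let ?f = "\<lambda>a. f (inv_into V \<psi> a)"
    let ?S1 = "\<psi> ` (V \<inter> U0)" and ?S2 = "\<psi> ` (V - c ` cball E r)"
    have o1: "open ?S1"
      using chart_image_open[OF V openin_Int[OF chart_openin[OF V] chart_openin[OF id_chart]]] by simp
    have o2: "open ?S2"
      using chart_image_open[OF V openin_diff[OF chart_openin[OF V] K]] by simp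
    have inv: "inv_into V \<psi> (\<psi> x) = x" if "x \<in> V" for x
      using inv_into_f_f[OF chart_inj[OF V] that] .
    have "Ck_on k (\<lambda>a. crd (inv_into V \<psi> a)) ?S1"
      using lie_group V id_chart unfolding lie_group_def smooth_atlas_def smooth_on_def by blast
    from Ck_on_compose[OF o1 this _ q] have "Ck_on k (\<lambda>a. q (crd (inv_into V \<psi> a))) ?S1" by simp
    then have 1: "Ck_on k ?f ?S1"
      by (rule Ck_on_cong[OF o1, rotated]) (auto simp: inv f_def)
    have 2: "Ck_on k ?f ?S2"
      by (rule Ck_on_cong[OF o2 _ Ck_on_const[of k 0]]) (auto simp: inv f0)
    have "c ` cball E r \<subseteq> U0" using r(2) c_U0 by auto
    then have "V = (V \<inter> U0) \<union> (V - c ` cball E r)" by blast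
    then have "\<psi> ` V = ?S1 \<union> ?S2" by (metis image_Un)
    then show "Ck_on k ?f (\<psi> ` V)" using Ck_on_Un[OF o1 o2 1 2] by simp
  qed
  define K where "K = flat 0 (r^2)"
  have "K > 0" using r(1) by (simp add: K_def flat_def)
  moreover have "left_field G z f \<one> = K * (z \<bullet> w)" for z
  proof -
    have "((\<lambda>b. q b) has_derivative (\<lambda>h. (E - E) \<bullet> w * frechet_derivative (\<lambda>b. flat 0 (r^2 - (b - E) \<bullet> (b - E))) (at E) h
        + (h \<bullet> w) * flat 0 (r^2 - (E - E) \<bullet> (E - E)))) (at E)"
      unfolding q_def
      by (intro has_derivative_mult has_derivative_inner_left Ck_on_Suc_has_derivative[OF fl])
         (auto intro!: derivative_eq_intros)
    then have "(q has_derivative (\<lambda>h. (h \<bullet> w) * K)) (at E)" by (simp add: K_def)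
    then have fd: "((\<lambda>b. f (\<one> \<otimes> c b)) has_derivative (\<lambda>h. (h \<bullet> w) * K)) (at E)"
      by (rule has_derivative_transform_within_open[OF _ open_dom E_dom]) (simp add: f_def c_U0)
    obtain S where S: "open S" "E \<in> S" "S \<subseteq> dom" and F: "\<And>k. Ck_on k (\<lambda>b. f (\<one> \<otimes> c b)) S"
      using smooth_fun_translate[OF sm one_closed] by blast
    have "left_field G z f (\<one> \<otimes> c E) = frechet_derivative (\<lambda>b. f (\<one> \<otimes> c b)) (at E) (Q E z)"
      by (rule left_field_at[OF S(1,3) F one_closed S(2)])
    also have "\<dots> = (z \<bullet> w) * K" unfolding Q_E using frechet_derivative_at[OF fd] by metis
    finally show ?thesis by simp
  qed
  ultimately show ?thesis using sm by blast
qed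

lemma bracket_eq: "bracket G v w = bet v w - bet w v"
  unfolding bracket_def
proof (rule the_equality)
  show "\<forall>f. smooth_fun G f \<longrightarrow> (\<forall>x\<in>carrier G. left_field G (bet v w - bet w v) f x =
     left_field G v (left_field G w f) x - left_field G w (left_field G v f) x)"
    using left_field_commutator by simp
next
  fix z
  assume z: "\<forall>f. smooth_fun G f \<longrightarrow> (\<forall>x\<in>carrier G. left_field G z f x =
     left_field G v (left_field G w f) x - left_field G w (left_field G v f) x)"
  let ?z = "bet v w - bet w v"
  \<comment> \<open>Testing in the direction of the difference itself gives a multiple of its
    squared norm.\<close>
  obtain f K where f: "smooth_fun G f" "K > 0" "\<And>y. left_field G y f \<one> = K * (y \<bullet> (z - ?z))"
    using exists_linear_test_function[of "z - ?z"] by blast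
  have "left_field G z f \<one> = left_field G ?z f \<one>"
    using z f(1) left_field_commutator[OF f(1) one_closed] by simp
  then have "(z - ?z) \<bullet> (z - ?z) = 0" using f(2) unfolding f(3) by (simp add: inner_diff_left)
  then show "z = ?z" by simp
qed

lemma bracket_linear: "linear (\<lambda>v. bracket G v w)" "linear (bracket G v)"
  unfolding bracket_eq using bet_linear by (auto intro!: linear_compose_sub)

end

section \<open>Ordinary differential equations\<close>

lemma vector_derivative_bound:
  fixes f :: "real \<Rightarrow> 'a::real_normed_vector"
  assumes "convex S" "\<And>t. t \<in> S \<Longrightarrow> (f has_vector_derivative f' t) (at t within S)"
    "\<And>t. t \<in> S \<Longrightarrow> norm (f' t) \<le> B" "s \<in> S" "t \<in> S"
  shows "norm (f s - f t) \<le> B * \<bar>s - t\<bar>"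
proof -
  have "norm (f s - f t) \<le> B * norm (s - t)"
  proof (rule differentiable_bound[OF assms(1) assms(2)[unfolded has_vector_derivative_def] _ assms(4,5)])
    show "onorm (\<lambda>x. x *\<^sub>R f' u) \<le> B" if "u \<in> S" for u
      using onorm_scaleR_left[OF bounded_linear_ident, of "f' u"] assms(3)[OF that]
      by (simp add: onorm_id)
  qed
  then show ?thesis by simp
qed

lemma Ck_on_lipschitz_cball:
  fixes f :: "'a::euclidean_space \<Rightarrow> 'b::real_normed_vector"
  assumes f: "Ck_on (Suc 0) f S" and S: "cball E r \<subseteq> S"
  shows "\<exists>L\<ge>0. \<forall>x\<in>cball E r. \<forall>y\<in>cball E r. norm (f x - f y) \<le> L * norm (x - y)"
proof -
  define g where "g = (\<lambda>x. \<Sum>j\<in>Basis. norm (frechet_derivative f (at x) j))"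
  have "continuous_on (cball E r) g"
    unfolding g_def
    by (intro continuous_on_sum continuous_on_norm continuous_on_subset[OF _ S])
       (use f in auto)
  then have "compact (g ` cball E r)" by (rule compact_continuous_image) simp
  then obtain L where L: "\<And>x. x \<in> cball E r \<Longrightarrow> norm (g x) \<le> L"
    using compact_imp_bounded bounded_iff by (metis imageI)
  have d: "(f has_derivative frechet_derivative f (at x)) (at x)" if "x \<in> cball E r" for x
    using Ck_on_Suc_has_derivative[OF f] S that by blast
  have "norm (f x - f y) \<le> max L 0 * norm (x - y)" if "x \<in> cball E r" "y \<in> cball E r" for x y
  proof (rule differentiable_bound[OF convex_cball has_derivative_at_withinI[OF d] _ that])
    fix z assume z: "z \<in> cball E r"
    have "onorm (frechet_derivative f (at z)) \<le> g z"
      unfolding g_def by (rule onorm_componentwise[OF has_derivative_bounded_linear[OF d[OF z]]])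
    then show "onorm (frechet_derivative f (at z)) \<le> max L 0" using L[OF z] by simp
  qed
  then show ?thesis by (intro exI[of _ "max L 0"]) auto
qed

text \<open>Picard iteration on the fixed interval [-1, 1]. The Lipschitz constant is below 1 and
  the speed is at most r, so the operator contracts and preserves the ball for the plain supremum
  distance; the smallness comes from the field and not from short time.\<close>

lemma ode_solution_exists:
  fixes X :: "'e::euclidean_space \<Rightarrow> 'e"
  assumes r: "0 < r" and L: "0 \<le> L" "L < 1"
    and lip: "\<And>x y. x \<in> cball E r \<Longrightarrow> y \<in> cball E r \<Longrightarrow> norm (X x - X y) \<le> L * norm (x - y)"
    and bd: "\<And>x. x \<in> cball E r \<Longrightarrow> norm (X x) \<le> r"
  shows "\<exists>y. y 0 = E \<and> (\<forall>t\<in>{-1..1}. y t \<in> cball E r \<and>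
     (y has_vector_derivative X (y t)) (at t within {-1..1::real}))"
proof -
  have contX: "continuous_on (cball E r) X"
    by (rule lipschitz_on_continuous_on[of L]) (auto simp: lipschitz_on_def dist_norm L lip)
  define I where "I = (\<lambda>(y :: real \<Rightarrow> 'e) t. integral {-1..t} (\<lambda>s. X (y s)))"
  \<comment> \<open>The Picard operator, with time clamped to [-1, 1] so that it acts on bounded
    continuous functions on the line. Subtracting \<open>I y 0\<close> makes the integral start at 0
    for either sign of t.\<close>
  define F where "F = (\<lambda>y t. E + I y (max (-1) (min 1 t)) - I y 0)"
  let ?S = "PiC UNIV (\<lambda>_. cball E r) :: (real \<Rightarrow>\<^sub>C 'e) set"
  have yS: "apply_bcontfun y t \<in> cball E r" if "y \<in> ?S" for y t
    using mem_PiCD[OF that] by (metis UNIV_I Pi_mem)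
  have cXy: "continuous_on {-1..1} (\<lambda>s. X (apply_bcontfun y s))" if "y \<in> ?S" for y
    by (rule continuous_on_compose2[OF contX]) (use yS[OF that] in \<open>auto intro: continuous_on_apply_bcontfun\<close>)
  have dI: "(I y has_vector_derivative X (y t)) (at t within {-1..1})" if "y \<in> ?S" "t \<in> {-1..1}" for y t
    unfolding I_def using integral_has_vector_derivative[OF cXy[OF that(1)] that(2)] .
  have cl: "max (-1) (min 1 t) \<in> {-1..1}" for t :: real by auto
  have Fball: "F y t \<in> cball E r" if "y \<in> ?S" for y t
  proof -
    have "norm (I y (max (-1) (min 1 t)) - I y 0) \<le> r * \<bar>max (-1) (min 1 t) - 0\<bar>"
      by (rule vector_derivative_bound[OF _ dI[OF that] bd[OF yS[OF that]] cl]) auto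
    also have "\<dots> \<le> r * 1" using r by (intro mult_left_mono) auto
    finally show ?thesis
      by (simp add: F_def dist_norm norm_minus_commute algebra_simps)
  qed
  have Fc: "F y \<in> bcontfun" if "y \<in> ?S" for y
  proof (rule bcontfun_normI)
    have "continuous_on {-1..1} (I y)"
      using dI[OF that] has_vector_derivative_continuous continuous_on_eq_continuous_within by blast
    then have "continuous_on UNIV (\<lambda>t. I y (max (-1) (min 1 t)))"
      by (rule continuous_on_compose2) (auto intro!: continuous_intros)
    then show "continuous_on UNIV (F y)" unfolding F_def by (intro continuous_intros)
    show "norm (F y t) \<le> norm E + r" for t
      using Fball[OF that, of t] norm_triangle_sub[of "F y t" E]
      by (simp add: dist_norm norm_minus_commute)
  qed
  have FB: "apply_bcontfun (Bcontfun (F y)) t = F y t" if "y \<in> ?S" for y t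
    using Bcontfun_inverse[OF Fc[OF that]] by simp
  have "\<exists>!y\<in>?S. Bcontfun (F y) = y"
  proof (rule Banach_fix[OF complete_eq_closed[THEN iffD2, OF closed_PiC]])
    have "const_bcontfun E \<in> ?S" using r by (auto intro!: mem_PiCI simp: const_bcontfun.rep_eq)
    then show "?S \<noteq> {}" by blast
    show "(\<lambda>y. Bcontfun (F (apply_bcontfun y))) ` ?S \<subseteq> ?S"
      using Fball by (auto intro!: mem_PiCI simp: FB)
    show "dist (Bcontfun (F x)) (Bcontfun (F y)) \<le> L * dist x y" if "x \<in> ?S" "y \<in> ?S" for x y
    proof (rule dist_bound)
      fix t :: real
      from that have x: "x \<in> ?S" and y: "y \<in> ?S" by auto
      let ?t = "max (-1) (min 1 t)"
      have "norm ((I x ?t - I y ?t) - (I x 0 - I y 0)) \<le> (L * dist x y) * \<bar>?t - 0\<bar>"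
      proof (rule vector_derivative_bound[of "{-1..1}" "\<lambda>t. I x t - I y t" "\<lambda>t. X (x t) - X (y t)", OF _ _ _ cl])
        show "norm (X (x t) - X (y t)) \<le> L * dist x y" for t
          using lip[OF yS[OF x] yS[OF y], of t t] dist_bounded[of x t y] L
          by (metis (no_types, opaque_lifting) dist_norm dual_order.trans mult_left_mono)
      qed (auto intro!: derivative_intros dI x y)
      also have "\<dots> \<le> (L * dist x y) * 1" using L by (intro mult_left_mono) auto
      finally show "dist (Bcontfun (F x) t) (Bcontfun (F y) t) \<le> L * dist x y"
        unfolding FB[OF x] FB[OF y] by (simp add: F_def dist_norm algebra_simps)
    qed
  qed (use L in auto)
  then obtain y where y: "y \<in> ?S" "Bcontfun (F y) = y" by blast
  have yt: "apply_bcontfun y t = F y t" for t using FB[OF y(1), of t] y(2) by simp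
  have "apply_bcontfun y 0 = E" using yt[of 0] by (simp add: F_def)
  moreover have "(apply_bcontfun y has_vector_derivative X (y t)) (at t within {-1..1})" if "t \<in> {-1..1}" for t
  proof (rule has_vector_derivative_transform[OF that])
    show "((\<lambda>s. E + I y s - I y 0) has_vector_derivative X (y t)) (at t within {-1..1})"
      by (auto intro!: derivative_eq_intros dI[OF y(1) that])
    show "apply_bcontfun y s = E + I y s - I y 0" if "s \<in> {-1..1}" for s
      using yt[of s] that by (simp add: F_def min_def max_def split: if_splits)
  qed
  ultimately show ?thesis using yS[OF y(1)] by blast
qed

text \<open>The mean value estimate improves a bound on the distance by the factor L, since times in
  S have modulus at most 1. Iterating from the bound 2 * r forces the distance to 0. Asymmetric
  intervals S are needed for the addition law of one-parameter subgroups.\<close>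

lemma ode_solution_unique:
  fixes y z :: "real \<Rightarrow> 'e::real_normed_vector"
  assumes L: "0 \<le> L" "L < 1" and S: "convex S" "0 \<in> S" "S \<subseteq> {-1..1}"
    and lip: "\<And>a b. a \<in> cball E r \<Longrightarrow> b \<in> cball E r \<Longrightarrow> norm (X a - X b) \<le> L * norm (a - b)"
    and y: "\<And>t. t \<in> S \<Longrightarrow> y t \<in> cball E r" "\<And>t. t \<in> S \<Longrightarrow> (y has_vector_derivative X (y t)) (at t within S)"
    and z: "\<And>t. t \<in> S \<Longrightarrow> z t \<in> cball E r" "\<And>t. t \<in> S \<Longrightarrow> (z has_vector_derivative X (z t)) (at t within S)"
    and eq: "y 0 = z 0" and t: "t \<in> S"
  shows "y t = z t"
proof -
  have "norm (y t - z t) \<le> L ^ n * (2 * r)" if "t \<in> S" for n t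
    using that
  proof (induction n arbitrary: t)
    case 0
    have "norm (y t - z t) \<le> norm (y t - E) + norm (z t - E)"
      using norm_triangle_ineq4[of "y t - E" "z t - E"] by simp
    then show ?case using y(1)[OF 0] z(1)[OF 0] by (simp add: dist_norm norm_minus_commute)
  next
    case (Suc n)
    have r: "0 \<le> r" using y(1)[OF Suc.prems] zero_le_dist[of E "y t"] by (simp del: zero_le_dist)
    have "norm ((y t - z t) - (y 0 - z 0)) \<le> L * (L ^ n * (2 * r)) * \<bar>t - 0\<bar>"
    proof (rule vector_derivative_bound[OF S(1) _ _ Suc.prems S(2)])
      show "((\<lambda>t. y t - z t) has_vector_derivative X (y t) - X (z t)) (at t within S)" if "t \<in> S" for t
        by (intro has_vector_derivative_diff y z that)
      show "norm (X (y t) - X (z t)) \<le> L * (L ^ n * (2 * r))" if "t \<in> S" for t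
        using lip[OF y(1)[OF that] z(1)[OF that]] mult_left_mono[OF Suc.IH[OF that] L(1)] by linarith
    qed
    also have "\<dots> \<le> L * (L ^ n * (2 * r)) * 1"
      using subsetD[OF S(3) Suc.prems] L r by (intro mult_left_mono) auto
    finally show ?case by (simp add: eq mult.assoc)
  qed
  then have "norm (y t - z t) \<le> L ^ n * (2 * r)" for n using t by blast
  moreover have "(\<lambda>n. L ^ n * (2 * r)) \<longlonglongrightarrow> 0 * (2 * r)"
    by (intro tendsto_intros LIMSEQ_realpow_zero L)
  ultimately have "norm (y t - z t) \<le> 0"
    using LIMSEQ_le_const[of "\<lambda>n. L ^ n * (2 * r)" 0 "norm (y t - z t)"] by auto
  then show ?thesis by simp
qed

section \<open>One-parameter subgroups\<close>

text \<open>The value at t is forced to be \<gamma> (t / n)^n. It does not depend on n, and one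
  large denominator m serves s, t and s + t together; the powers multiply because \<gamma> (s / m)
  and \<gamma> (t / m) commute.\<close>

lemma (in group) local_hom_extends:
  fixes \<gamma> :: "real \<Rightarrow> 'a"
  assumes cl: "\<And>t. \<bar>t\<bar> \<le> 1 \<Longrightarrow> \<gamma> t \<in> carrier G"
    and add: "\<And>s t. \<bar>s\<bar> \<le> 1 \<Longrightarrow> \<bar>t\<bar> \<le> 1 \<Longrightarrow> \<bar>s + t\<bar> \<le> 1 \<Longrightarrow> \<gamma> (s + t) = \<gamma> s \<otimes> \<gamma> t"
  obtains \<beta> where "\<And>t. \<bar>t\<bar> \<le> 1 \<Longrightarrow> \<beta> t = \<gamma> t" "\<And>t. \<beta> t \<in> carrier G" "\<And>s t. \<beta> (s + t) = \<beta> s \<otimes> \<beta> t"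
proof -
  have g0: "\<gamma> 0 = \<one>" using add[of 0 0] cl[of 0] by (simp add: l_cancel_one)
  have pow: "\<gamma> (real k * s) = \<gamma> s [^] k" if "\<bar>real k * s\<bar> \<le> 1" for k s
    using that
  proof (induction k)
    case 0 then show ?case by (simp add: g0)
  next
    case (Suc k)
    show ?case
    proof (cases "k = 0")
      case False
      have "real k * \<bar>s\<bar> \<le> real (Suc k) * \<bar>s\<bar>" "1 * \<bar>s\<bar> \<le> real (Suc k) * \<bar>s\<bar>"
        by (intro mult_right_mono; simp)+
      then have "\<bar>real k * s\<bar> \<le> 1" "\<bar>s\<bar> \<le> 1" using Suc.prems by (auto simp: abs_mult)
      moreover from this have "\<gamma> (real k * s + s) = \<gamma> (real k * s) \<otimes> \<gamma> s"
        using Suc.prems by (intro add) (auto simp: algebra_simps)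
      ultimately show ?thesis using Suc.IH by (simp add: algebra_simps)
    qed (use Suc.prems cl in simp)
  qed
  \<comment> \<open>The 1 keeps the denominator positive at t = 0.\<close>
  define \<beta> where "\<beta> = (\<lambda>t. \<gamma> (t / real (nat \<lceil>\<bar>t\<bar>\<rceil> + 1)) [^] (nat \<lceil>\<bar>t\<bar>\<rceil> + 1))"
  have \<beta>: "\<beta> t = \<gamma> (t / real m) [^] m" if m: "m \<ge> 1" "\<bar>t\<bar> \<le> real m" for m t
  proof -
    define n where "n = nat \<lceil>\<bar>t\<bar>\<rceil> + 1"
    have n: "n \<ge> 1" "\<bar>t\<bar> \<le> real n" unfolding n_def by linarith+
    \<comment> \<open>Two admissible denominators are compared through their product.\<close>
    have *: "\<gamma> (t / real m) [^] m = \<gamma> (t / real (n * m)) [^] (n * m)"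
      if "m \<ge> 1" "\<bar>t\<bar> \<le> real m" "n \<ge> 1" for m n
    proof -
      have eq: "t / real m = real n * (t / real (n * m))" using that by simp
      have le: "\<bar>t / real m\<bar> \<le> 1" using that by (simp add: abs_divide)
      have "\<gamma> (t / real m) = \<gamma> (t / real (n * m)) [^] n"
        using pow[of n "t / real (n * m)"] le unfolding eq by simp
      moreover have "\<bar>t / real (n * m)\<bar> \<le> 1"
      proof -
        have "1 * real m \<le> real n * real m" using that by (intro mult_right_mono) auto
        then have "\<bar>t\<bar> \<le> real n * real m" using that(2) by linarith
        then show ?thesis using that by (simp add: abs_divide divide_le_eq)
      qed
      ultimately show ?thesis using cl by (simp add: nat_pow_pow)
    qed
    show ?thesis unfolding \<beta>_def n_def[symmetric]
      using *[OF m n(1)] *[OF n m(1)] by (simp add: mult.commute)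
  qed
  show thesis
  proof
    show "\<beta> t = \<gamma> t" if "\<bar>t\<bar> \<le> 1" for t using \<beta>[of 1 t] that cl by simp
    show "\<beta> t \<in> carrier G" for t
    proof -
      have "\<bar>t / real (nat \<lceil>\<bar>t\<bar>\<rceil> + 1)\<bar> \<le> 1" by (simp add: abs_divide divide_le_eq) linarith
      then show ?thesis unfolding \<beta>_def using cl by simp
    qed
    show "\<beta> (s + t) = \<beta> s \<otimes> \<beta> t" for s t
    proof -
      obtain m where m: "\<bar>s\<bar> + \<bar>t\<bar> + 1 \<le> real m" using real_arch_simple by blast
      then have m1: "m \<ge> 1" and b: "\<bar>s / real m\<bar> \<le> 1" "\<bar>t / real m\<bar> \<le> 1" "\<bar>s / real m + t / real m\<bar> \<le> 1"
        by (auto simp: abs_divide divide_le_eq add_divide_distrib[symmetric])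
      have "\<gamma> (s / real m + t / real m) = \<gamma> (s / real m) \<otimes> \<gamma> (t / real m)"
        "\<gamma> (t / real m + s / real m) = \<gamma> (t / real m) \<otimes> \<gamma> (s / real m)"
        using b by (intro add; simp add: add.commute)+
      then have com: "\<gamma> (s / real m) \<otimes> \<gamma> (t / real m) = \<gamma> (t / real m) \<otimes> \<gamma> (s / real m)"
        "\<gamma> ((s + t) / real m) = \<gamma> (s / real m) \<otimes> \<gamma> (t / real m)"
        by (simp_all add: add.commute add_divide_distrib)
      have "\<beta> (s + t) = \<gamma> ((s + t) / real m) [^] m" by (rule \<beta>[OF m1]) (use m in linarith)
      also have "\<dots> = \<gamma> (s / real m) [^] m \<otimes> \<gamma> (t / real m) [^] m"
        unfolding com(2) by (rule pow_mult_distrib[OF com(1)]) (use b cl in auto)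
      also have "\<dots> = \<beta> s \<otimes> \<beta> t"
        using \<beta>[OF m1, of s] \<beta>[OF m1, of t] m by simp
      finally show ?thesis .
    qed
  qed
qed

context lie_grp
begin

definition one_param :: "(real \<Rightarrow> 'g) \<Rightarrow> 'e \<Rightarrow> bool" where
  "one_param \<gamma> v \<longleftrightarrow> continuous_map euclideanreal T \<gamma> \<and> (\<forall>s t. \<gamma> (s + t) = \<gamma> s \<otimes> \<gamma> t) \<and>
     ((\<lambda>t. crd (\<gamma> t)) has_vector_derivative v) (at 0)"

lemma one_param_carrier [simp]: "one_param \<gamma> v \<Longrightarrow> \<gamma> t \<in> carrier G"
  unfolding one_param_def continuous_map_def by auto

lemma one_param_0 [simp]: "one_param \<gamma> v \<Longrightarrow> \<gamma> 0 = \<one>"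
proof -
  assume o: "one_param \<gamma> v"
  then have "\<gamma> (0 + 0) = \<gamma> 0 \<otimes> \<gamma> 0" unfolding one_param_def by blast
  then show ?thesis using one_param_carrier[OF o] by (simp add: l_cancel_one)
qed

lemma one_param_limit:
  assumes "one_param \<gamma> v" "(f \<longlongrightarrow> t) F"
  shows "limitin T (\<lambda>s. \<gamma> (f s)) (\<gamma> t) F"
  using continuous_map_limit[of euclideanreal T \<gamma> f t F] assms unfolding one_param_def
  by (simp add: o_def)

lemma one_param_scale:
  assumes "one_param \<gamma> v"
  shows "one_param (\<lambda>t. \<gamma> (r * t)) (r *\<^sub>R v)"
  unfolding one_param_def
proof (intro conjI)
  have "continuous_map euclideanreal euclideanreal (\<lambda>t. r * t)" by (auto intro!: continuous_intros)
  then show "continuous_map euclideanreal T (\<lambda>t. \<gamma> (r * t))"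
    using continuous_map_compose[of euclideanreal euclideanreal "\<lambda>t. r * t" T \<gamma>] assms
    unfolding one_param_def by (simp add: o_def)
  show "\<forall>s t. \<gamma> (r * (s + t)) = \<gamma> (r * s) \<otimes> \<gamma> (r * t)"
    using assms unfolding one_param_def by (simp add: distrib_left)
  have "((\<lambda>t. crd (\<gamma> t)) has_derivative (\<lambda>h. h *\<^sub>R v)) (at (r * 0))"
    using assms unfolding one_param_def has_vector_derivative_def by simp
  moreover have "((\<lambda>t. r * t) has_derivative (\<lambda>h. r * h)) (at 0)" by (auto intro!: derivative_eq_intros)
  ultimately show "((\<lambda>t. crd (\<gamma> (r * t))) has_vector_derivative r *\<^sub>R v) (at 0)"
    using has_derivative_compose[of "\<lambda>t. r * t" "\<lambda>h. r * h" 0 UNIV "\<lambda>t. crd (\<gamma> t)" "\<lambda>h. h *\<^sub>R v"]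
    by (simp add: has_vector_derivative_def mult.commute)
qed

lemma one_param_pow:
  assumes "one_param \<gamma> v"
  shows "\<gamma> (real n * t) = \<gamma> t [^] n"
  using assms
  by (induction n) (auto simp: one_param_def distrib_right add.commute[of 1] dest: one_param_0)

text \<open>Differentiating \<gamma> (t + h) = \<gamma> t \<gamma> h at h = 0 in coordinates: a
  one-parameter subgroup is an integral curve of the left-invariant field, so its existence and
  uniqueness become questions about a differential equation.\<close>

lemma one_param_deriv:
  assumes o: "one_param \<gamma> v" and t: "\<gamma> t \<in> U0"
  shows "((\<lambda>t. crd (\<gamma> t)) has_vector_derivative Q (crd (\<gamma> t)) v) (at t)"
proof -
  let ?y = "\<lambda>t. crd (\<gamma> t)"
  have yd: "?y t \<in> dom" using t by simp
  have 1: "((\<lambda>h. M (?y t, ?y h)) has_derivative (\<lambda>h. M' (?y t, E) (0, h *\<^sub>R v))) (at 0)"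
    using o by (intro M_deriv_snd) (auto simp: yd one_param_def has_vector_derivative_def E_def[symmetric] dest: one_param_0[OF o, THEN subst])
  have "(\<lambda>h. M' (?y t, E) (0, h *\<^sub>R v)) = (\<lambda>h. h *\<^sub>R Q (?y t) v)"
    using linear_cmul[OF Q_linear[OF yd]] by (simp add: Q_def)
  with 1 have 2: "((\<lambda>h. M (?y t, ?y h)) has_derivative (\<lambda>h. h *\<^sub>R Q (?y t) v)) (at 0)" by simp
  have "limitin T \<gamma> \<one> (at 0)" using one_param_limit[OF o tendsto_ident_at, of 0 UNIV] o by simp
  then have "\<forall>\<^sub>F h in at 0. \<gamma> h \<in> U0" by (rule limitin_eventually_U0[OF _ one_U0])
  then have e: "\<forall>\<^sub>F h in at 0. M (?y t, ?y h) = ?y (t + h)"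
  proof eventually_elim
    case (elim h)
    then show ?case using o t by (simp add: M_def one_param_def)
  qed
  have "M (?y t, ?y 0) = ?y (t + 0)" using o t one_U0 U0_carrier[OF t] by (simp add: M_def)
  with has_derivative_transform_eventually[OF 2 e]
  have "((\<lambda>h. ?y (t + h)) has_derivative (\<lambda>h. h *\<^sub>R Q (?y t) v)) (at 0)" by simp
  moreover have "((\<lambda>s. s - t) has_derivative (\<lambda>h. h)) (at t)" by (auto intro!: derivative_eq_intros)
  ultimately have "((\<lambda>s. ?y (t + (s - t))) has_derivative (\<lambda>h. h *\<^sub>R Q (?y t) v)) (at t)"
    using has_derivative_compose[of "\<lambda>s. s - t" "\<lambda>h. h" t UNIV "\<lambda>h. ?y (t + h)"] by simp
  then show ?thesis by (simp add: has_vector_derivative_def)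
qed

text \<open>Constants for integrating left-invariant fields. The Lipschitz constant is proportional
  to the norm of v, so small v meet the contraction condition. On the ball of radius
  \<open>r\<close> the field stays within half the norm of v from v; products of points of the ball
  of radius \<open>\<rho>\<close> stay in the ball of radius \<open>r\<close>, where uniqueness is
  applied to translated solutions.\<close>

lemma exp_radius:
  obtains L r \<rho> where "0 \<le> L" "0 < \<rho>" "\<rho> \<le> r" "cball E r \<subseteq> dom"
    "\<And>a b v. a \<in> cball E r \<Longrightarrow> b \<in> cball E r \<Longrightarrow> norm (Q a v - Q b v) \<le> L * norm v * norm (a - b)"
    "\<And>a v. a \<in> cball E r \<Longrightarrow> norm (Q a v - v) \<le> norm v / 2"
    "\<And>a b. a \<in> cball E \<rho> \<Longrightarrow> b \<in> cball E \<rho> \<Longrightarrow> (a, b) \<in> D \<and> M (a, b) \<in> cball E r"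
proof -
  obtain r0 where r0: "r0 > 0" "cball E r0 \<subseteq> dom"
    using open_dom E_dom open_contains_cball by metis
  have "\<forall>i. \<exists>L\<ge>0. \<forall>x\<in>cball E r0. \<forall>y\<in>cball E r0. norm (Q x i - Q y i) \<le> L * norm (x - y)"
    using Ck_on_lipschitz_cball[OF Q_Ck r0(2)] by blast
  then obtain l where l: "\<And>i. l i \<ge> 0"
    "\<And>i x y. x \<in> cball E r0 \<Longrightarrow> y \<in> cball E r0 \<Longrightarrow> norm (Q x i - Q y i) \<le> l i * norm (x - y)"
    by metis
  define L where "L = (\<Sum>i\<in>Basis. l i)"
  have L0: "0 \<le> L" unfolding L_def using l(1) by (simp add: sum_nonneg)
  have lip: "norm (Q a v - Q b v) \<le> L * norm v * norm (a - b)" if "a \<in> cball E r0" "b \<in> cball E r0" for a b v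
  proof -
    have rep: "Q a v = (\<Sum>i\<in>Basis. (v \<bullet> i) *\<^sub>R Q a i)" if "a \<in> cball E r0" for a
      using linear_representation[OF Q_linear] that r0 by blast
    have "Q a v - Q b v = (\<Sum>i\<in>Basis. (v \<bullet> i) *\<^sub>R (Q a i - Q b i))"
      using rep[OF that(1)] rep[OF that(2)] by (simp only: sum_subtractf scaleR_diff_right)
    also have "norm \<dots> \<le> (\<Sum>i\<in>Basis. norm v * (l i * norm (a - b)))"
    proof (rule sum_norm_le)
      fix i :: 'e assume "i \<in> Basis"
      then show "norm ((v \<bullet> i) *\<^sub>R (Q a i - Q b i)) \<le> norm v * (l i * norm (a - b))"
        using l(2)[OF that, of i] by (simp add: Basis_le_norm mult_mono)
    qed
    also have "\<dots> = L * norm v * norm (a - b)"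
      by (simp add: L_def sum_distrib_left sum_distrib_right mult_ac)
    finally show ?thesis .
  qed
  \<comment> \<open>Makes L * r at most 1/2, also for L = 0.\<close>
  define r where "r = min r0 (1 / (2 * (L + 1)))"
  have r: "0 < r" "r \<le> r0" "L * r \<le> 1/2"
  proof -
    show "0 < r" "r \<le> r0" using r0 L0 by (auto simp: r_def)
    have "L * r \<le> L * (1 / (2 * (L + 1)))" using L0 by (intro mult_left_mono) (auto simp: r_def)
    also have "\<dots> \<le> 1/2" using L0 by (simp add: divide_simps)
    finally show "L * r \<le> 1/2" .
  qed
  have sub: "cball E r \<subseteq> cball E r0" using r(2) by (rule subset_cball)
  have half: "norm (Q a v - v) \<le> norm v / 2" if "a \<in> cball E r" for a v
  proof -
    have "norm (Q a v - Q E v) \<le> L * norm v * norm (a - E)"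
      using that sub r0 by (intro lip) auto
    also have "\<dots> \<le> L * norm v * r"
      using that L0 by (intro mult_left_mono) (auto simp: dist_norm norm_minus_commute)
    also have "\<dots> = (L * r) * norm v" by simp
    also have "\<dots> \<le> 1/2 * norm v" by (rule mult_right_mono[OF r(3)]) simp
    finally show ?thesis by simp
  qed
  have "continuous_on D M" by (rule Ck_on_imp_continuous_on[OF M_Ck[of 0]])
  then have "open (D \<inter> M -` ball E r)"
    using continuous_on_open_vimage[OF open_D] open_ball by (metis inf_commute)
  moreover have "(E, E) \<in> D \<inter> M -` ball E r" using r by simp
  ultimately obtain e where e: "e > 0" "cball (E, E) e \<subseteq> D \<inter> M -` ball E r"
    using open_contains_cball by metis
  define \<rho> where "\<rho> = min r (e/2)"
  have "(a, b) \<in> D \<and> M (a, b) \<in> cball E r" if "a \<in> cball E \<rho>" "b \<in> cball E \<rho>" for a b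
  proof -
    have "dist (E, E) (a, b) \<le> dist E a + dist E b"
      by (simp add: dist_Pair_Pair sqrt_sum_squares_le_sum)
    then have "(a, b) \<in> cball (E, E) e" using that by (simp add: \<rho>_def)
    then show ?thesis using e by auto
  qed
  then show thesis
    using L0 r e(1) lip half sub r0 by (intro that[of L \<rho> r]) (auto simp: \<rho>_def)
qed

end

section \<open>Uniqueness and existence of one-parameter subgroups, and the exponential map\<close>

context lie_grp
begin

lemma one_param_locally_eq:
  assumes o: "one_param \<alpha> v" "one_param \<beta> v" and \<tau>: "\<tau> > 0" "\<And>t. \<bar>t\<bar> \<le> \<tau> \<Longrightarrow> \<alpha> t = \<beta> t"
  shows "\<alpha> t = \<beta> t"
proof -
  obtain n where n: "\<bar>t\<bar> / \<tau> + 1 \<le> real n" using real_arch_simple by blast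
  moreover have "0 \<le> \<bar>t\<bar> / \<tau>" using \<tau> by simp
  ultimately have n0: "real n > 0" by linarith
  have "\<bar>t\<bar> / \<tau> \<le> real n" using n by linarith
  then have "\<bar>t / real n\<bar> \<le> \<tau>" using n0 \<tau>(1) by (simp add: abs_divide field_simps)
  then have "\<alpha> (t / real n) = \<beta> (t / real n)" by (rule \<tau>(2))
  then show ?thesis
    using one_param_pow[OF o(1), of n "t / real n"] one_param_pow[OF o(2), of n "t / real n"] n0 by simp
qed

text \<open>Near time 0 both curves solve the same equation inside the ball where the Lipschitz
  bound holds; the local agreement spreads to all times by taking powers.\<close>

lemma one_param_unique:
  assumes o: "one_param \<alpha> v" "one_param \<beta> v"
  shows "\<alpha> t = \<beta> t"
proof -
  obtain L r \<rho> where L: "0 \<le> L" and r: "0 < \<rho>" "\<rho> \<le> r" "cball E r \<subseteq> dom"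
    and lip: "\<And>a b v. a \<in> cball E r \<Longrightarrow> b \<in> cball E r \<Longrightarrow> norm (Q a v - Q b v) \<le> L * norm v * norm (a - b)"
    using exp_radius by metis
  \<comment> \<open>Slowing time down by this factor brings the Lipschitz constant to at most 1/2,
    below the threshold 1 of the uniqueness lemma.\<close>
  define \<epsilon> where "\<epsilon> = 1 / (2 * (L * norm v + 1))"
  have Lv: "0 \<le> L * norm v" using L by simp
  have \<epsilon>: "\<epsilon> > 0" "L * norm (\<epsilon> *\<^sub>R v) \<le> 1/2"
  proof -
    show "\<epsilon> > 0" unfolding \<epsilon>_def using Lv by simp
    then have "L * norm (\<epsilon> *\<^sub>R v) = (L * norm v) / (2 * (L * norm v + 1))"
      by (simp add: \<epsilon>_def)
    also have "\<dots> \<le> 1/2" using Lv by (simp add: divide_simps)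
    finally show "L * norm (\<epsilon> *\<^sub>R v) \<le> 1/2" .
  qed
  have o': "one_param (\<lambda>t. \<alpha> (\<epsilon> * t)) (\<epsilon> *\<^sub>R v)" "one_param (\<lambda>t. \<beta> (\<epsilon> * t)) (\<epsilon> *\<^sub>R v)"
    using o one_param_scale by auto
  have near: "\<exists>\<tau>>0. \<forall>t. \<bar>t\<bar> \<le> \<tau> \<longrightarrow> \<eta> t \<in> U0 \<and> crd (\<eta> t) \<in> cball E r" if "one_param \<eta> w" for \<eta> w
  proof -
    have l: "limitin T \<eta> \<one> (nhds 0)"
      using one_param_limit[OF that filterlim_ident, of 0] that by simp
    have "\<forall>\<^sub>F t in nhds 0. crd (\<eta> t) \<in> ball E r"
      using topological_tendstoD[OF crd_limit_one[OF l] open_ball] r by simp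
    with limitin_eventually_U0[OF l one_U0]
    have "\<forall>\<^sub>F t in nhds 0. \<eta> t \<in> U0 \<and> crd (\<eta> t) \<in> ball E r" by eventually_elim simp
    then obtain d where d: "d > 0" "\<And>t. dist t 0 < d \<Longrightarrow> \<eta> t \<in> U0 \<and> crd (\<eta> t) \<in> ball E r"
      unfolding eventually_nhds_metric by blast
    show ?thesis
    proof (intro exI[of _ "d/2"] conjI allI impI)
      fix t :: real assume "\<bar>t\<bar> \<le> d/2"
      then have "dist t 0 < d" using d(1) by simp
      from d(2)[OF this] show "\<eta> t \<in> U0" "crd (\<eta> t) \<in> cball E r" by auto
    qed (use d in simp)
  qed
  obtain a b where ab: "a > 0" "b > 0"
    "\<And>t. \<bar>t\<bar> \<le> a \<Longrightarrow> \<alpha> (\<epsilon> * t) \<in> U0 \<and> crd (\<alpha> (\<epsilon> * t)) \<in> cball E r"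
    "\<And>t. \<bar>t\<bar> \<le> b \<Longrightarrow> \<beta> (\<epsilon> * t) \<in> U0 \<and> crd (\<beta> (\<epsilon> * t)) \<in> cball E r"
    using near[OF o'(1)] near[OF o'(2)] by blast
  define \<tau> where "\<tau> = min 1 (min a b)"
  have \<tau>: "\<tau> > 0" "\<tau> \<le> 1" "\<tau> \<le> a" "\<tau> \<le> b" using ab by (auto simp: \<tau>_def)
  have "\<alpha> (\<epsilon> * t) = \<beta> (\<epsilon> * t)" if t: "\<bar>t\<bar> \<le> \<tau>" for t
  proof -
    have "crd (\<alpha> (\<epsilon> * t)) = crd (\<beta> (\<epsilon> * t))"
    proof (rule ode_solution_unique[where S = "{-\<tau>..\<tau>}" and X = "\<lambda>b. Q b (\<epsilon> *\<^sub>R v)" and r = r and E = E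
          and y = "\<lambda>t. crd (\<alpha> (\<epsilon> * t))" and z = "\<lambda>t. crd (\<beta> (\<epsilon> * t))" and t = t])
      show "norm (Q a (\<epsilon> *\<^sub>R v) - Q b (\<epsilon> *\<^sub>R v)) \<le> (L * norm (\<epsilon> *\<^sub>R v)) * norm (a - b)"
        if "a \<in> cball E r" "b \<in> cball E r" for a b by (rule lip[OF that])
      show "0 \<le> L * norm (\<epsilon> *\<^sub>R v)" using L by simp
      show "L * norm (\<epsilon> *\<^sub>R v) < 1" using \<epsilon> by linarith
      fix s assume s: "s \<in> {-\<tau>..\<tau>}"
      then have sa: "\<alpha> (\<epsilon> * s) \<in> U0" "crd (\<alpha> (\<epsilon> * s)) \<in> cball E r"
        and sb: "\<beta> (\<epsilon> * s) \<in> U0" "crd (\<beta> (\<epsilon> * s)) \<in> cball E r"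
        using ab(3)[of s] ab(4)[of s] \<tau> by auto
      show "crd (\<alpha> (\<epsilon> * s)) \<in> cball E r" "crd (\<beta> (\<epsilon> * s)) \<in> cball E r" by fact+
      show "((\<lambda>t. crd (\<alpha> (\<epsilon> * t))) has_vector_derivative Q (crd (\<alpha> (\<epsilon> * s))) (\<epsilon> *\<^sub>R v)) (at s within {-\<tau>..\<tau>})"
        using one_param_deriv[OF o'(1) sa(1)] has_vector_derivative_at_within by blast
      show "((\<lambda>t. crd (\<beta> (\<epsilon> * t))) has_vector_derivative Q (crd (\<beta> (\<epsilon> * s))) (\<epsilon> *\<^sub>R v)) (at s within {-\<tau>..\<tau>})"
        using one_param_deriv[OF o'(2) sb(1)] has_vector_derivative_at_within by blast
    qed (use \<tau> t o in auto)
    then have "c (crd (\<alpha> (\<epsilon> * t))) = c (crd (\<beta> (\<epsilon> * t)))" by simp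
    then show ?thesis using ab(3)[of t] ab(4)[of t] \<tau> t by simp
  qed
  from one_param_locally_eq[OF o' \<tau>(1) this, of "t / \<epsilon>"] show ?thesis using \<epsilon>(1) by simp
qed

text \<open>For small v the equation y' = Q y v is solved on all of [-1, 1]. Left invariance makes u
  -> M (y s, y u) a solution with the same initial value as u -> y (s + u), so y is a local
  homomorphism, which extends to the line. The velocity stays within half the norm of v from v,
  which locates the point at time 1.\<close>

lemma one_param_near:
  obtains \<delta> \<rho> where "0 < \<delta>" "cball E \<rho> \<subseteq> dom"
    "\<And>v. norm v \<le> \<delta> \<Longrightarrow> \<exists>\<gamma> b. one_param \<gamma> v \<and> b \<in> cball E \<rho> \<and> \<gamma> 1 = c b \<and> norm (b - E - v) \<le> norm v / 2"
proof -
  obtain L r \<rho> where L: "0 \<le> L" and r: "0 < \<rho>" "\<rho> \<le> r" "cball E r \<subseteq> dom"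
    and lip: "\<And>a b v. a \<in> cball E r \<Longrightarrow> b \<in> cball E r \<Longrightarrow> norm (Q a v - Q b v) \<le> L * norm v * norm (a - b)"
    and half: "\<And>a v. a \<in> cball E r \<Longrightarrow> norm (Q a v - v) \<le> norm v / 2"
    and prod: "\<And>a b. a \<in> cball E \<rho> \<Longrightarrow> b \<in> cball E \<rho> \<Longrightarrow> (a, b) \<in> D \<and> M (a, b) \<in> cball E r"
    using exp_radius by metis
  define \<delta> where "\<delta> = min (\<rho> / 2) (1 / (2 * (L + 1)))"
  have \<delta>: "\<delta> > 0" using r L by (simp add: \<delta>_def)
  have sub: "cball E \<rho> \<subseteq> cball E r" using r(2) by (rule subset_cball)
  have "\<exists>\<gamma> b. one_param \<gamma> v \<and> b \<in> cball E \<rho> \<and> \<gamma> 1 = c b \<and> norm (b - E - v) \<le> norm v / 2"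
    if v: "norm v \<le> \<delta>" for v
  proof -
    have vL: "L * norm v \<le> 1/2"
    proof -
      have "L * norm v \<le> L * (1 / (2 * (L + 1)))" using v L by (intro mult_left_mono) (auto simp: \<delta>_def)
      also have "\<dots> \<le> 1/2" using L by (simp add: divide_simps)
      finally show ?thesis .
    qed
    have "\<exists>y. y 0 = E \<and> (\<forall>t\<in>{-1..1}. y t \<in> cball E \<rho> \<and>
        (y has_vector_derivative Q (y t) v) (at t within {-1..1::real}))"
    proof (rule ode_solution_exists[OF r(1), of "L * norm v"])
      show "norm (Q a v - Q b v) \<le> (L * norm v) * norm (a - b)" if "a \<in> cball E \<rho>" "b \<in> cball E \<rho>" for a b
        using lip sub that by blast
      show "norm (Q a v) \<le> \<rho>" if "a \<in> cball E \<rho>" for a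
      proof -
        have "norm v \<le> \<rho> / 2" using v by (simp add: \<delta>_def)
        then show ?thesis
          using half[OF subsetD[OF sub that], of v] norm_triangle_sub[of "Q a v" v] norm_ge_zero[of v] by linarith
      qed
    qed (use L vL in auto)
    then obtain y where y0: "y 0 = E" and yb: "\<And>t. t \<in> {-1..1} \<Longrightarrow> y t \<in> cball E \<rho>"
      and yd: "\<And>t. t \<in> {-1..1} \<Longrightarrow> (y has_vector_derivative Q (y t) v) (at t within {-1..1::real})"
      by blast
    have hom: "(y s, y t) \<in> D \<and> M (y s, y t) = y (s + t)" if s: "\<bar>s\<bar> \<le> 1" and t: "\<bar>t\<bar> \<le> 1" and st: "\<bar>s + t\<bar> \<le> 1" for s t
    proof
      have ys: "y s \<in> cball E \<rho>" using yb[of s] s by (simp add: abs_le_iff)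
      show "(y s, y t) \<in> D" using prod[OF ys] yb[of t] t by (simp add: abs_le_iff)
      \<comment> \<open>The times u for which both u and s + u lie in [-1, 1].\<close>
      let ?S = "{max (-1) (-1 - s)..min 1 (1 - s)}"
      have S: "u \<in> {-1..1}" "s + u \<in> {-1..1}" if "u \<in> ?S" for u using that by auto
      show "M (y s, y t) = y (s + t)"
      proof (rule ode_solution_unique[where S = ?S and X = "\<lambda>b. Q b v" and r = r and E = E and t = t
            and y = "\<lambda>u. M (y s, y u)" and z = "\<lambda>u. y (s + u)"])
        show "norm (Q a v - Q b v) \<le> (L * norm v) * norm (a - b)" if "a \<in> cball E r" "b \<in> cball E r" for a b
          using lip that by blast
        show "0 \<le> L * norm v" "L * norm v < 1" using L vL by auto
        show "0 \<in> ?S" "t \<in> ?S" "?S \<subseteq> {-1..1}" using s t st by auto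
        show "M (y s, y 0) = y (s + 0)"
        proof -
          have "y s \<in> dom" using ys sub r by blast
          then show ?thesis by (simp add: y0)
        qed
        fix u assume u: "u \<in> ?S"
        have p: "(y s, y u) \<in> D" "M (y s, y u) \<in> cball E r" using prod[OF ys yb[OF S(1)[OF u]]] by auto
        then show "M (y s, y u) \<in> cball E r" by simp
        show "y (s + u) \<in> cball E r" using yb[OF S(2)[OF u]] sub by blast
        have "(y has_vector_derivative Q (y (s + u)) v) (at (s + u) within (\<lambda>u. s + u) ` ?S)"
          by (rule has_vector_derivative_within_subset[OF yd[OF S(2)[OF u]]]) (use S in auto)
        moreover have "((\<lambda>u. s + u) has_vector_derivative 1) (at u within ?S)"
          by (auto intro!: derivative_eq_intros)
        ultimately show "((\<lambda>u. y (s + u)) has_vector_derivative Q (y (s + u)) v) (at u within ?S)"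
          using vector_diff_chain_within[of "\<lambda>u. s + u" 1 u ?S y] by (simp add: o_def)
        have "(y has_vector_derivative Q (y u) v) (at u within ?S)"
          by (rule has_vector_derivative_within_subset[OF yd[OF S(1)[OF u]]]) (use S in auto)
        from M_deriv_snd[OF p(1) this[unfolded has_vector_derivative_def] refl]
        show "((\<lambda>u. M (y s, y u)) has_vector_derivative Q (M (y s, y u)) v) (at u within ?S)"
          unfolding has_vector_derivative_def Q_M[OF p(1)]
          using linear_cmul[OF M'_linear[OF p(1)], of _ "(0, Q (y u) v)"] by simp
      qed auto
    qed
    have ydom: "y t \<in> dom" if "\<bar>t\<bar> \<le> 1" for t using yb[of t] that sub r by (auto simp: abs_le_iff)
    obtain \<beta> where \<beta>: "\<And>t. \<bar>t\<bar> \<le> 1 \<Longrightarrow> \<beta> t = c (y t)" "\<And>t. \<beta> t \<in> carrier G" "\<And>s t. \<beta> (s + t) = \<beta> s \<otimes> \<beta> t"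
    proof (rule local_hom_extends[of "\<lambda>t. c (y t)"])
      show "c (y t) \<in> carrier G" if "\<bar>t\<bar> \<le> 1" for t using ydom[OF that] by simp
      show "c (y (s + t)) = c (y s) \<otimes> c (y t)" if "\<bar>s\<bar> \<le> 1" "\<bar>t\<bar> \<le> 1" "\<bar>s + t\<bar> \<le> 1" for s t
        using hom[OF that] c_M[of "(y s, y t)"] by auto
    qed blast
    have y'0: "(y has_vector_derivative v) (at 0)"
      using yd[of 0] y0 at_within_Icc_at[of "-1" 0 "1::real"] by simp
    have near: "\<forall>\<^sub>F t in at 0. \<bar>t\<bar> \<le> (1::real)"
      unfolding eventually_at by (intro exI[of _ 1]) auto
    have "one_param \<beta> v"
      unfolding one_param_def
    proof (intro conjI allI)
      show "\<beta> (s + t) = \<beta> s \<otimes> \<beta> t" for s t by (rule \<beta>(3))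
      have "(y \<longlongrightarrow> E) (at 0)"
        using has_vector_derivative_continuous[OF y'0] y0 by (simp add: continuous_within)
      then have "limitin T (\<lambda>t. c (y t)) \<one> (at 0)" by (rule c_tendsto_one)
      then have l0: "limitin T \<beta> \<one> (at 0)"
        by (rule limitin_transform_eventually[rotated]) (use near in \<open>eventually_elim, simp add: \<beta>(1)\<close>)
      \<comment> \<open>Continuity at t is moved to the identity by writing \<beta> s as the product
        of \<beta> t and \<beta> (s - t).\<close>
      have "limitin T \<beta> (\<beta> t) (at t)" for t
      proof -
        have "filterlim (\<lambda>s. s - t) (at 0) (at t)"
          unfolding filterlim_at by (auto intro!: tendsto_eq_intros simp: eventually_at_filter)
        then have "limitin T (\<lambda>s. \<beta> (s - t)) \<one> (at t)"
          using l0 unfolding limitin_def by (auto dest: eventually_compose_filterlim)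
        then have "limitin T (\<lambda>s. \<beta> t \<otimes> \<beta> (s - t)) (\<beta> t \<otimes> \<one>) (at t)"
          by (intro limitin_mult) (use \<beta>(2) in auto)
        moreover have "\<beta> t \<otimes> \<beta> (s - t) = \<beta> s" for s using \<beta>(3)[of t "s - t"] by simp
        ultimately show ?thesis using \<beta>(2) by simp
      qed
      then have lim: "\<forall>\<^sub>F s in at t. \<beta> s \<in> V" if "openin T V" "\<beta> t \<in> V" for t V
        using that unfolding limitin_def by blast
      show "continuous_map euclideanreal T \<beta>"
        unfolding continuous_map_atin limitin_atin
      proof (intro ballI conjI impI allI)
        fix t V assume "openin T V \<and> \<beta> t \<in> V"
        then have "\<forall>\<^sub>F s in at t. \<beta> s \<in> V" using lim by blast
        then show "\<exists>U. openin euclideanreal U \<and> t \<in> U \<and> \<beta> ` (U - {t}) \<subseteq> V"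
          unfolding eventually_at_topological open_openin[symmetric] by auto
      qed (use \<beta>(2) in simp)
      have "(y has_derivative (\<lambda>h. h *\<^sub>R v)) (at 0)" using y'0 by (simp add: has_vector_derivative_def)
      then show "((\<lambda>t. crd (\<beta> t)) has_vector_derivative v) (at 0)"
        unfolding has_vector_derivative_def
      proof (rule has_derivative_transform_eventually)
        show "\<forall>\<^sub>F t in at 0. y t = crd (\<beta> t)"
          using near by eventually_elim (simp add: \<beta>(1) ydom)
      qed (simp_all add: \<beta>(1) ydom)
    qed
    moreover have "norm ((y 1 - 1 *\<^sub>R v) - (y 0 - 0 *\<^sub>R v)) \<le> norm v / 2 * \<bar>1 - 0\<bar>"
    proof (rule vector_derivative_bound[of "{-1..1::real}" "\<lambda>t. y t - t *\<^sub>R v" "\<lambda>t. Q (y t) v - v"])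
      show "((\<lambda>t. y t - t *\<^sub>R v) has_vector_derivative Q (y t) v - v) (at t within {- 1..1})" if "t \<in> {-1..1}" for t
        using yd[OF that] by (auto intro!: derivative_eq_intros)
      show "norm (Q (y t) v - v) \<le> norm v / 2" if "t \<in> {-1..1}" for t
        using half yb[OF that] sub by blast
    qed auto
    then have "norm (y 1 - E - v) \<le> norm v / 2" by (simp add: y0 algebra_simps)
    ultimately show ?thesis using \<beta>(1)[of 1] yb[of 1] by (intro exI[of _ \<beta>] exI[of _ "y 1"]) auto
  qed
  with \<delta> sub r show thesis by (intro that[of \<delta> \<rho>]) auto
qed

lemma one_param_exists: "\<exists>\<gamma>. one_param \<gamma> v"
proof -
  obtain \<delta> \<rho> where \<delta>: "0 < \<delta>" "\<And>v. norm v \<le> \<delta> \<Longrightarrow> \<exists>\<gamma>. one_param \<gamma> v"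
    using one_param_near by metis
  define r where "r = (norm v + 1) / \<delta>"
  have r: "r > 0" using \<delta> by (simp add: r_def add_nonneg_pos)
  have "norm ((1 / r) *\<^sub>R v) \<le> \<delta>" using r \<delta>(1) by (simp add: r_def field_simps)
  then obtain \<gamma> where "one_param \<gamma> ((1 / r) *\<^sub>R v)" using \<delta>(2) by blast
  from one_param_scale[OF this, of r] show ?thesis using r by auto
qed

lemma lie_exp_eq: "one_param \<gamma> v \<Longrightarrow> lie_exp G v = \<gamma> 1"
  unfolding lie_exp_def
  by (rule the_equality) (use one_param_unique in \<open>auto simp: one_param_def\<close>)

lemma one_param_lie_exp: "one_param (\<lambda>t. lie_exp G (t *\<^sub>R v)) v"
proof -
  obtain \<gamma> where \<gamma>: "one_param \<gamma> v" using one_param_exists by blast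
  have "lie_exp G (t *\<^sub>R v) = \<gamma> t" for t
    using lie_exp_eq[OF one_param_scale[OF \<gamma>, of t]] by simp
  then show ?thesis using \<gamma> by simp
qed

lemma lie_exp_carrier [simp]: "lie_exp G v \<in> carrier G"
  using one_param_carrier[OF one_param_lie_exp, of 1] by simp

lemma lie_exp_add: "lie_exp G ((s + t) *\<^sub>R v) = lie_exp G (s *\<^sub>R v) \<otimes> lie_exp G (t *\<^sub>R v)"
  using one_param_lie_exp[of v] unfolding one_param_def by blast

lemma lie_exp_0 [simp]: "lie_exp G 0 = \<one>"
  using one_param_0[OF one_param_lie_exp[of 0]] by simp

lemma lie_exp_pow: "lie_exp G (real n *\<^sub>R v) = lie_exp G v [^] n"
  using one_param_pow[OF one_param_lie_exp[of v], of n 1] by simp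

text \<open>A quantitative substitute for the local diffeomorphism property: a vector of small norm
  d goes to a point at coordinate distance between d / 2 and 3 d / 2 from the identity, inside a
  compact chart ball. The upper bound gives compactness and convergence to 1, the lower bound keeps
  limits off the identity.\<close>

lemma lie_exp_near:
  obtains \<delta> \<rho> where "0 < \<delta>" "cball E \<rho> \<subseteq> dom"
    "\<And>v. norm v \<le> \<delta> \<Longrightarrow> \<exists>b\<in>cball E \<rho>. lie_exp G v = c b \<and> norm (b - E - v) \<le> norm v / 2"
  using one_param_near lie_exp_eq by metis

lemma lie_hom_one_param:
  assumes \<phi>: "lie_hom \<phi>" and \<gamma>: "one_param \<gamma> v"
  shows "one_param (\<lambda>t. \<phi> (\<gamma> t)) (differential G \<phi> v)"
  unfolding one_param_def
proof (intro conjI allI)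
  show "continuous_map euclideanreal T (\<lambda>t. \<phi> (\<gamma> t))"
    using continuous_map_compose[of euclideanreal T \<gamma> T \<phi>] \<phi> \<gamma>
    by (simp add: lie_hom_def one_param_def o_def)
  show "\<phi> (\<gamma> (s + t)) = \<phi> (\<gamma> s) \<otimes> \<phi> (\<gamma> t)" for s t
    using lie_hom_mult[OF \<phi>] one_param_carrier[OF \<gamma>] \<gamma> by (simp add: one_param_def)
  have "((\<lambda>t. crd (\<gamma> t)) has_derivative (\<lambda>h. h *\<^sub>R v)) (at 0)"
    using \<gamma> by (simp add: one_param_def has_vector_derivative_def)
  moreover have "limitin T \<gamma> \<one> (at 0)" using one_param_limit[OF \<gamma> tendsto_ident_at, of 0 UNIV] \<gamma> by simp
  ultimately have "((\<lambda>t. crd (\<phi> (\<gamma> t))) has_derivative (\<lambda>h. differential G \<phi> (h *\<^sub>R v))) (at 0)"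
    using \<gamma> by (intro lie_hom_curve[OF \<phi>]) auto
  then show "((\<lambda>t. crd (\<phi> (\<gamma> t))) has_vector_derivative differential G \<phi> v) (at 0)"
    by (simp add: has_vector_derivative_def linear_cmul[OF differential_linear[OF \<phi>]])
qed

lemma lie_hom_exp: "lie_hom \<phi> \<Longrightarrow> \<phi> (lie_exp G v) = lie_exp G (differential G \<phi> v)"
  using lie_exp_eq[OF lie_hom_one_param[OF _ one_param_lie_exp]] by simp

lemma conj_exp: "g \<in> carrier G \<Longrightarrow> g \<otimes> lie_exp G v \<otimes> inv g = lie_exp G (Ad G g v)"
  using lie_hom_exp[OF lie_hom_conj] by (simp add: Ad_def)

lemma Ad_exp_derivative:
  "((\<lambda>t. Ad G (lie_exp G (t *\<^sub>R X)) v) has_vector_derivative bracket G X v) (at 0)"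
proof -
  let ?\<gamma> = "\<lambda>t. lie_exp G (t *\<^sub>R X)"
  have o: "one_param ?\<gamma> X" by (rule one_param_lie_exp)
  have "((\<lambda>t. crd (?\<gamma> t)) has_vector_derivative X) (at 0)" using o by (simp add: one_param_def)
  then have "((\<lambda>t. Ad G (c (crd (?\<gamma> t))) v) has_vector_derivative bracket G X v) (at 0)"
    unfolding bracket_eq by (rule Ad_curve_derivative) (simp add: E_def)
  then show ?thesis
    unfolding has_vector_derivative_def
  proof (rule has_derivative_transform_eventually)
    have "limitin T ?\<gamma> \<one> (at 0)" using one_param_limit[OF o tendsto_ident_at, of 0 UNIV] by simp
    from limitin_eventually_U0[OF this one_U0]
    show "\<forall>\<^sub>F t in at 0. Ad G (c (crd (?\<gamma> t))) v = Ad G (?\<gamma> t) v" by eventually_elim simp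
  qed (simp_all add: one_U0)
qed

text \<open>The equivariance of Ad along exp (t X) is differentiated at t = 0, where the bracket
  appears as the derivative of Ad.\<close>

lemma lie_hom_bracket:
  assumes \<phi>: "lie_hom \<phi>"
  shows "differential G \<phi> (bracket G X v) = bracket G (differential G \<phi> X) (differential G \<phi> v)"
proof -
  let ?d = "differential G \<phi>"
  have lin: "linear ?d" by (rule differential_linear[OF \<phi>])
  then have "bounded_linear ?d" by (simp add: linear_conv_bounded_linear)
  from bounded_linear.has_vector_derivative[OF this Ad_exp_derivative]
  have "((\<lambda>t. ?d (Ad G (lie_exp G (t *\<^sub>R X)) v)) has_vector_derivative ?d (bracket G X v)) (at 0)" .
  moreover have "?d (Ad G (lie_exp G (t *\<^sub>R X)) v) = Ad G (lie_exp G (t *\<^sub>R ?d X)) (?d v)" for t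
    using lie_hom_Ad[OF \<phi> lie_exp_carrier] lie_hom_exp[OF \<phi>] by (simp add: linear_cmul[OF lin])
  ultimately show ?thesis
    using vector_derivative_unique_at[OF _ Ad_exp_derivative] by simp
qed

end

section \<open>Traces and the Killing form\<close>

lemma lie_trace_add: "lie_trace (\<lambda>z. A z + B z) = lie_trace A + lie_trace B"
  by (simp add: lie_trace_def inner_add_left sum.distrib)

lemma lie_trace_scale: "lie_trace (\<lambda>z. r *\<^sub>R A z) = r * lie_trace A"
  by (simp add: lie_trace_def sum_distrib_left)

lemma lie_trace_commute:
  fixes A B :: "'e::euclidean_space \<Rightarrow> 'e"
  assumes A: "linear A" and B: "linear B"
  shows "lie_trace (\<lambda>z. A (B z)) = lie_trace (\<lambda>z. B (A z))"
proof -
  have *: "lie_trace (\<lambda>z. A (B z)) = (\<Sum>b\<in>Basis. \<Sum>i\<in>Basis. (B b \<bullet> i) * (A i \<bullet> b))" if "linear A" for A B :: "'e \<Rightarrow> 'e"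
    unfolding lie_trace_def
    by (subst linear_representation[OF that]) (simp add: inner_sum_left)
  show ?thesis
    unfolding *[OF A] *[OF B] by (subst sum.swap) (simp add: mult.commute)
qed

context lie_grp
begin

lemma bracket_bilinear: "bilinear (bracket G)"
  unfolding bilinear_def using bracket_linear by blast

lemmas bracket_simps =
  linear_add[OF bracket_linear(1)] linear_add[OF bracket_linear(2)]
  linear_cmul[OF bracket_linear(1)] linear_cmul[OF bracket_linear(2)]

lemma killing_form_bilinear: "bilinear (killing_form G)"
  unfolding bilinear_def killing_form_def
  by (auto intro!: linearI simp: bracket_simps lie_trace_add lie_trace_scale)

lemma killing_form_commute: "killing_form G v w = killing_form G w v"
  unfolding killing_form_def by (rule lie_trace_commute; rule bracket_linear)

text \<open>The differential conjugates ad v to ad of its image, and traces are invariant under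
  conjugation. Its inverse \<open>\<psi>\<close> is Ad of the inverse element in one application and
  the differential itself in the other.\<close>

lemma killing_form_hom:
  assumes \<phi>: "lie_hom \<phi>" and \<psi>: "linear \<psi>"
    and inv: "\<And>v. differential G \<phi> (\<psi> v) = v" "\<And>v. \<psi> (differential G \<phi> v) = v"
  shows "killing_form G (differential G \<phi> v) (differential G \<phi> w) = killing_form G v w"
proof -
  let ?d = "differential G \<phi>"
  have b: "bracket G (?d v) z = ?d (bracket G v (\<psi> z))" for v z
    unfolding lie_hom_bracket[OF \<phi>] inv ..
  have "killing_form G (?d v) (?d w) = lie_trace (\<lambda>z. ?d (bracket G v (bracket G w (\<psi> z))))"
    unfolding killing_form_def b inv ..
  also have "\<dots> = lie_trace (\<lambda>z. bracket G v (bracket G w (\<psi> (?d z))))"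
  proof (rule lie_trace_commute[OF differential_linear[OF \<phi>], of "\<lambda>z. bracket G v (bracket G w (\<psi> z))"])
    have "linear (bracket G v \<circ> (bracket G w \<circ> \<psi>))" by (intro linear_compose bracket_linear \<psi>)
    then show "linear (\<lambda>z. bracket G v (bracket G w (\<psi> z)))" by (simp add: o_def)
  qed
  also have "\<dots> = killing_form G v w" by (simp add: inv killing_form_def)
  finally show ?thesis .
qed

lemma killing_form_Ad:
  assumes "g \<in> carrier G"
  shows "killing_form G (Ad G g v) (Ad G g w) = killing_form G v w"
proof -
  let ?c = "\<lambda>x. g \<otimes> x \<otimes> inv g"
  have "killing_form G (differential G ?c v) (differential G ?c w) = killing_form G v w"
    by (rule killing_form_hom[OF lie_hom_conj[OF assms] Ad_linear[OF inv_closed[OF assms]]])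
       (simp_all only: Ad_def[of G g, symmetric] Ad_inv_left[OF assms] Ad_inv_right[OF assms])
  then show ?thesis by (simp only: Ad_def)
qed

lemma killing_form_involution:
  assumes "group_involution G \<sigma>"
  shows "killing_form G (differential G \<sigma> v) (differential G \<sigma> w) = killing_form G v w"
  by (rule killing_form_hom[OF lie_hom_involution[OF assms]
        differential_linear[OF lie_hom_involution[OF assms]]])
     (rule differential_involution[OF assms])+

end

section \<open>Growth of the adjoint action\<close>

locale symmetric_lie_grp = lie_grp G for G :: "('g, 'e::euclidean_space) lie_data" (structure) +
  fixes \<sigma> \<theta> :: "'g \<Rightarrow> 'g"
  assumes \<sigma>: "group_involution G \<sigma>" and cartan: "cartan_involution G \<theta>"
    and commute: "x \<in> carrier G \<Longrightarrow> \<sigma> (\<theta> x) = \<theta> (\<sigma> x)"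
begin

lemma \<theta>: "group_involution G \<theta>"
  using cartan by (simp add: cartan_involution_def)

abbreviation d\<sigma> where "d\<sigma> \<equiv> differential G \<sigma>"
abbreviation d\<theta> where "d\<theta> \<equiv> differential G \<theta>"

lemmas hom_\<sigma> = lie_hom_involution[OF \<sigma>] and hom_\<theta> = lie_hom_involution[OF \<theta>]
lemmas lin_\<sigma> = differential_linear[OF hom_\<sigma>] and lin_\<theta> = differential_linear[OF hom_\<theta>]
lemmas d\<sigma>_d\<sigma> = differential_involution[OF \<sigma>] and d\<theta>_d\<theta> = differential_involution[OF \<theta>]

lemma d\<sigma>_d\<theta>: "d\<sigma> (d\<theta> v) = d\<theta> (d\<sigma> v)"
proof -
  have "differential G (\<lambda>x. \<sigma> (\<theta> x)) = differential G (\<lambda>x. \<theta> (\<sigma> x))"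
    by (rule differential_cong[OF lie_hom_compose(1)[OF hom_\<sigma> hom_\<theta>]]) (rule commute)
  then show ?thesis
    using lie_hom_compose(2)[OF hom_\<sigma> hom_\<theta>] lie_hom_compose(2)[OF hom_\<theta> hom_\<sigma>] by metis
qed

definition ip where "ip v w = - killing_form G v (d\<theta> w)"

lemma ip_bilinear: "bilinear ip"
proof -
  have "linear (killing_form G v)" "linear (\<lambda>v. killing_form G v w)" for v w
    using killing_form_bilinear by (auto simp: bilinear_def)
  then have "linear (\<lambda>w. - (killing_form G v \<circ> d\<theta>) w)" "linear (\<lambda>v. - killing_form G v w)" for v w
    by (intro linear_compose_neg linear_compose lin_\<theta>; blast)+
  then show ?thesis by (simp add: bilinear_def ip_def)
qed

lemmas ip_simps = bilinear_ladd[OF ip_bilinear] bilinear_radd[OF ip_bilinear]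
  bilinear_lmul[OF ip_bilinear] bilinear_rmul[OF ip_bilinear] bilinear_lneg[OF ip_bilinear]
  bilinear_rneg[OF ip_bilinear] bilinear_lsub[OF ip_bilinear] bilinear_rsub[OF ip_bilinear]

lemma ip_commute: "ip v w = ip w v"
proof -
  have "killing_form G v (d\<theta> w) = killing_form G (d\<theta> (d\<theta> w)) (d\<theta> v)"
    unfolding killing_form_involution[OF \<theta>] by (rule killing_form_commute)
  then show ?thesis by (simp add: ip_def d\<theta>_d\<theta>)
qed

lemma ip_pos: "v \<noteq> 0 \<Longrightarrow> 0 < ip v v"
  using cartan by (simp add: cartan_involution_def ip_def)

lemma ip_nonneg: "0 \<le> ip v v"
  using ip_pos[of v] bilinear_lzero[OF ip_bilinear, of v] by (cases "v = 0") auto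

lemma ip_\<sigma>: "ip (d\<sigma> v) (d\<sigma> w) = ip v w"
  unfolding ip_def d\<sigma>_d\<theta>[symmetric] killing_form_involution[OF \<sigma>] ..

lemma ip_bounded_bilinear: "bounded_bilinear ip"
  using ip_bilinear bilinear_conv_bounded_bilinear by blast

text \<open>The growth estimates live in \<open>ip\<close>, whereas limits and charts use the norm
  of \<open>'e\<close>; the lower constant is the minimum of \<open>ip v v\<close> on the unit
  sphere.\<close>

lemma ip_norm_bounds: obtains m M where "0 < m" "0 < M" "\<And>v. m * (norm v)\<^sup>2 \<le> ip v v" "\<And>v. ip v v \<le> M * (norm v)\<^sup>2"
proof -
  obtain M where M: "M > 0" "\<And>v w. norm (ip v w) \<le> norm v * norm w * M"
    using bounded_bilinear.pos_bounded[OF ip_bounded_bilinear] by blast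
  have "\<exists>m>0. \<forall>v. m * (norm v)\<^sup>2 \<le> ip v v"
  proof -
    have "continuous_on (sphere 0 1) (\<lambda>v. ip v v)"
      by (intro bounded_bilinear.continuous_on[OF ip_bounded_bilinear] continuous_intros)
    from continuous_attains_inf[OF compact_sphere _ this]
    obtain v0 where v0: "v0 \<in> sphere 0 1" "\<And>v. v \<in> sphere 0 1 \<Longrightarrow> ip v0 v0 \<le> ip v v" by auto
    have "ip v0 v0 * (norm v)\<^sup>2 \<le> ip v v" for v
    proof (cases "v = 0")
      case False
      have "ip v0 v0 \<le> ip ((1 / norm v) *\<^sub>R v) ((1 / norm v) *\<^sub>R v)" using False by (intro v0(2)) simp
      then show ?thesis using False by (simp add: ip_simps divide_simps power2_eq_square)
    qed (simp add: ip_nonneg)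
    moreover have "ip v0 v0 > 0" using v0(1) by (intro ip_pos) auto
    ultimately show ?thesis by blast
  qed
  then obtain m where "m > 0" "\<And>v. m * (norm v)\<^sup>2 \<le> ip v v" by blast
  moreover have "ip v v \<le> M * (norm v)\<^sup>2" for v
    using M(2)[of v v] by (simp add: power2_eq_square mult_ac)
  ultimately show thesis using M(1) that[of m M] by simp
qed

section \<open>The flow of an element of the common -1 eigenspace of the two involutions\<close>

context
  fixes X assumes X\<sigma>: "d\<sigma> X = - X" and X\<theta>: "d\<theta> X = - X"
begin

definition flow where "flow t v = Ad G (lie_exp G (t *\<^sub>R X)) v"

lemma flow_linear: "linear (flow t)"
  unfolding flow_def[abs_def] by (intro Ad_linear lie_exp_carrier)

lemma flow_add: "flow (s + t) v = flow s (flow t v)"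
  by (simp add: flow_def lie_exp_add Ad_mult)

lemma flow_0: "flow 0 v = v"
  by (simp add: flow_def Ad_one)

lemma hom_flow:
  assumes "lie_hom \<phi>" "differential G \<phi> X = - X"
  shows "differential G \<phi> (flow t v) = flow (- t) (differential G \<phi> v)"
  using lie_hom_Ad[OF assms(1) lie_exp_carrier] lie_hom_exp[OF assms(1)] assms(2)
  by (simp add: flow_def linear_cmul[OF differential_linear[OF assms(1)]])

text \<open>\<open>d\<theta>\<close> turns the flow at time t into the flow at time -t, and the
  Killing form is invariant when the flow is applied to both arguments.\<close>

lemma flow_symmetric: "ip (flow t v) w = ip v (flow t w)"
proof -
  have "killing_form G (flow t v) (flow t (flow (-t) (d\<theta> w))) = killing_form G v (flow (-t) (d\<theta> w))"
    unfolding flow_def by (rule killing_form_Ad) simp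
  moreover have "flow t (flow (-t) (d\<theta> w)) = d\<theta> w" using flow_add[of t "-t"] flow_0 by simp
  ultimately show ?thesis by (simp add: ip_def hom_flow[OF hom_\<theta> X\<theta>])
qed

lemma flow_deriv: "((\<lambda>t. flow t v) has_vector_derivative flow t (bracket G X v)) (at t)"
proof -
  have "bounded_linear (flow t)" using flow_linear by (simp add: linear_conv_bounded_linear)
  from bounded_linear.has_vector_derivative[OF this Ad_exp_derivative[of X v]]
  have "((\<lambda>h. flow t (flow h v)) has_vector_derivative flow t (bracket G X v)) (at (t - t))"
    unfolding flow_def by simp
  moreover have "((\<lambda>s. s - t) has_vector_derivative 1) (at t)" by (auto intro!: derivative_eq_intros)
  ultimately have "((\<lambda>s. flow t (flow (s - t) v)) has_vector_derivative 1 *\<^sub>R flow t (bracket G X v)) (at t)"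
    using vector_diff_chain_at[of "\<lambda>s. s - t" 1 t "\<lambda>h. flow t (flow h v)"] by (simp add: o_def)
  then show ?thesis by (simp flip: flow_add)
qed

lemma flow_bracket: "flow t (bracket G X v) = bracket G X (flow t v)"
proof -
  have "((\<lambda>h. flow h (flow t v)) has_vector_derivative bracket G X (flow t v)) (at 0)"
    using flow_deriv[of "flow t v" 0] by (simp add: flow_0)
  moreover have "(\<lambda>h. flow h (flow t v)) = (\<lambda>h. flow t (flow h v))"
    by (simp flip: flow_add add: add.commute)
  moreover have "((\<lambda>h. flow t (flow h v)) has_vector_derivative flow t (bracket G X v)) (at 0)"
  proof -
    have "bounded_linear (flow t)" using flow_linear by (simp add: linear_conv_bounded_linear)
    from bounded_linear.has_vector_derivative[OF this flow_deriv[of v 0]] show ?thesis by (simp add: flow_0)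
  qed
  ultimately show ?thesis using vector_derivative_unique_at by fastforce
qed

lemma ip_flow_deriv: "((\<lambda>t. ip (flow t v) w) has_real_derivative ip (flow t (bracket G X v)) w) (at t)"
  using bounded_linear.has_vector_derivative[OF
      bounded_bilinear.bounded_linear_left[OF ip_bounded_bilinear, of w] flow_deriv[of v t]]
  by (simp add: has_real_derivative_iff_has_vector_derivative)

lemma ip_bracket_symmetric: "ip (bracket G X v) w = ip v (bracket G X w)"
proof -
  have "((\<lambda>t. ip (flow t v) w) has_real_derivative ip (bracket G X v) w) (at 0)"
    using ip_flow_deriv[of v w 0] by (simp add: flow_0)
  moreover have "((\<lambda>t. ip (flow t v) w) has_real_derivative ip (bracket G X w) v) (at 0)"
    using ip_flow_deriv[of w v 0] by (simp add: flow_0 flow_symmetric ip_commute[of _ v])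
  ultimately show ?thesis using DERIV_unique ip_commute by metis
qed

text \<open>As \<open>d\<sigma>\<close> reverses the flow and preserves \<open>ip\<close>, the
  function ip (flow t w) w is even in t. Therefore the square of flow (t/2) w - flow (-t/2) w equals
  twice the difference of the two sides of the inequality.\<close>

lemma ip_flow_ge:
  assumes w: "d\<sigma> w = w \<or> d\<sigma> w = - w"
  shows "ip w w \<le> ip (flow t w) w"
proof -
  let ?s = "t / 2"
  have dd: "ip (flow (-t) w) w = ip (flow t w) w"
  proof -
    have "ip (flow t w) w = ip (d\<sigma> (flow t w)) (d\<sigma> w)" by (simp add: ip_\<sigma>)
    also have "\<dots> = ip (flow (- t) (d\<sigma> w)) (d\<sigma> w)" by (simp add: hom_flow[OF hom_\<sigma> X\<sigma>])
    also have "\<dots> = ip (flow (-t) w) w"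
      using w by (auto simp: ip_simps linear_neg[OF flow_linear])
    finally show ?thesis by simp
  qed
  have e: "ip (flow a w) (flow b w) = ip (flow (a + b) w) w" for a b
    by (simp add: flow_add[of b a] flow_symmetric add.commute[of a])
  have "0 \<le> ip (flow ?s w - flow (-?s) w) (flow ?s w - flow (-?s) w)" by (rule ip_nonneg)
  also have "\<dots> = 2 * ip (flow t w) w - 2 * ip w w"
    by (simp add: ip_simps e flow_0 dd)
  finally show ?thesis by simp
qed

text \<open>[X, v] lies in the -1 eigenspace of \<open>d\<sigma>\<close>, hence is orthogonal to v,
  so ip (flow t v) v has derivative 0 at t = 0; its second derivative is at least q. Integrating
  twice up to t = 2 gives the gain 2 * q, and by symmetry the value at 2 is the square of the vector
  at time 1.\<close>

lemma Ad_exp_growth: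
  assumes v: "d\<sigma> v = v"
  shows "2 * ip (bracket G X v) (bracket G X v) \<le> ip (Ad G (lie_exp G X) v) (Ad G (lie_exp G X) v)"
proof -
  let ?w = "bracket G X v"
  define q where "q = ip ?w ?w"
  have w: "d\<sigma> ?w = - ?w"
    using lie_hom_bracket[OF hom_\<sigma>, of X v] linear_neg[OF bracket_linear(1), of X] by (simp add: v X\<sigma>)
  have w0: "ip ?w v = 0"
    using ip_\<sigma>[of ?w v] by (simp add: w v ip_simps)
  define f f' where "f = (\<lambda>t. ip (flow t v) v - q * t^2 / 2)" and "f' = (\<lambda>t. ip (flow t ?w) v - q * t)"
  have d1: "(f has_real_derivative f' t) (at t)" for t
    unfolding f_def f'_def by (auto intro!: derivative_eq_intros ip_flow_deriv)
  have d2: "(f' has_real_derivative (ip (flow t (bracket G X ?w)) v - q)) (at t)" for t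
    unfolding f'_def by (auto intro!: derivative_eq_intros ip_flow_deriv)
  have nonneg2: "0 \<le> ip (flow t (bracket G X ?w)) v - q" for t
  proof -
    have "ip (flow t (bracket G X ?w)) v = ip (flow t ?w) ?w"
      unfolding flow_bracket ip_bracket_symmetric ..
    then show ?thesis using ip_flow_ge[of ?w t] w by (simp add: q_def)
  qed
  have nonneg1: "0 \<le> f' t" if "0 \<le> t" for t
  proof -
    have "f' 0 \<le> f' t"
      by (rule DERIV_nonneg_imp_nondecreasing[OF that]) (use d2 nonneg2 in blast)
    then show ?thesis by (simp add: f'_def flow_0 w0)
  qed
  have "f 0 \<le> f 2"
  proof (rule DERIV_nonneg_imp_nondecreasing[of 0 2 f])
    fix t :: real assume "0 \<le> t"
    then show "\<exists>y. (f has_real_derivative y) (at t) \<and> 0 \<le> y" using d1[of t] nonneg1[of t] by blast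
  qed simp
  then have "ip v v + 2 * q \<le> ip (flow 2 v) v" by (simp add: f_def flow_0)
  moreover have "ip (flow 2 v) v = ip (flow 1 v) (flow 1 v)"
    using flow_add[of 1 1 v] by (simp add: flow_symmetric)
  ultimately show ?thesis using ip_nonneg[of v] by (simp add: q_def flow_def)
qed

end

text \<open>With \<pi> the projection to the fixed space of \<open>d\<sigma>\<close>, ad X exchanges
  the two eigenspaces, that is, ad X (1 - \<pi>) = \<pi> ad X. Cyclicity then gives tr (ad X)^2 = 2
  tr ((ad X)^2 \<pi>), which would be too small if ad X were small on all of the fixed
  space.\<close>

lemma bracket_lower_bound:
  obtains \<kappa> where "0 < \<kappa>"
    "\<And>X. d\<sigma> X = - X \<Longrightarrow> d\<theta> X = - X \<Longrightarrow> \<exists>v. d\<sigma> v = v \<and> norm v \<le> 1 \<and> \<kappa> * norm X \<le> norm (bracket G X v)"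
proof -
  obtain K where K: "K > 0" "\<And>v w. norm (bracket G v w) \<le> norm v * norm w * K"
    using bounded_bilinear.pos_bounded bracket_bilinear bilinear_conv_bounded_bilinear by metis
  obtain m where m: "0 < m" "\<And>v. m * (norm v)\<^sup>2 \<le> ip v v" using ip_norm_bounds by metis
  define \<pi> where "\<pi> v = (1/2) *\<^sub>R (v + d\<sigma> v)" for v
  have lin\<pi>: "linear \<pi>"
    unfolding \<pi>_def by (intro linear_compose_scale_right linear_compose_add linear_ident lin_\<sigma>)
  have \<pi>\<sigma>: "d\<sigma> (\<pi> v) = \<pi> v" for v
    by (simp add: \<pi>_def linear_cmul[OF lin_\<sigma>] linear_add[OF lin_\<sigma>] d\<sigma>_d\<sigma> add.commute)
  obtain C where C: "C > 0" "\<And>v. norm (\<pi> v) \<le> norm v * C"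
    using bounded_linear.pos_bounded lin\<pi> linear_conv_bounded_linear by metis
  define n where "n = real DIM('e)"
  have n: "n > 0" by (simp add: n_def)
  \<comment> \<open>Chosen so that the trace bound, a sum of n equal terms taken twice, is exactly
    \<open>m * (norm X)\<^sup>2\<close>, a contradiction.\<close>
  define \<kappa> where "\<kappa> = m / (2 * K * n * C)"
  have "\<exists>v. d\<sigma> v = v \<and> norm v \<le> 1 \<and> \<kappa> * norm X \<le> norm (bracket G X v)" if X: "d\<sigma> X = - X" "d\<theta> X = - X" for X
  proof (rule ccontr)
    assume neg: "\<not> ?thesis"
    let ?a = "bracket G X"
    have X0: "X \<noteq> 0"
    proof
      assume "X = 0"
      then have "d\<sigma> 0 = 0 \<and> norm (0::'e) \<le> 1 \<and> \<kappa> * norm X \<le> norm (?a 0)" using linear_0[OF lin_\<sigma>] by simp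
      then show False using neg by blast
    qed
    have small: "norm (?a (\<pi> b)) < \<kappa> * norm X * C" if "b \<in> Basis" for b
    proof -
      let ?v = "(1 / C) *\<^sub>R \<pi> b"
      have "norm ?v \<le> 1" using C(2)[of b] C(1) that by (simp add: divide_simps)
      moreover have "d\<sigma> ?v = ?v" by (simp add: linear_cmul[OF lin_\<sigma>] \<pi>\<sigma>)
      ultimately have "norm (?a ?v) < \<kappa> * norm X" using neg by force
      then show ?thesis using C(1) by (simp add: bracket_simps divide_simps mult.commute)
    qed
    have la: "linear ?a" by (rule bracket_linear)
    have swap: "?a (z - \<pi> z) = \<pi> (?a z)" for z
    proof -
      have "d\<sigma> (?a z) = - ?a (d\<sigma> z)"
        using lie_hom_bracket[OF hom_\<sigma>, of X z] linear_neg[OF bracket_linear(1), of X] by (simp add: X)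
      then show ?thesis
        by (simp add: \<pi>_def linear_diff[OF la] linear_add[OF la] linear_cmul[OF la] algebra_simps flip: scaleR_add_left)
    qed
    have "m * (norm X)\<^sup>2 \<le> ip X X" by (rule m)
    also have "ip X X = killing_form G X X"
      using bilinear_rneg[OF killing_form_bilinear] by (simp add: ip_def X)
    also have "\<dots> = lie_trace (\<lambda>z. ?a (?a z))" by (simp add: killing_form_def)
    also have "\<dots> = lie_trace (\<lambda>z. ?a (?a (\<pi> z)) + ?a (\<pi> (?a z)))"
      by (simp flip: swap linear_add[OF la])
    also have "\<dots> = lie_trace (\<lambda>z. ?a (?a (\<pi> z))) + lie_trace (\<lambda>z. (?a (\<pi> (?a z))))"
      by (rule lie_trace_add)
    also have "lie_trace (\<lambda>z. (?a (\<pi> (?a z)))) = lie_trace (\<lambda>z. ?a (?a (\<pi> z)))"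
    proof (rule lie_trace_commute[symmetric, OF la])
      show "linear (\<lambda>z. ?a (\<pi> z))" using linear_compose[OF lin\<pi> la] by (simp add: o_def)
    qed
    also have "lie_trace (\<lambda>z. ?a (?a (\<pi> z))) + lie_trace (\<lambda>z. ?a (?a (\<pi> z))) = 2 * lie_trace (\<lambda>z. ?a (?a (\<pi> z)))"
      by simp
    also have "\<dots> < 2 * (\<Sum>b\<in>(Basis::'e set). norm X * (\<kappa> * norm X * C) * K)"
    proof -
      have "lie_trace (\<lambda>z. ?a (?a (\<pi> z))) < (\<Sum>b\<in>(Basis::'e set). norm X * (\<kappa> * norm X * C) * K)"
        unfolding lie_trace_def
      proof (rule sum_strict_mono)
        fix b :: 'e assume b: "b \<in> Basis"
        have "?a (?a (\<pi> b)) \<bullet> b \<le> norm (?a (?a (\<pi> b)))"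
          using Basis_le_norm[OF b, of "?a (?a (\<pi> b))"] by linarith
        also have "\<dots> \<le> norm X * norm (?a (\<pi> b)) * K" by (rule K(2))
        also have "\<dots> < norm X * (\<kappa> * norm X * C) * K"
          using small[OF b] X0 K(1) by simp
        finally show "?a (?a (\<pi> b)) \<bullet> b < norm X * (\<kappa> * norm X * C) * K" .
      qed auto
      then show ?thesis by simp
    qed
    also have "\<dots> = m * (norm X)\<^sup>2"
      using K(1) C(1) n by (simp add: \<kappa>_def n_def power2_eq_square field_simps)
    finally show False by simp
  qed
  moreover have "\<kappa> > 0" using m K C n by (simp add: \<kappa>_def)
  ultimately show thesis using that by blast
qed

lemma Ad_exp_lower_bound:
  obtains \<kappa> where "0 < \<kappa>"
    "\<And>X. d\<sigma> X = - X \<Longrightarrow> d\<theta> X = - X \<Longrightarrow>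
      \<exists>v. d\<sigma> v = v \<and> norm v \<le> 1 \<and> \<kappa> * norm X \<le> norm (Ad G (lie_exp G X) v)"
proof -
  obtain m M where m: "0 < m" "0 < M" "\<And>v. m * (norm v)\<^sup>2 \<le> ip v v" "\<And>v. ip v v \<le> M * (norm v)\<^sup>2"
    using ip_norm_bounds by metis
  obtain \<kappa> where \<kappa>: "0 < \<kappa>"
    "\<And>X. d\<sigma> X = - X \<Longrightarrow> d\<theta> X = - X \<Longrightarrow> \<exists>v. d\<sigma> v = v \<and> norm v \<le> 1 \<and> \<kappa> * norm X \<le> norm (bracket G X v)"
    using bracket_lower_bound by metis
  define k where "k = sqrt (m / M) * \<kappa>"
  have "\<exists>v. d\<sigma> v = v \<and> norm v \<le> 1 \<and> k * norm X \<le> norm (Ad G (lie_exp G X) v)"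
    if X: "d\<sigma> X = - X" "d\<theta> X = - X" for X
  proof -
    obtain v where v: "d\<sigma> v = v" "norm v \<le> 1" "\<kappa> * norm X \<le> norm (bracket G X v)" using \<kappa>(2)[OF X] by blast
    let ?A = "Ad G (lie_exp G X) v"
    have "m * (\<kappa> * norm X)\<^sup>2 \<le> m * (norm (bracket G X v))\<^sup>2"
      using m(1) v(3) \<kappa>(1) by (intro mult_left_mono power_mono) auto
    also have "\<dots> \<le> ip (bracket G X v) (bracket G X v)" by (rule m)
    also have "\<dots> \<le> ip ?A ?A"
      using Ad_exp_growth[OF X v(1)] ip_nonneg[of "bracket G X v"] by linarith
    also have "\<dots> \<le> M * (norm ?A)\<^sup>2" by (rule m)
    finally have "m / M * (\<kappa> * norm X)\<^sup>2 \<le> (norm ?A)\<^sup>2" using m by (simp add: divide_simps mult.commute)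
    then have "(k * norm X)\<^sup>2 \<le> (norm ?A)\<^sup>2" using m by (simp add: k_def power_mult_distrib)
    then have "k * norm X \<le> norm ?A" by (rule power2_le_imp_le) simp
    then show ?thesis using v by blast
  qed
  moreover have "k > 0" using m \<kappa> by (simp add: k_def)
  ultimately show thesis using that by blast
qed

end

section \<open>A trace criterion for nilpotence\<close>

text \<open>The trace of an idempotent is the dimension of its range: it is computed in an
  orthonormal basis of the range, whose vectors are fixed by e.\<close>

lemma idempotent_trace_0:
  fixes e :: "'e::euclidean_space \<Rightarrow> 'e"
  assumes lin: "linear e" and idem: "\<And>v. e (e v) = e v" and tr: "lie_trace e = 0"
  shows "e v = 0"
proof -
  have sub: "subspace (range e)"
    using linear_subspace_image[OF lin subspace_UNIV] .
  obtain B where B: "B \<subseteq> range e" "pairwise orthogonal B" "\<And>x. x \<in> B \<Longrightarrow> norm x = 1"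
    "independent B" "span B = range e"
    using orthonormal_basis_subspace[OF sub] by metis
  have fin: "finite B" using B(4) independent_bound by blast
  have ex: "e x = (\<Sum>b\<in>B. (e x \<bullet> b) *\<^sub>R b)" for x
    using orthonormal_basis_expand[OF B(2,3) _ fin, of "e x"] B(5) by simp
  have "lie_trace e = (\<Sum>i\<in>Basis. \<Sum>b\<in>B. (e i \<bullet> b) * (b \<bullet> i))"
    unfolding lie_trace_def by (subst ex) (simp add: inner_sum_left)
  also have "\<dots> = (\<Sum>b\<in>B. \<Sum>i\<in>Basis. (e i \<bullet> b) * (b \<bullet> i))" by (rule sum.swap)
  also have "\<dots> = (\<Sum>b\<in>B. e b \<bullet> b)"
    by (subst (2) linear_representation[OF lin]) (simp add: inner_sum_left mult.commute)
  also have "\<dots> = (\<Sum>b\<in>B. 1)"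
  proof (rule sum.cong[OF refl])
    fix b assume b: "b \<in> B"
    then have "e b = b" using B(1) idem by auto
    then show "e b \<bullet> b = 1" using B(3)[OF b] by (simp add: dot_square_norm)
  qed
  finally have "card B = 0" using tr by simp
  then have "B = {}" using fin by simp
  then have "range e = {0}" using B(5) by simp
  then show ?thesis by blast
qed

definition op_poly :: "('e::real_vector \<Rightarrow> 'e) \<Rightarrow> real poly \<Rightarrow> 'e \<Rightarrow> 'e" where
  "op_poly A p v = (\<Sum>i\<le>degree p. coeff p i *\<^sub>R (A ^^ i) v)"

lemma op_poly_ge: "degree p \<le> n \<Longrightarrow> op_poly A p v = (\<Sum>i\<le>n. coeff p i *\<^sub>R (A ^^ i) v)"
  unfolding op_poly_def by (rule sum.mono_neutral_left) (auto simp: coeff_eq_0)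

lemma op_poly_add: "op_poly A (p + q) v = op_poly A p v + op_poly A q v"
proof -
  let ?n = "max (degree p) (degree q)"
  show ?thesis
    using op_poly_ge[of p ?n A v] op_poly_ge[of q ?n A v] op_poly_ge[of "p + q" ?n A v]
    by (simp add: degree_add_le_max scaleR_add_left sum.distrib)
qed

lemma op_poly_smult: "op_poly A (smult r p) v = r *\<^sub>R op_poly A p v"
  using op_poly_ge[of "smult r p" "degree p" A v] degree_smult_le
  by (simp add: op_poly_def scaleR_sum_right)

lemma funpow_linear: "linear A \<Longrightarrow> linear (A ^^ n)"
  for A :: "'e::real_vector \<Rightarrow> 'e"
  by (induction n) (simp_all add: linear_id linear_compose)

lemma op_poly_pCons:
  assumes "linear A"
  shows "op_poly A (pCons r p) v = r *\<^sub>R v + A (op_poly A p v)"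
proof -
  have "op_poly A (pCons r p) v = (\<Sum>i\<le>Suc (degree p). coeff (pCons r p) i *\<^sub>R (A ^^ i) v)"
    by (rule op_poly_ge) (rule degree_pCons_le)
  also have "\<dots> = r *\<^sub>R v + (\<Sum>i\<le>degree p. coeff p i *\<^sub>R A ((A ^^ i) v))"
    by (simp only: sum.atMost_Suc_shift coeff_pCons_0 coeff_pCons_Suc funpow.simps o_apply id_apply)
  also have "(\<Sum>i\<le>degree p. coeff p i *\<^sub>R A ((A ^^ i) v)) = A (op_poly A p v)"
    unfolding op_poly_def by (simp add: linear_sum[OF assms] linear_cmul[OF assms])
  finally show ?thesis .
qed

lemma op_poly_0 [simp]: "op_poly A 0 v = 0"
  by (simp add: op_poly_def)

lemma op_poly_linear: "linear A \<Longrightarrow> linear (op_poly A p)"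
  unfolding op_poly_def[abs_def]
  by (intro linear_compose_sum linear_compose_scale_right ballI funpow_linear)

lemma op_poly_mult:
  assumes "linear A"
  shows "op_poly A (p * q) v = op_poly A p (op_poly A q v)"
  by (induction p)
     (simp_all add: op_poly_add op_poly_smult op_poly_pCons[OF assms] linear_0[OF assms])

lemma op_poly_monom: "op_poly A (monom r n) v = r *\<^sub>R (A ^^ n) v"
proof -
  have "op_poly A (monom r n) v = (\<Sum>i\<le>n. coeff (monom r n) i *\<^sub>R (A ^^ i) v)"
    by (rule op_poly_ge) (rule degree_monom_le)
  also have "\<dots> = (\<Sum>i\<le>n. if i = n then r *\<^sub>R (A ^^ n) v else 0)"
    by (rule sum.cong) auto
  finally show ?thesis by simp
qed

text \<open>One more vector of the orbit than the dimension forces a linear relation. If two of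
  these vectors coincide, the difference of two monomials already annihilates b; otherwise they form
  a set large enough to be dependent.\<close>

lemma vector_annihilating_poly:
  fixes A :: "'e::euclidean_space \<Rightarrow> 'e"
  shows "\<exists>p\<noteq>0. op_poly A p b = 0"
proof (cases "inj_on (\<lambda>i. (A ^^ i) b) {..DIM('e)}")
  case False
  then obtain i j where ij: "i \<noteq> j" "(A ^^ i) b = (A ^^ j) b" by (auto simp: inj_on_def)
  have "op_poly A (monom 1 i + monom (-1) j) b = 0"
    by (simp add: op_poly_add op_poly_monom ij)
  moreover have "coeff (monom 1 i + monom (-1) j :: real poly) i = 1" using ij by simp
  then have "monom 1 i + monom (-1) j \<noteq> (0 :: real poly)" by (metis coeff_0 zero_neq_one)
  ultimately show ?thesis by blast
next
  case True
  let ?f = "\<lambda>i. (A ^^ i) b" and ?d = "DIM('e)"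
  have "card (?f ` {..?d}) = Suc ?d" using card_image[OF True] by simp
  then have "dependent (?f ` {..?d})" by (intro dependent_biggerset) simp
  then obtain u where u: "\<exists>v\<in>?f ` {..?d}. u v \<noteq> 0" "(\<Sum>v\<in>?f ` {..?d}. u v *\<^sub>R v) = 0"
    using dependent_finite[of "?f ` {..?d}"] by blast
  define p where "p = (\<Sum>i\<le>?d. monom (u (?f i)) i)"
  have cp: "coeff p j = (if j \<le> ?d then u (?f j) else 0)" for j
    by (simp add: p_def coeff_sum coeff_monom)
  have "degree p \<le> ?d" by (rule degree_le) (simp add: cp)
  then have "op_poly A p b = (\<Sum>i\<le>?d. u (?f i) *\<^sub>R ?f i)" by (simp add: op_poly_ge cp)
  also have "\<dots> = 0" using u(2) by (simp add: sum.reindex[OF True])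
  finally have "op_poly A p b = 0" .
  moreover obtain j where "j \<le> ?d" "u (?f j) \<noteq> 0" using u(1) by blast
  then have "coeff p j \<noteq> 0" by (simp add: cp)
  then have "p \<noteq> 0" by auto
  ultimately show ?thesis by blast
qed

text \<open>Polynomials in A commute, so the product of annihilators of the basis vectors
  annihilates each of them.\<close>

lemma annihilating_poly:
  fixes A :: "'e::euclidean_space \<Rightarrow> 'e"
  assumes lin: "linear A"
  shows "\<exists>p\<noteq>0. \<forall>v. op_poly A p v = 0"
proof -
  have "\<exists>p\<noteq>0. \<forall>b\<in>S. op_poly A p b = 0" if "finite S" for S
    using that
  proof (induction S)
    case empty
    show ?case by (intro exI[of _ 1]) simp
  next
    case (insert b S)
    then obtain p q where p: "p \<noteq> 0" "\<forall>b\<in>S. op_poly A p b = 0" and q: "q \<noteq> 0" "op_poly A q b = 0"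
      using vector_annihilating_poly by metis
    have "op_poly A (p * q) b' = 0" if "b' \<in> insert b S" for b'
      using that p(2) q(2) op_poly_mult[OF lin, of p q b'] op_poly_mult[OF lin, of q p b']
        linear_0[OF op_poly_linear[OF lin]] by (auto simp: mult.commute[of q])
    then show ?case using p(1) q(1) by (intro exI[of _ "p * q"]) auto
  qed
  from this[OF finite_Basis] obtain p where p: "p \<noteq> 0" "\<forall>b\<in>Basis. op_poly A p b = 0" by blast
  have "op_poly A p v = 0" for v
    using linear_representation[OF op_poly_linear[OF lin], of p v] p(2) by simp
  then show ?thesis using p(1) by blast
qed

lemma poly_split_X_power:
  fixes p :: "real poly"
  assumes "p \<noteq> 0"
  shows "\<exists>k s. p = [:0, 1:] ^ k * s \<and> coeff s 0 \<noteq> 0"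
  using assms
proof (induction p)
  case (pCons a q)
  show ?case
  proof (cases "a = 0")
    case True
    then obtain k s where "q = [:0, 1:] ^ k * s" "coeff s 0 \<noteq> 0" using pCons by auto
    then have "pCons a q = [:0, 1:] ^ Suc k * s" using True by (simp add: mult.assoc)
    then show ?thesis using \<open>coeff s 0 \<noteq> 0\<close> by blast
  next
    case False
    then show ?thesis by (intro exI[of _ 0] exI[of _ "pCons a q"]) simp
  qed
qed simp

text \<open>Writing an annihilating polynomial as \<open>X\<^sup>k (1 - q)\<close> up to a unit, with \<open>q\<close> divisible by \<open>X\<close>,
  a power of \<open>q\<close> gives the projection onto the stable range of \<open>A\<close>; its trace is its rank.\<close>

lemma nilpotent_if_traces_0:
  fixes A :: "'e::euclidean_space \<Rightarrow> 'e"
  assumes lin: "linear A" and tr: "\<And>k. 1 \<le> k \<Longrightarrow> lie_trace (A ^^ k) = 0"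
  shows "\<exists>m. \<forall>v. (A ^^ m) v = 0"
proof -
  let ?X = "[:0, 1:] :: real poly"
  obtain p where p: "p \<noteq> 0" "\<And>v. op_poly A p v = 0" using annihilating_poly[OF lin] by blast
  obtain k s where s: "p = ?X ^ k * s" "coeff s 0 \<noteq> 0" using poly_split_X_power[OF p(1)] by blast
  \<comment> \<open>Scaling by the constant coefficient of \<open>s\<close> leaves \<open>q\<close>
    without constant term, which is why only traces of positive powers enter.\<close>
  define q where "q = 1 - smult (1 / coeff s 0) s"
  have "coeff q 0 = 0" using s(2) by (simp add: q_def)
  then obtain t where t: "q = ?X * t" by (cases q) auto
  \<comment> \<open>Positive even for k = 0, so that \<open>q ^ m\<close> has no constant term, and
    large enough for X^m to contain X^k.\<close>
  define m where "m = Suc k"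
  have zero: "op_poly A (r * (?X ^ k * (1 - q))) v = 0" for r v
  proof -
    have "r * (?X ^ k * (1 - q)) = smult (1 / coeff s 0) (r * p)" by (simp add: q_def s(1) mult_ac)
    then show ?thesis
      by (simp add: op_poly_smult op_poly_mult[OF lin] p(2) linear_0[OF op_poly_linear[OF lin]])
  qed
  obtain w where w: "1 - q ^ m = (1 - q) * w" using one_diff_power_eq[of q m] by blast
  have Xm: "?X ^ m * (1 - q ^ m) = (?X * w) * (?X ^ k * (1 - q))"
    unfolding w by (simp only: m_def power_Suc mult_ac)
  \<comment> \<open>\<open>q ^ m\<close> contains X^m and \<open>1 - q ^ m\<close> contains 1 - q,
    so the product annihilates A; this makes q^m (A) idempotent.\<close>
  have qm: "q ^ m * (1 - q ^ m) = t ^ m * (?X * w) * (?X ^ k * (1 - q))"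
  proof -
    have "q ^ m * (1 - q ^ m) = t ^ m * (?X ^ m * (1 - q ^ m))"
      unfolding power_mult_distrib[of ?X t m, folded t] by (simp only: mult_ac)
    also have "\<dots> = t ^ m * (?X * w) * (?X ^ k * (1 - q))" unfolding Xm by (simp only: mult_ac)
    finally show ?thesis .
  qed
  define e where "e = op_poly A (q ^ m)"
  have split: "op_poly A (r * (1 - q ^ m)) v = op_poly A r v - op_poly A r (e v)" for r v
  proof -
    have "r = r * (1 - q ^ m) + r * q ^ m" by (simp add: algebra_simps)
    then have "op_poly A r v = op_poly A (r * (1 - q ^ m)) v + op_poly A (r * q ^ m) v"
      using op_poly_add by metis
    then show ?thesis by (simp add: op_poly_mult[OF lin, of r "q ^ m"] e_def)
  qed
  have "e v - e (e v) = 0" for v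
    using split[of "q ^ m" v] zero unfolding qm e_def[symmetric] by metis
  then have idem: "e (e v) = e v" for v by simp
  have "lie_trace e = (\<Sum>i\<le>degree (q ^ m). coeff (q ^ m) i * lie_trace (A ^^ i))"
    by (simp add: e_def op_poly_def[abs_def] lie_trace_def inner_sum_left sum_distrib_left
        sum.swap[of _ _ "Basis"])
  also have "\<dots> = (\<Sum>i\<le>degree (q ^ m). 0)"
  proof (rule sum.cong[OF refl])
    fix i show "coeff (q ^ m) i * lie_trace (A ^^ i) = 0"
    proof (cases "i = 0")
      case True
      have "coeff (q ^ m) 0 = 0" using \<open>coeff q 0 = 0\<close> by (simp add: m_def coeff_mult_0)
      then show ?thesis using True by simp
    qed (use tr[of i] in simp)
  qed
  finally have e0: "e v = 0" for v
    using idempotent_trace_0[OF _ idem] op_poly_linear[OF lin] by (simp add: e_def)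
  \<comment> \<open>Since \<open>e\<close> is zero, the factor \<open>1 - q ^ m\<close> acts as the
    identity, and what remains annihilating is X^m.\<close>
  have "op_poly A (?X ^ m * (1 - q ^ m)) v = 0" for v unfolding Xm by (rule zero)
  then have "op_poly A (?X ^ m) v = 0" for v
    using split[of "?X ^ m" v] unfolding e0 linear_0[OF op_poly_linear[OF lin]] by simp
  moreover have "?X ^ m = monom 1 m" by (simp add: monom_altdef)
  ultimately have "(A ^^ m) v = 0" for v by (simp add: op_poly_monom)
  then show ?thesis by blast
qed

section \<open>Limits of conjugates\<close>

context lie_grp
begin

lemma Ad_minus_id_pow_limit:
  assumes x: "limitin T x l sequentially" and xc: "\<And>n. x n \<in> carrier G"
  shows "(\<lambda>n. ((\<lambda>w. Ad G (x n) w - w) ^^ k) v) \<longlonglongrightarrow> ((\<lambda>w. Ad G l w - w) ^^ k) v"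
proof (induction k)
  case (Suc k)
  show ?case
    by (simp, intro tendsto_diff Ad_tendsto[OF x] Suc) (simp add: xc)
qed simp

text \<open>Nothing bounds \<open>g n\<close>, so only conjugation invariants pass from
  \<open>y n\<close> to its conjugates. The traces of positive powers of Ad - 1 are such invariants,
  depend continuously on the element and vanish at the identity.\<close>

lemma Ad_unipotent_limit:
  assumes g: "\<And>n. g n \<in> carrier G" and y: "\<And>n. y n \<in> carrier G" and y1: "limitin T y \<one> sequentially"
    and u: "limitin T (\<lambda>n. g n \<otimes> y n \<otimes> inv (g n)) u sequentially"
  shows "Ad_unipotent G u"
proof -
  let ?u = "\<lambda>n. g n \<otimes> y n \<otimes> inv (g n)"
  let ?A = "\<lambda>x w. Ad G x w - w"
  have uc: "u \<in> carrier G" using limitin_topspace[OF u] by simp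
  have linA: "linear (?A x)" if "x \<in> carrier G" for x
    by (intro linear_compose_sub Ad_linear that linear_ident)
  have conj: "(?A (?u n) ^^ k) v = Ad G (g n) ((?A (y n) ^^ k) (Ad G (inv (g n)) v))" for n k v
  proof (induction k)
    case 0
    show ?case by (simp add: Ad_inv_right g)
  next
    case (Suc k)
    have "?A (?u n) (Ad G (g n) z) = Ad G (g n) (?A (y n) z)" for z
      using g y by (simp add: Ad_mult Ad_inv_left linear_diff[OF Ad_linear])
    then show ?case by (simp add: Suc)
  qed
  have tr_conj: "lie_trace (?A (?u n) ^^ k) = lie_trace (?A (y n) ^^ k)" for n k
  proof -
    have "lie_trace (?A (?u n) ^^ k) = lie_trace (\<lambda>v. Ad G (g n) ((?A (y n) ^^ k) (Ad G (inv (g n)) v)))"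
      by (rule arg_cong[of _ _ lie_trace], rule ext) (rule conj)
    also have "\<dots> = lie_trace (\<lambda>v. (?A (y n) ^^ k) (Ad G (inv (g n)) (Ad G (g n) v)))"
    proof (rule lie_trace_commute[OF Ad_linear[OF g]])
      show "linear (\<lambda>v. (?A (y n) ^^ k) (Ad G (inv g n) v))"
        using linear_compose[OF Ad_linear[OF inv_closed[OF g]] funpow_linear[OF linA[OF y]]]
        by (simp add: o_def)
    qed
    finally show ?thesis by (simp add: Ad_inv_left g)
  qed
  have lim: "(\<lambda>n. lie_trace (?A (x n) ^^ k)) \<longlonglongrightarrow> lie_trace (?A l ^^ k)"
    if "limitin T x l sequentially" "\<And>n. x n \<in> carrier G" for x l k
    unfolding lie_trace_def by (intro tendsto_sum tendsto_inner tendsto_const Ad_minus_id_pow_limit that)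
  have "lie_trace (?A u ^^ k) = 0" if k: "1 \<le> k" for k
  proof -
    have "(\<lambda>n. lie_trace (?A (?u n) ^^ k)) \<longlonglongrightarrow> lie_trace (?A u ^^ k)"
      by (rule lim[OF u]) (use g y in simp)
    from LIMSEQ_unique[OF this[unfolded tr_conj] lim[OF y1 y]]
    have "lie_trace (?A u ^^ k) = lie_trace (?A \<one> ^^ k)" .
    moreover have "lie_trace (?A \<one> ^^ k) = 0"
      using k by (cases k) (simp_all add: Ad_one lie_trace_def)
    ultimately show ?thesis by simp
  qed
  from nilpotent_if_traces_0[OF linA[OF uc] this] show ?thesis
    unfolding Ad_unipotent_def .
qed

section \<open>Compact sets, exponentials and divergence modulo a subgroup\<close>

lemma compactin_mult:
  assumes "compactin T A" "compactin T B"
  shows "compactin T ((\<lambda>(x, y). x \<otimes> y) ` (A \<times> B))"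
proof (rule image_compactin)
  show "compactin (prod_topology T T) (A \<times> B)" using assms by (simp add: compactin_Times)
  show "continuous_map (prod_topology T T) T (\<lambda>(x, y). x \<otimes> y)"
    using lie_group by (simp add: lie_group_def smooth_mult_def)
qed

text \<open>exp v = exp (v / n)^n, and for large n the factor exp (v / n) lies in a compact chart
  ball, whose n-th powers stay in a compact set.\<close>

lemma lie_exp_cball_compact: "\<exists>C. compactin T C \<and> lie_exp G ` cball 0 R \<subseteq> C"
proof -
  obtain \<delta> \<rho> where \<delta>: "0 < \<delta>" "cball E \<rho> \<subseteq> dom"
    "\<And>v. norm v \<le> \<delta> \<Longrightarrow> \<exists>b\<in>cball E \<rho>. lie_exp G v = c b \<and> norm (b - E - v) \<le> norm v / 2"
    using lie_exp_near by metis
  have pow: "\<exists>C. compactin T C \<and> (\<forall>x\<in>c ` cball E \<rho>. x [^] n \<in> C)" for n :: nat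
  proof (induction n)
    case 0
    show ?case by (intro exI[of _ "{\<one>}"]) simp
  next
    case (Suc n)
    then obtain C where C: "compactin T C" "\<forall>x\<in>c ` cball E \<rho>. x [^] n \<in> C" by blast
    show ?case
      by (intro exI[of _ "(\<lambda>(x, y). x \<otimes> y) ` (C \<times> c ` cball E \<rho>)"] conjI compactin_mult C(1)
          compactin_c_cball[OF \<delta>(2)]) (use C(2) in \<open>auto intro!: image_eqI[of _ _ "(_, _)"]\<close>)
  qed
  obtain n :: nat where n: "\<bar>R\<bar> / \<delta> + 1 \<le> real n" using real_arch_simple by blast
  moreover have "0 \<le> \<bar>R\<bar> / \<delta>" using \<delta>(1) by simp
  ultimately have n0: "0 < real n" by linarith
  have "\<bar>R\<bar> / \<delta> \<le> real n" using n by linarith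
  then have R: "\<bar>R\<bar> / real n \<le> \<delta>" using n0 \<delta>(1) by (simp add: field_simps)
  obtain C where C: "compactin T C" "\<forall>x\<in>c ` cball E \<rho>. x [^] n \<in> C" using pow by blast
  have "lie_exp G v \<in> C" if "v \<in> cball 0 R" for v
  proof -
    have "norm ((1 / real n) *\<^sub>R v) \<le> \<bar>R\<bar> / real n" using that n0 by (simp add: divide_right_mono)
    then have "norm ((1 / real n) *\<^sub>R v) \<le> \<delta>" using R by linarith
    then have "lie_exp G ((1 / real n) *\<^sub>R v) \<in> c ` cball E \<rho>" using \<delta>(3) by blast
    then have "lie_exp G ((1 / real n) *\<^sub>R v) [^] n \<in> C" using C(2) by blast
    then show ?thesis using lie_exp_pow[of n "(1 / real n) *\<^sub>R v"] n0 by simp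
  qed
  then show ?thesis using C(1) by blast
qed

lemma continuous_map_coset:
  "continuous_map T (coset_space G H) (\<lambda>x. x <# H)"
  unfolding continuous_map_def topspace_coset_space[OF lie_group]
  by (auto simp: openin_coset_space LCOSETS_def)

text \<open>Modulo H the factor \<open>h n\<close> disappears. If \<open>X n\<close> returned to a
  ball, the cosets would return to the image of the compact product of \<open>K\<close> with a
  compact set containing the exponentials of that ball.\<close>

lemma lie_exp_factor_to_infinity:
  assumes inf: "tends_to_infinity (coset_space G H) (\<lambda>n. g n <# H)" and H: "subgroup H G"
    and K: "compactin T K"
    and g: "\<And>n. 1 \<le> n \<Longrightarrow> k n \<in> K \<and> h n \<in> H \<and> g n = k n \<otimes> lie_exp G (X n) \<otimes> h n"
  shows "filterlim (\<lambda>n. norm (X n)) at_top sequentially"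
  unfolding filterlim_at_top
proof
  fix R
  obtain C where C: "compactin T C" "lie_exp G ` cball 0 R \<subseteq> C" using lie_exp_cball_compact by blast
  let ?S = "(\<lambda>x. x <# H) ` ((\<lambda>(x, y). x \<otimes> y) ` (K \<times> C))"
  have "compactin (coset_space G H) ?S"
    by (rule image_compactin[OF compactin_mult[OF K C(1)] continuous_map_coset])
  then have "\<forall>\<^sub>F n in sequentially. g n <# H \<notin> ?S" using inf by (simp add: tends_to_infinity_def)
  then show "\<forall>\<^sub>F n in sequentially. R \<le> norm (X n)"
    using eventually_ge_at_top[of 1]
  proof eventually_elim
    case (elim n)
    show ?case
    proof (rule ccontr)
      assume "\<not> R \<le> norm (X n)"
      then have XC: "lie_exp G (X n) \<in> C" using C(2) by (auto simp: image_subset_iff)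
      have kc: "k n \<in> carrier G" using g[OF elim(2)] compactin_subset_topspace[OF K] by auto
      have hc: "h n \<in> carrier G" using g[OF elim(2)] subgroup.subset[OF H] by auto
      have "g n <# H = (k n \<otimes> lie_exp G (X n)) <# (h n <# H)"
        using g[OF elim(2)] kc hc subgroup.subset[OF H] by (simp add: lcos_m_assoc)
      also have "h n <# H = H" using g[OF elim(2)] hc H by (simp add: coset_join3)
      finally have "g n <# H = (k n \<otimes> lie_exp G (X n)) <# H" .
      then have "g n <# H \<in> ?S" using XC g[OF elim(2)] by (auto intro!: image_eqI[of _ _ "(k n, lie_exp G (X n))"])
      then show False using elim(1) by simp
    qed
  qed
qed

text \<open>Continuity bounds the image of each basis vector on \<open>K\<close>, and linearity
  extends the bound to all v.\<close>

lemma Ad_bounded_on_compact: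
  assumes K: "compactin T K"
  obtains C where "0 < C" "\<And>k v. k \<in> K \<Longrightarrow> norm (Ad G k v) \<le> C * norm v"
proof -
  have ct: "continuous_map T euclidean (\<lambda>x. Ad G x w)" for w
    unfolding continuous_map_atin
  proof
    fix l assume l: "l \<in> topspace T"
    have "limitin T (\<lambda>x. x) l (atin T l)" using l by (auto simp: limitin_def eventually_atin)
    moreover have "\<forall>\<^sub>F x in atin T l. x \<in> carrier G"
      using l openin_topspace[of T] by (auto simp: eventually_atin intro!: exI[of _ "carrier G"])
    ultimately show "limitin euclidean (\<lambda>x. Ad G x w) (Ad G l w) (atin T l)"
      using Ad_tendsto[of "\<lambda>x. x" l "atin T l" "\<lambda>_. w" w] by simp
  qed
  have "\<exists>B. \<forall>k\<in>K. norm (Ad G k w) \<le> B" for w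
  proof -
    have "compact ((\<lambda>x. Ad G x w) ` K)" using image_compactin[OF K ct] by (simp add: compactin_euclidean_iff)
    from compact_imp_bounded[OF this] show ?thesis by (auto simp: bounded_iff)
  qed
  then obtain B where B: "\<And>w k. k \<in> K \<Longrightarrow> norm (Ad G k w) \<le> B w" by metis
  define C where "C = (\<Sum>i\<in>(Basis::'e set). \<bar>B i\<bar>) + 1"
  have "norm (Ad G k v) \<le> C * norm v" if k: "k \<in> K" for k v
  proof -
    have kc: "k \<in> carrier G" using k compactin_subset_topspace[OF K] by auto
    have "norm (Ad G k v) \<le> (\<Sum>i\<in>(Basis::'e set). norm v * \<bar>B i\<bar>)"
      unfolding linear_representation[OF Ad_linear[OF kc], of v]
    proof (rule sum_norm_le)
      fix i :: 'e assume "i \<in> Basis"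
      moreover have "norm (Ad G k i) \<le> \<bar>B i\<bar>" using B[OF k, of i] by linarith
      ultimately show "norm ((v \<bullet> i) *\<^sub>R Ad G k i) \<le> norm v * \<bar>B i\<bar>"
        by (simp add: Basis_le_norm mult_mono)
    qed
    also have "\<dots> = (\<Sum>i\<in>(Basis::'e set). \<bar>B i\<bar>) * norm v" by (simp add: sum_distrib_left mult.commute)
    also have "\<dots> \<le> C * norm v" by (simp add: C_def mult_right_mono)
    finally show ?thesis .
  qed
  moreover have "C > 0" unfolding C_def by (intro add_nonneg_pos sum_nonneg) auto
  ultimately show thesis using that by blast
qed

lemma lie_exp_tendsto_one:
  assumes "(Y \<longlongrightarrow> 0) F"
  shows "limitin T (\<lambda>n. lie_exp G (Y n)) \<one> F"
proof -
  obtain \<delta> \<rho> where \<delta>: "0 < \<delta>" "cball E \<rho> \<subseteq> dom"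
    "\<And>v. norm v \<le> \<delta> \<Longrightarrow> \<exists>b\<in>cball E \<rho>. lie_exp G v = c b \<and> norm (b - E - v) \<le> norm v / 2"
    using lie_exp_near by metis
  then obtain B where B: "\<And>v. norm v \<le> \<delta> \<Longrightarrow> lie_exp G v = c (B v) \<and> norm (B v - E - v) \<le> norm v / 2"
    by metis
  have small: "\<forall>\<^sub>F n in F. norm (Y n) < \<delta>"
    using order_tendstoD(2)[OF tendsto_norm_zero[OF assms] \<delta>(1)] .
  have "((\<lambda>n. B (Y n) - E) \<longlongrightarrow> 0) F"
  proof (rule Lim_null_comparison)
    show "\<forall>\<^sub>F n in F. norm (B (Y n) - E) \<le> 2 * norm (Y n)"
      using small
    proof eventually_elim
      case (elim n)
      then show ?case
        using B[of "Y n"] norm_triangle_sub[of "B (Y n) - E" "Y n"] norm_ge_zero[of "Y n"] by linarith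
    qed
    show "((\<lambda>n. 2 * norm (Y n)) \<longlongrightarrow> 0) F" using tendsto_mult_right_zero[OF tendsto_norm_zero[OF assms]] .
  qed
  then have "((\<lambda>n. B (Y n)) \<longlongrightarrow> E) F" by (simp add: LIM_zero_iff)
  then have "limitin T (\<lambda>n. c (B (Y n))) \<one> F" by (rule c_tendsto_one)
  then show ?thesis
    by (rule limitin_transform_eventually[rotated]) (use small in \<open>eventually_elim, simp add: B\<close>)
qed

end

context symmetric_lie_grp
begin

text \<open>Conjugation by \<open>g n\<close> expands some direction of the Lie algebra of the fixed points of \<open>\<sigma>\<close>
  arbitrarily much; \<open>y n\<close> is the exponential of a small multiple of such a direction.\<close>

lemma conjugates_limit_exists:
  assumes g: "\<And>n. 1 \<le> n \<Longrightarrow> k n \<in> K \<and> h n \<in> carrier G \<and> \<sigma> (h n) = h n \<and> d\<sigma> (X n) = - X n \<and>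
      d\<theta> (X n) = - X n \<and> g n = k n \<otimes> lie_exp G (X n) \<otimes> h n"
    and K: "compactin T K" "subgroup K G"
    and bd: "\<And>n v. 1 \<le> n \<Longrightarrow> norm (Ad G (inv (h n)) v) \<le> B * norm v"
    and inf: "filterlim (\<lambda>n. norm (X n)) at_top sequentially"
  obtains r u y where "strict_mono r" "\<And>n. 1 \<le> r n" "u \<in> carrier G" "u \<noteq> \<one>"
    "\<And>n. y n \<in> carrier G \<and> \<sigma> (y n) = y n" "limitin T y \<one> sequentially"
    "limitin T (\<lambda>n. g (r n) \<otimes> y n \<otimes> inv (g (r n))) u sequentially"
proof -
  obtain \<kappa> where \<kappa>: "0 < \<kappa>"
    "\<And>X. d\<sigma> X = - X \<Longrightarrow> d\<theta> X = - X \<Longrightarrow>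
      \<exists>v. d\<sigma> v = v \<and> norm v \<le> 1 \<and> \<kappa> * norm X \<le> norm (Ad G (lie_exp G X) v)"
    using Ad_exp_lower_bound by metis
  obtain \<delta> \<rho> where \<delta>: "0 < \<delta>" "cball E \<rho> \<subseteq> dom"
    "\<And>v. norm v \<le> \<delta> \<Longrightarrow> \<exists>b\<in>cball E \<rho>. lie_exp G v = c b \<and> norm (b - E - v) \<le> norm v / 2"
    using lie_exp_near by metis
  obtain C where C: "0 < C" "\<And>k v. k \<in> K \<Longrightarrow> norm (Ad G k v) \<le> C * norm v"
    using Ad_bounded_on_compact[OF K(1)] by metis
  have "\<forall>\<^sub>F n in sequentially. 1 \<le> norm (X n)" using inf by (simp add: filterlim_at_top)
  then obtain N where N: "\<And>n. N \<le> n \<Longrightarrow> 1 \<le> norm (X n)" by (auto simp: eventually_sequentially)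
  \<comment> \<open>Moves past \<open>N\<close>, from where on \<open>X\<close> has norm at least 1,
    and past index 0, about which nothing is assumed.\<close>
  define p where "p n = n + N + 1" for n
  have p: "1 \<le> p n" "1 \<le> norm (X (p n))" for n using N by (auto simp: p_def)
  have "\<forall>n. \<exists>v. d\<sigma> v = v \<and> norm v \<le> 1 \<and> \<kappa> * norm (X (p n)) \<le> norm (Ad G (lie_exp G (X (p n))) v)"
    using \<kappa>(2) g[OF p(1)] by blast
  then obtain v where v: "\<And>n. d\<sigma> (v n) = v n" "\<And>n. norm (v n) \<le> 1"
    "\<And>n. \<kappa> * norm (X (p n)) \<le> norm (Ad G (lie_exp G (X (p n))) (v n))" by metis
  have kc: "k (p n) \<in> carrier G" and hc: "h (p n) \<in> carrier G" for n
    using g[OF p(1)] subgroup.subset[OF K(2)] by auto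
  define W where "W n = Ad G (k (p n)) (Ad G (lie_exp G (X (p n))) (v n))" for n
  \<comment> \<open>The factor in \<open>K\<close> costs at most the constant \<open>C\<close>,
    because \<open>K\<close> also contains its inverse.\<close>
  have W: "\<kappa> * norm (X (p n)) \<le> C * norm (W n)" for n
  proof -
    have "inv (k (p n)) \<in> K" using g[OF p(1)] subgroup.m_inv_closed[OF K(2)] by blast
    from C(2)[OF this, of "W n"] show ?thesis
      using v(3)[of n] by (simp add: W_def Ad_inv_left kc)
  qed
  have W0: "0 < norm (W n)" for n
  proof -
    have "0 < \<kappa> * norm (X (p n))"
      by (rule mult_pos_pos[OF \<kappa>(1)]) (use p(2)[of n] in linarith)
    with W[of n] have "0 < C * norm (W n)" by linarith
    then show ?thesis using C(1) by (simp add: zero_less_mult_iff)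
  qed
  \<comment> \<open>Normalises the conjugate to the exponential of a vector of norm exactly
    \<delta>.\<close>
  define s where "s n = \<delta> / norm (W n)" for n
  \<comment> \<open>Ad of the inverse of \<open>h\<close> cancels the last factor of
    \<open>g\<close>; as \<open>h\<close> is fixed by \<sigma>, the vector stays in the +1
    eigenspace of \<open>d\<sigma>\<close>.\<close>
  define Y where "Y n = Ad G (inv (h (p n))) (s n *\<^sub>R v n)" for n
  define y where "y n = lie_exp G (Y n)" for n
  have gc: "g (p n) \<in> carrier G" for n using g[OF p(1)] kc[of n] hc[of n] by simp
  have conj: "g (p n) \<otimes> y n \<otimes> inv (g (p n)) = lie_exp G (s n *\<^sub>R W n)" for n
  proof -
    have "Ad G (g (p n)) (Y n) = s n *\<^sub>R W n"
      using g[OF p(1)[of n]] kc[of n] hc[of n]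
      by (simp add: Y_def W_def Ad_mult Ad_inv_right linear_cmul[OF Ad_linear])
    then show ?thesis using conj_exp[OF gc, of n "Y n"] by (simp add: y_def)
  qed
  have \<sigma>y: "\<sigma> (y n) = y n" for n
  proof -
    have "\<sigma> (inv (h (p n))) = inv (h (p n))" using lie_hom_inv[OF hom_\<sigma> hc] g[OF p(1)] by simp
    then have "d\<sigma> (Y n) = Y n"
      unfolding Y_def lie_hom_Ad[OF hom_\<sigma> inv_closed[OF hc]]
      by (simp add: linear_cmul[OF lin_\<sigma>] v(1))
    then show ?thesis by (simp add: y_def lie_hom_exp[OF hom_\<sigma>])
  qed
  \<comment> \<open>The bound on Ad of the inverse of \<open>h\<close> reduces this to
    \<open>s n\<close>, which is at most a constant divided by the norm of
    \<open>X (p n)\<close>.\<close>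
  have Y0: "Y \<longlonglongrightarrow> 0"
  proof (rule Lim_null_comparison)
    show "\<forall>\<^sub>F n in sequentially. norm (Y n) \<le> \<bar>B\<bar> * (\<delta> * C / \<kappa>) * inverse (norm (X (p n)))"
    proof (rule always_eventually, rule allI)
      fix n
      have "norm (Y n) \<le> B * norm (s n *\<^sub>R v n)" unfolding Y_def by (rule bd[OF p(1)])
      also have "\<dots> \<le> \<bar>B\<bar> * (s n * 1)"
      proof (rule mult_mono)
        show "norm (s n *\<^sub>R v n) \<le> s n * 1"
        proof -
          have s0: "0 \<le> s n" using \<delta>(1) W0[of n] by (simp add: s_def)
          then show ?thesis using mult_left_mono[OF v(2)[of n] s0] by simp
        qed
      qed auto
      also have "s n * 1 \<le> (\<delta> * C / \<kappa>) * inverse (norm (X (p n)))"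
      proof -
        have x: "0 < norm (X (p n))" using p(2)[of n] by linarith
        have "s n \<le> \<delta> / (\<kappa> * norm (X (p n)) / C)"
          unfolding s_def using W[of n] W0[of n] C(1) \<delta>(1) \<kappa>(1) x
          by (intro divide_left_mono mult_pos_pos) (auto simp: divide_le_eq mult.commute)
        then show ?thesis by (simp add: divide_inverse mult_ac)
      qed
      finally show "norm (Y n) \<le> \<bar>B\<bar> * (\<delta> * C / \<kappa>) * inverse (norm (X (p n)))"
        by (simp add: mult_left_mono mult.assoc)
    qed
    have "filterlim p at_top sequentially"
      unfolding p_def using filterlim_add_const_nat_at_top[of "N + 1"] by (simp add: add.assoc)
    from filterlim_compose[OF inf this] have "filterlim (\<lambda>n. norm (X (p n))) at_top sequentially" .
    then have "(\<lambda>n. inverse (norm (X (p n)))) \<longlonglongrightarrow> 0"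
      by (rule filterlim_compose[OF tendsto_inverse_0_at_top[OF filterlim_ident]])
    from tendsto_mult_right_zero[OF this]
    show "(\<lambda>n. \<bar>B\<bar> * (\<delta> * C / \<kappa>) * inverse (norm (X (p n)))) \<longlonglongrightarrow> 0" .
  qed
  have "norm (s n *\<^sub>R W n) = \<delta>" for n using W0[of n] \<delta>(1) by (simp add: s_def)
  then have "\<forall>n. \<exists>b\<in>cball E \<rho>. lie_exp G (s n *\<^sub>R W n) = c b \<and> norm (b - E - s n *\<^sub>R W n) \<le> \<delta> / 2"
    using \<delta>(3) by (metis order_refl)
  then obtain b where b: "\<And>n. b n \<in> cball E \<rho>" "\<And>n. lie_exp G (s n *\<^sub>R W n) = c (b n)"
    "\<And>n. norm (b n - E - s n *\<^sub>R W n) \<le> \<delta> / 2" by metis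
  \<comment> \<open>The coordinate error is at most half of \<delta>, so the limit point cannot be
    the identity.\<close>
  have bE: "\<delta> / 2 \<le> norm (b n - E)" for n
    using b(3)[of n] norm_triangle_sub[of "s n *\<^sub>R W n" "b n - E"] \<open>norm (s n *\<^sub>R W n) = \<delta>\<close>
    by (simp add: norm_minus_commute)
  obtain l q where q: "l \<in> cball E \<rho>" "strict_mono q" "(b \<circ> q) \<longlonglongrightarrow> l"
    using seq_compactE[OF compact_imp_seq_compact[OF compact_cball]] b(1) by metis
  have ld: "l \<in> dom" using q(1) \<delta>(2) by blast
  have "(\<lambda>n. norm ((b \<circ> q) n - E)) \<longlonglongrightarrow> norm (l - E)" by (intro tendsto_intros q)
  then have "\<delta> / 2 \<le> norm (l - E)" by (rule LIMSEQ_le_const) (use bE in auto)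
  then have "l \<noteq> E" using \<delta>(1) by auto
  then have "c l \<noteq> \<one>" using crd_c[OF ld] by (metis E_def)
  moreover have "limitin T (\<lambda>n. c ((b \<circ> q) n)) (c l) sequentially" by (rule c_limit[OF q(3) ld])
  then have "limitin T (\<lambda>n. g (p (q n)) \<otimes> y (q n) \<otimes> inv (g (p (q n)))) (c l) sequentially"
    by (simp add: conj b(2))
  moreover have "limitin T (\<lambda>n. y (q n)) \<one> sequentially"
    using lie_exp_tendsto_one[OF LIMSEQ_subseq_LIMSEQ[OF Y0 q(2)]] by (simp add: y_def o_def)
  moreover have "strict_mono (\<lambda>n. p (q n))"
    using q(2) by (auto simp: strict_mono_def p_def)
  moreover have "y n \<in> carrier G" for n by (simp add: y_def)
  ultimately show thesis
    using p(1) ld \<sigma>y by (intro that[of "\<lambda>n. p (q n)" "c l" "\<lambda>n. y (q n)"]) auto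
qed

end

section \<open>Norms\<close>

lemma is_norm_bounds:
  fixes N :: "'e::euclidean_space \<Rightarrow> real"
  assumes N: "is_norm N"
  obtains m M where "0 < m" "0 < M" "\<And>v. m * norm v \<le> N v" "\<And>v. N v \<le> M * norm v"
proof -
  have N0: "0 \<le> N v" and Nz: "N v = 0 \<longleftrightarrow> v = 0" and Nc: "N (r *\<^sub>R v) = \<bar>r\<bar> * N v"
    and Na: "N (v + w) \<le> N v + N w" for v w r
    using N by (auto simp: is_norm_def)
  define M where "M = (\<Sum>i\<in>(Basis::'e set). N i) + 1"
  have M0: "0 < M" unfolding M_def by (intro add_nonneg_pos sum_nonneg N0) simp
  have sumN: "N (sum f S) \<le> (\<Sum>i\<in>S. N (f i))" if "finite S" for f and S :: "'e set"
    using that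
  proof (induction S)
    case empty
    show ?case using Nz[of 0] by simp
  next
    case (insert x S)
    then show ?case using Na[of "f x" "sum f S"] by simp
  qed
  have up: "N v \<le> M * norm v" for v
  proof -
    have "N v = N (\<Sum>i\<in>Basis. (v \<bullet> i) *\<^sub>R i)" by (simp add: euclidean_representation)
    also have "\<dots> \<le> (\<Sum>i\<in>Basis. N ((v \<bullet> i) *\<^sub>R i))" by (rule sumN) simp
    also have "\<dots> \<le> (\<Sum>i\<in>(Basis::'e set). norm v * N i)"
      by (intro sum_mono) (simp add: Nc Basis_le_norm mult_right_mono N0)
    also have "\<dots> = (\<Sum>i\<in>(Basis::'e set). N i) * norm v" by (simp add: sum_distrib_left mult.commute)
    also have "\<dots> \<le> M * norm v" by (simp add: M_def mult_right_mono)
    finally show ?thesis .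
  qed
  have diff: "\<bar>N v - N w\<bar> \<le> M * norm (v - w)" for v w
  proof -
    have "N v \<le> N w + N (v - w)" "N w \<le> N v + N (w - v)" using Na[of w "v - w"] Na[of v "w - v"] by auto
    then show ?thesis using up[of "v - w"] up[of "w - v"] by (simp add: norm_minus_commute)
  qed
  have cont: "continuous_on (sphere 0 1) N"
    by (rule lipschitz_on_continuous_on[of M]) (use diff M0 in \<open>auto simp: lipschitz_on_def dist_norm\<close>)
  from continuous_attains_inf[OF compact_sphere _ cont]
  obtain v0 where v0: "v0 \<in> sphere 0 1" "\<And>v. v \<in> sphere 0 1 \<Longrightarrow> N v0 \<le> N v" by auto
  have "N v0 * norm v \<le> N v" for v
  proof (cases "v = 0")
    case False
    have "N v0 \<le> N ((1 / norm v) *\<^sub>R v)" using False by (intro v0(2)) simp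
    then show ?thesis using False by (simp add: Nc divide_simps)
  qed (simp add: N0)
  moreover have "N v0 > 0" using v0(1) Nz[of v0] N0[of v0] by (cases "v0 = 0") auto
  ultimately show thesis using M0 up that[of "N v0" M] by blast
qed

text \<open>\<open>op_norm\<close> is a supremum of reals and says something only for sets bounded
  above; equivalence of \<open>N\<close> with the Euclidean norm supplies the bound, after which v
  is rescaled.\<close>

lemma op_norm_bound:
  fixes A :: "'e::euclidean_space \<Rightarrow> 'e"
  assumes N: "is_norm N" and A: "linear A"
  shows "N (A v) \<le> op_norm N A * N v"
proof -
  obtain m M where m: "0 < m" "0 < M" "\<And>v. m * norm v \<le> N v" "\<And>v. N v \<le> M * norm v"
    using is_norm_bounds[OF N] by metis
  have N0: "0 \<le> N v" and Nz: "N v = 0 \<longleftrightarrow> v = 0" and Nc: "N (r *\<^sub>R v) = \<bar>r\<bar> * N v" for v r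
    using N by (auto simp: is_norm_def)
  obtain K where K: "K > 0" "\<And>v. norm (A v) \<le> norm v * K"
    using bounded_linear.pos_bounded A linear_conv_bounded_linear by metis
  have "N (A v) \<le> M * K / m" if "N v \<le> 1" for v
  proof -
    have "N (A v) \<le> M * (norm v * K)" using m(4)[of "A v"] mult_left_mono[OF K(2)[of v], of M] m(2) by linarith
    also have "\<dots> \<le> M * (1 / m * K)"
    proof -
      have "m * norm v \<le> 1" using m(3)[of v] that by linarith
      then have "norm v \<le> 1 / m" using m(1) by (simp add: field_simps)
      then show ?thesis using m K by (intro mult_left_mono mult_right_mono) auto
    qed
    finally show ?thesis by simp
  qed
  then have bdd: "bdd_above ((\<lambda>v. N (A v)) ` {v. N v \<le> 1})" by (intro bdd_aboveI2[of _ _ "M * K / m"]) simp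
  show ?thesis
  proof (cases "v = 0")
    case True
    moreover have "N 0 = 0" using Nz[of 0] by simp
    ultimately show ?thesis by (simp add: linear_0[OF A])
  next
    case False
    then have "N v > 0" using N0[of v] Nz[of v] by auto
    have "N (A ((1 / N v) *\<^sub>R v)) \<le> op_norm N A"
      unfolding op_norm_def using \<open>N v > 0\<close> by (intro cSUP_upper[OF _ bdd]) (simp add: Nc)
    then show ?thesis using \<open>N v > 0\<close> by (simp add: linear_cmul[OF A] Nc divide_simps)
  qed
qed

lemma op_norm_bounded_imp_norm:
  fixes A :: "'i \<Rightarrow> 'e::euclidean_space \<Rightarrow> 'e"
  assumes N: "is_norm N" and A: "\<And>i. i \<in> I \<Longrightarrow> linear (A i)" and bd: "\<And>i. i \<in> I \<Longrightarrow> op_norm N (A i) \<le> C"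
  obtains B where "\<And>i v. i \<in> I \<Longrightarrow> norm (A i v) \<le> B * norm v"
proof -
  obtain m M where m: "0 < m" "0 < M" "\<And>v. m * norm v \<le> N v" "\<And>v. N v \<le> M * norm v"
    using is_norm_bounds[OF N] by metis
  have "norm (A i v) \<le> (\<bar>C\<bar> * M / m) * norm v" if i: "i \<in> I" for i v
  proof -
    have N0: "0 \<le> N v" using N by (simp add: is_norm_def)
    have "m * norm (A i v) \<le> N (A i v)" by (rule m)
    also have "\<dots> \<le> op_norm N (A i) * N v" by (rule op_norm_bound[OF N A[OF i]])
    also have "\<dots> \<le> \<bar>C\<bar> * N v" using bd[OF i] by (intro mult_right_mono N0) linarith
    also have "\<dots> \<le> \<bar>C\<bar> * (M * norm v)" by (intro mult_left_mono m) simp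
    finally show ?thesis using m(1) by (simp add: field_simps)
  qed
  then show thesis by (rule that)
qed

section \<open>Borel measures on locally compact spaces\<close>

lemma sets_borel_of: "sets (borel_of X) = sigma_sets (topspace X) {U. openin X U}"
  and space_borel_of: "space (borel_of X) = topspace X"
  unfolding borel_of_def
  by (subst sets_measure_of space_measure_of; use openin_subset in auto)+

lemma borel_of_measurable_real:
  assumes M: "sets M = sets (borel_of X)" and f: "continuous_map X euclideanreal f"
  shows "f \<in> borel_measurable M"
proof (rule borel_measurableI)
  fix S :: "real set" assume S: "open S"
  have sp: "space M = topspace X" using sets_eq_imp_space_eq[OF M] by (simp add: space_borel_of)
  have "openin X {x \<in> topspace X. f x \<in> S}"
    using openin_continuous_map_preimage[OF f] S by simp
  moreover have "f -` S \<inter> space M = {x \<in> topspace X. f x \<in> S}" by (auto simp: sp)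
  ultimately show "f -` S \<inter> space M \<in> sets M" by (simp add: M sets_borel_of)
qed

lemma borel_of_measurable_map:
  assumes M: "sets M = sets (borel_of X)" and N: "sets N = sets (borel_of X)" and f: "continuous_map X X f"
  shows "f \<in> measurable M N"
proof (rule measurable_sigma_sets[OF N[unfolded sets_borel_of]])
  have sp: "space M = topspace X" using sets_eq_imp_space_eq[OF M] by (simp add: space_borel_of)
  show "{U. openin X U} \<subseteq> Pow (topspace X)" using openin_subset by auto
  show "f \<in> space M \<rightarrow> topspace X" using f by (auto simp: sp continuous_map_def)
  fix U assume "U \<in> {U. openin X U}"
  then have "openin X {x \<in> topspace X. f x \<in> U}" using openin_continuous_map_preimage[OF f] by simp
  moreover have "f -` U \<inter> space M = {x \<in> topspace X. f x \<in> U}" by (auto simp: sp)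
  ultimately show "f -` U \<inter> space M \<in> sets M" by (simp add: M sets_borel_of)
qed

lemma Cc_fun_bounded:
  assumes "Cc_fun X f"
  obtains B where "0 \<le> B" "\<And>x. x \<in> topspace X \<Longrightarrow> \<bar>f x\<bar> \<le> B"
proof -
  obtain C where C: "compactin X C" "\<forall>x\<in>topspace X - C. f x = 0" and f: "continuous_map X euclideanreal f"
    using assms by (auto simp: Cc_fun_def)
  have "compact (f ` C)" using image_compactin[OF C(1) f] by (simp add: compactin_euclidean_iff)
  then obtain B where B: "\<And>x. x \<in> C \<Longrightarrow> \<bar>f x\<bar> \<le> B" using compact_imp_bounded by (force simp: bounded_iff)
  have "\<bar>f x\<bar> \<le> max B 0" if "x \<in> topspace X" for x
    using B[of x] C(2) that by (cases "x \<in> C") auto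
  then show thesis by (intro that[of "max B 0"]) auto
qed

definition pos_set :: "'x topology \<Rightarrow> ('x \<Rightarrow> real) \<Rightarrow> 'x set" where
  "pos_set X f = {x \<in> topspace X. 0 < f x}"

text \<open>A locally compact Hausdorff space is completely regular. Separating x from the
  complement of W \<inter> U, with U inside a compact set, yields compact support and positivity
  only within W.\<close>

lemma bump_function_exists:
  assumes H: "Hausdorff_space X" and L: "locally_compact_space X" and W: "openin X W" "x \<in> W"
  shows "\<exists>f. Cc_fun X f \<and> (\<forall>x\<in>topspace X. 0 \<le> f x) \<and> x \<in> pos_set X f \<and> pos_set X f \<subseteq> W"
proof -
  have cr: "completely_regular_space X"
    by (rule locally_compact_regular_imp_completely_regular_space[OF L]) (use H in simp)
  have xt: "x \<in> topspace X" using W openin_subset by blast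
  obtain U K where U: "openin X U" "compactin X K" "x \<in> U" "U \<subseteq> K"
    using L xt unfolding locally_compact_space_def by blast
  have "closedin X (topspace X - (W \<inter> U))" using W(1) U(1) by (intro closedin_diff) auto
  moreover have "x \<in> topspace X - (topspace X - (W \<inter> U))" using xt W U by auto
  ultimately obtain f :: "'a \<Rightarrow> real" where f: "continuous_map X (top_of_set {0..1}) f" "f x = 0" "f ` (topspace X - (W \<inter> U)) \<subseteq> {1}"
    using cr unfolding completely_regular_space_def by blast
  have fc: "continuous_map X euclideanreal f" and f01: "f ` topspace X \<subseteq> {0..1}"
    using f(1) by (auto simp: continuous_map_in_subtopology)
  let ?g = "\<lambda>x. 1 - f x"
  have "continuous_map X euclideanreal ?g" by (intro continuous_intros fc)
  moreover have "\<forall>x\<in>topspace X - K. ?g x = 0" using f(3) U(4) by auto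
  ultimately have "Cc_fun X ?g" using U(2) by (auto simp: Cc_fun_def)
  moreover have "\<forall>x\<in>topspace X. 0 \<le> ?g x" using f01 by auto
  moreover have "x \<in> pos_set X ?g" using xt f(2) by (simp add: pos_set_def)
  moreover have "pos_set X ?g \<subseteq> W" using f(3) by (auto simp: pos_set_def)
  ultimately show ?thesis by blast
qed

text \<open>The functions min 1 (k f) increase to the indicator of the set where f is positive, so
  their integrals determine its measure. Taking finite products of countably many bump functions
  makes these sets stable under intersection, and they generate the Borel sets, so the uniqueness
  theorem for measures applies.\<close>

lemma exists_determining_functions:
  fixes X :: "'x topology"
  assumes H: "Hausdorff_space X" and L: "locally_compact_space X"
    and \<B>: "countable \<B>" "\<And>B. B \<in> \<B> \<Longrightarrow> openin X B"
      "\<And>U x. openin X U \<Longrightarrow> x \<in> U \<Longrightarrow> \<exists>B\<in>\<B>. x \<in> B \<and> B \<subseteq> U"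
  obtains F :: "nat \<Rightarrow> 'x \<Rightarrow> real" where "\<And>i. Cc_fun X (F i)"
    "\<And>\<nu> \<nu>'. finite_measure \<nu> \<Longrightarrow> finite_measure \<nu>' \<Longrightarrow> sets \<nu> = sets (borel_of X) \<Longrightarrow>
       sets \<nu>' = sets (borel_of X) \<Longrightarrow> (\<And>i. integral\<^sup>L \<nu> (F i) = integral\<^sup>L \<nu>' (F i)) \<Longrightarrow> \<nu> = \<nu>'"
proof -
  \<comment> \<open>One bump function is chosen for each pair of basic sets that admits one in
    between; countably many choices suffice for the positivity sets to form a base.\<close>
  define good where "good f p \<longleftrightarrow> Cc_fun X f \<and> (\<forall>x\<in>topspace X. 0 \<le> f x) \<and> fst p \<subseteq> pos_set X f \<and> pos_set X f \<subseteq> snd p"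
    for f and p :: "'x set \<times> 'x set"
  define D0 where "D0 = (\<lambda>p. SOME f. good f p) ` {p \<in> \<B> \<times> \<B>. \<exists>f. good f p}"
  have cD0: "countable D0"
  proof -
    have "countable (\<B> \<times> \<B>)" using \<B>(1) by simp
    then have "countable {p \<in> \<B> \<times> \<B>. \<exists>f. good f p}" by (rule countable_subset[rotated]) blast
    then show ?thesis unfolding D0_def by (rule countable_image)
  qed
  have D0: "Cc_fun X f" "\<And>x. x \<in> topspace X \<Longrightarrow> 0 \<le> f x" if "f \<in> D0" for f
  proof -
    obtain p where p: "\<exists>f. good f p" "f = (SOME f. good f p)" using \<open>f \<in> D0\<close> unfolding D0_def by blast
    have "good f p" unfolding p(2) by (rule someI_ex[OF p(1)])
    then show "Cc_fun X f" "\<And>x. x \<in> topspace X \<Longrightarrow> 0 \<le> f x" by (auto simp: good_def)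
  qed
  have pos_open: "openin X (pos_set X f)" if "Cc_fun X f" for f
    using openin_continuous_map_preimage[of X euclideanreal f "{0<..}"] that
    by (simp add: pos_set_def Cc_fun_def)
  have D0_base: "\<exists>f\<in>D0. x \<in> pos_set X f \<and> pos_set X f \<subseteq> U" if U: "openin X U" "x \<in> U" for U x
  proof -
    obtain B2 where B2: "B2 \<in> \<B>" "x \<in> B2" "B2 \<subseteq> U" using \<B>(3)[OF U] by blast
    obtain f where f: "Cc_fun X f" "\<forall>x\<in>topspace X. 0 \<le> f x" "x \<in> pos_set X f" "pos_set X f \<subseteq> B2"
      using bump_function_exists[OF H L \<B>(2)[OF B2(1)] B2(2)] by blast
    obtain B1 where B1: "B1 \<in> \<B>" "x \<in> B1" "B1 \<subseteq> pos_set X f" using \<B>(3)[OF pos_open[OF f(1)] f(3)] by blast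
    have ex: "\<exists>f. good f (B1, B2)" using f B1 by (auto simp: good_def)
    define f' where "f' = (SOME f. good f (B1, B2))"
    have "good f' (B1, B2)" unfolding f'_def using someI_ex[OF ex] .
    moreover have "f' \<in> D0" unfolding D0_def f'_def using ex B1(1) B2(1) by blast
    ultimately show ?thesis using B1(2) B2(3) by (intro bexI[of _ f']) (auto simp: good_def)
  qed
  define pr where "pr l x = prod_list (map (\<lambda>f. f x) l)" for l :: "('x \<Rightarrow> real) list" and x
  \<comment> \<open>The empty product is the constant 1, whose support need not be compact.\<close>
  define LL where "LL = {l \<in> lists D0. l \<noteq> []}"
  have pr0: "0 \<le> pr l x" if "l \<in> lists D0" "x \<in> topspace X" for l x
    using that(1) unfolding pr_def by (induction l) (auto simp: D0(2) that(2))
  have prc: "continuous_map X euclideanreal (pr l)" if "l \<in> lists D0" for l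
    using that
  proof (induction l)
    case Nil
    then show ?case by (simp add: pr_def[abs_def])
  next
    case (Cons f l)
    have "continuous_map X euclideanreal (\<lambda>x. f x * pr l x)"
      using Cons D0(1)[of f] by (intro continuous_map_real_mult) (auto simp: Cc_fun_def)
    then show ?case by (simp add: pr_def[abs_def])
  qed
  define hk where "hk k l x = min 1 (real k * pr l x)" for k l x
  have hkC: "Cc_fun X (hk k l)" if "l \<in> LL" for k l
  proof -
    obtain f l' where l: "l = f # l'" "f \<in> D0" using \<open>l \<in> LL\<close> by (cases l) (auto simp: LL_def)
    obtain C where C: "compactin X C" "\<forall>x\<in>topspace X - C. f x = 0" using D0(1)[OF l(2)] by (auto simp: Cc_fun_def)
    have "continuous_map X euclideanreal (hk k l)"
      unfolding hk_def[abs_def] using prc[of l] that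
      by (intro continuous_map_real_min continuous_map_real_mult) (auto simp: LL_def)
    moreover have "hk k l x = 0" if "x \<in> topspace X - C" for x
      using C(2) that by (simp add: hk_def pr_def l)
    ultimately show ?thesis using C(1) by (auto simp: Cc_fun_def)
  qed
  \<comment> \<open>The zero function guarantees a nonempty family, which can be enumerated by the
    natural numbers.\<close>
  define \<D> where "\<D> = insert (\<lambda>_. 0) ((\<lambda>(k, l). hk k l) ` (UNIV \<times> LL))"
  have "countable LL" unfolding LL_def using countable_lists[OF cD0] by (rule countable_subset[rotated]) auto
  then have c\<D>: "countable \<D>" unfolding \<D>_def by (intro countable_insert countable_image countable_SIGMA) auto
  have \<D>C: "Cc_fun X f" if "f \<in> \<D>" for f
  proof -
    have "Cc_fun X (\<lambda>_. 0)" by (auto simp: Cc_fun_def intro!: exI[of _ "{}"])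
    then show ?thesis using that hkC by (auto simp: \<D>_def)
  qed
  define F where "F = from_nat_into \<D>"
  have rF: "range F = \<D>" unfolding F_def by (rule range_from_nat_into[OF _ c\<D>]) (simp add: \<D>_def)
  define \<E> where "\<E> = (\<lambda>l. pos_set X (pr l)) ` LL"
  have Efrom: "pos_set X f \<in> \<E>" if "f \<in> D0" for f
    unfolding \<E>_def using that by (intro image_eqI[of _ _ "[f]"]) (auto simp: pr_def[abs_def] LL_def pos_set_def)
  have cE: "countable \<E>" unfolding \<E>_def using \<open>countable LL\<close> by simp
  have cover: "U = \<Union>{V \<in> \<E>. V \<subseteq> U}" if "openin X U" for U
    using D0_base[OF that] Efrom by blast
  have Eopen: "openin X V" if V: "V \<in> \<E>" for V
  proof -
    obtain l where "l \<in> lists D0" "V = pos_set X (pr l)" using V by (auto simp: \<E>_def LL_def)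
    then show ?thesis
      using openin_continuous_map_preimage[OF prc, of l "{0<..}"] by (simp add: pos_set_def)
  qed
  have gen: "sigma_sets (topspace X) {U. openin X U} = sigma_sets (topspace X) \<E>"
  proof (rule sigma_sets_eqI)
    fix U assume "U \<in> {U. openin X U}"
    then have "U = \<Union>{V \<in> \<E>. V \<subseteq> U}" using cover by blast
    moreover have "\<Union>{V \<in> \<E>. V \<subseteq> U} \<in> sigma_sets (topspace X) \<E>"
      by (rule sigma_sets_UNION) (auto intro: countable_subset[OF _ cE] sigma_sets.Basic)
    ultimately show "U \<in> sigma_sets (topspace X) \<E>" by simp
  qed (auto intro!: sigma_sets.Basic Eopen)
  have det: "\<nu> = \<nu>'" if fin: "finite_measure \<nu>" "finite_measure \<nu>'"
    and s: "sets \<nu> = sets (borel_of X)" "sets \<nu>' = sets (borel_of X)"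
    and eq: "\<And>i. integral\<^sup>L \<nu> (F i) = integral\<^sup>L \<nu>' (F i)" for \<nu> \<nu>' :: "'x measure"
  proof (rule measure_eqI_generator_eq_countable[where E = \<E> and \<Omega> = "topspace X" and A = "{V \<in> \<E>. V \<subseteq> topspace X}"])
    show "Int_stable \<E>"
    proof (rule Int_stableI)
      fix a b assume "a \<in> \<E>" "b \<in> \<E>"
      then obtain l l' where l: "l \<in> LL" "l' \<in> LL" "a = pos_set X (pr l)" "b = pos_set X (pr l')" by (auto simp: \<E>_def)
      have "pos_set X (pr (l @ l')) = a \<inter> b"
      proof -
        have "0 < pr (l @ l') x \<longleftrightarrow> 0 < pr l x \<and> 0 < pr l' x" if "x \<in> topspace X" for x
        proof -
          have "pr (l @ l') x = pr l x * pr l' x" by (simp add: pr_def)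
          moreover have "0 \<le> pr l x" "0 \<le> pr l' x" using pr0[OF _ that] l by (auto simp: LL_def)
          ultimately show ?thesis by (auto simp: zero_less_mult_iff)
        qed
        then show ?thesis by (auto simp: pos_set_def l)
      qed
      moreover have "l @ l' \<in> LL" using l by (auto simp: LL_def)
      ultimately show "a \<inter> b \<in> \<E>" by (metis \<E>_def imageI)
    qed
    show "\<E> \<subseteq> Pow (topspace X)" using Eopen openin_subset by blast
    have lim: "(\<lambda>k. integral\<^sup>L M (hk k l)) \<longlonglongrightarrow> measure M (pos_set X (pr l))"
      if M: "finite_measure M" "sets M = sets (borel_of X)" and l: "l \<in> LL" for M :: "'x measure" and l
    proof -
      interpret finite_measure M by (rule M(1))
      have sp: "space M = topspace X" using sets_eq_imp_space_eq[OF M(2)] by (simp add: space_borel_of)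
      have mp: "pos_set X (pr l) \<in> sets M"
        using Eopen[of "pos_set X (pr l)"] l unfolding M(2) sets_borel_of by (auto simp: \<E>_def)
      have "(\<lambda>k. integral\<^sup>L M (hk k l)) \<longlonglongrightarrow> integral\<^sup>L M (indicator (pos_set X (pr l)))"
      proof (rule integral_dominated_convergence[where w = "\<lambda>_. 1"])
        show "hk k l \<in> borel_measurable M" for k
          using borel_of_measurable_real[OF M(2)] hkC[OF l] by (auto simp: Cc_fun_def)
        show "AE x in M. (\<lambda>k. hk k l x) \<longlonglongrightarrow> indicator (pos_set X (pr l)) x"
        proof (rule AE_I2)
          fix x assume x: "x \<in> space M"
          have p0: "0 \<le> pr l x" using pr0[of l x] l x by (auto simp: LL_def sp)
          show "(\<lambda>k. hk k l x) \<longlonglongrightarrow> indicator (pos_set X (pr l)) x"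
          proof (cases "pr l x = 0")
            case True
            then show ?thesis by (simp add: hk_def pos_set_def)
          next
            case False
            with p0 have p: "0 < pr l x" by simp
            have "\<forall>\<^sub>F k in sequentially. hk k l x = 1"
            proof -
              obtain n :: nat where n: "1 / pr l x \<le> real n" using real_arch_simple by blast
              have "hk k l x = 1" if "n \<le> k" for k
              proof -
                have "1 / pr l x \<le> real k" using n that by linarith
                then have "1 \<le> real k * pr l x" using p by (simp add: field_simps)
                then show ?thesis by (simp add: hk_def)
              qed
              then show ?thesis by (auto simp: eventually_sequentially)
            qed
            moreover have "indicator (pos_set X (pr l)) x = (1::real)" using p x by (simp add: pos_set_def sp)
            ultimately show ?thesis by (simp add: tendsto_eventually)
          qed
        qed
        show "AE x in M. norm (hk k l x) \<le> 1" for k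
        proof (rule AE_I2)
          fix x assume "x \<in> space M"
          then have "0 \<le> pr l x" using pr0[of l x] l by (auto simp: LL_def sp)
          then have "0 \<le> hk k l x" "hk k l x \<le> 1" by (auto simp: hk_def)
          then show "norm (hk k l x) \<le> 1" by simp
        qed
      qed (use mp in auto)
      then show ?thesis using mp by simp
    qed
    show "emeasure \<nu> V = emeasure \<nu>' V" if "V \<in> \<E>" for V
    proof -
      obtain l where l: "l \<in> LL" "V = pos_set X (pr l)" using \<open>V \<in> \<E>\<close> by (auto simp: \<E>_def)
      have "integral\<^sup>L \<nu> (hk k l) = integral\<^sup>L \<nu>' (hk k l)" for k
      proof -
        have "hk k l \<in> range F" unfolding rF \<D>_def using l(1) by blast
        then show ?thesis using eq by auto
      qed
      then have "measure \<nu> V = measure \<nu>' V"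
        using lim[OF fin(1) s(1) l(1)] lim[OF fin(2) s(2) l(1)] LIMSEQ_unique by (simp add: l(2))
      then show ?thesis using fin by (simp add: finite_measure.emeasure_eq_measure)
    qed
    show "sets \<nu> = sigma_sets (topspace X) \<E>" "sets \<nu>' = sigma_sets (topspace X) \<E>"
      using s by (simp_all add: sets_borel_of gen)
    show "\<Union>{V \<in> \<E>. V \<subseteq> topspace X} = topspace X" using cover[OF openin_topspace] by simp
    show "countable {V \<in> \<E>. V \<subseteq> topspace X}" by (rule countable_subset[OF _ cE]) auto
    show "emeasure \<nu> a \<noteq> \<infinity>" for a using fin(1) by (simp add: finite_measure.emeasure_finite)
  qed auto
  show thesis by (rule that[of F]) (use rF \<D>C det in auto)
qed

section \<open>A law of large numbers along a sparse subsequence\<close>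

text \<open>From q^2 to an N below (q + 1)^2 there are at most 2 q further terms, each bounded by B;
  divided by at least q^2 they contribute at most 2 B / q.\<close>

lemma average_tendsto_0_if_square_averages:
  fixes a :: "nat \<Rightarrow> real"
  assumes B: "\<And>n. \<bar>a n\<bar> \<le> B" and lim: "(\<lambda>k. (\<Sum>n=1..k^2. a n) / real (k^2)) \<longlonglongrightarrow> 0"
  shows "(\<lambda>N. (\<Sum>n=1..N. a n) / real N) \<longlonglongrightarrow> 0"
proof -
  let ?S = "\<lambda>N. \<Sum>n=1..N. a n" and ?k = floor_sqrt
  have B0: "0 \<le> B" using B[of 0] by linarith
  have k: "filterlim ?k at_top sequentially"
    unfolding filterlim_at_top
  proof
    fix Z
    show "\<forall>\<^sub>F N in sequentially. Z \<le> ?k N"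
      using eventually_ge_at_top[of "Z^2"] by eventually_elim (simp add: le_floor_sqrtI)
  qed
  have bound: "\<bar>?S N / real N\<bar> \<le> \<bar>?S ((?k N)^2) / real ((?k N)^2)\<bar> + 2 * B * inverse (real (?k N))" if N: "1 \<le> N" for N
  proof -
    let ?q = "?k N"
    have q1: "1 \<le> ?q" using N le_floor_sqrtI[of 1 N] by simp
    have le: "?q^2 \<le> N" by simp
    have "N < (Suc ?q)^2" by (rule Suc_floor_sqrt_power2_gt)
    then have gap: "N - ?q^2 \<le> 2 * ?q" by (simp add: power2_eq_square)
    have qpos: "0 < real (?q^2)" using q1 by simp
    have leR: "real (?q^2) \<le> real N" using le by (simp only: of_nat_le_iff)
    have "?S N = ?S (?q^2) + (\<Sum>n=?q^2+1..N. a n)"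
      using sum.ub_add_nat[of 1 "?q^2" a "N - ?q^2"] le by simp
    also have "\<bar>\<dots>\<bar> \<le> \<bar>?S (?q^2)\<bar> + \<bar>\<Sum>n=?q^2+1..N. a n\<bar>" by simp
    also have "\<bar>\<Sum>n=?q^2+1..N. a n\<bar> \<le> (\<Sum>n=?q^2+1..N. B)"
      by (rule order_trans[OF sum_abs]) (intro sum_mono B)
    also have "\<dots> = real (N - ?q^2) * B" by simp
    also have "\<dots> \<le> real (2 * ?q) * B" using gap B0 by (intro mult_right_mono of_nat_mono) auto
    finally have "\<bar>?S N\<bar> \<le> \<bar>?S (?q^2)\<bar> + 2 * B * real ?q" by (simp add: mult_ac)
    then have "\<bar>?S N / real N\<bar> \<le> (\<bar>?S (?q^2)\<bar> + 2 * B * real ?q) / real N"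
      by (simp add: abs_divide divide_right_mono)
    also have "\<dots> \<le> (\<bar>?S (?q^2)\<bar> + 2 * B * real ?q) / real (?q^2)"
      using B0 qpos leR by (intro divide_left_mono mult_pos_pos) auto
    also have "\<dots> = \<bar>?S (?q^2) / real (?q^2)\<bar> + 2 * B * inverse (real ?q)"
    proof -
      have "(\<bar>S\<bar> + 2 * B * q) / q\<^sup>2 = \<bar>S / q\<^sup>2\<bar> + 2 * B * inverse q" if "0 < q" for q S :: real
        using that by (simp add: add_divide_distrib abs_divide power2_eq_square inverse_eq_divide)
      from this[of "real ?q" "?S (?q^2)"] show ?thesis using q1 by (simp only: of_nat_power)
    qed
    finally show ?thesis .
  qed
  have "(\<lambda>N. \<bar>?S ((?k N)^2) / real ((?k N)^2)\<bar> + 2 * B * inverse (real (?k N))) \<longlonglongrightarrow> \<bar>0\<bar> + 2 * B * 0"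
    by (intro tendsto_intros filterlim_compose[OF lim k]
        filterlim_compose[OF tendsto_inverse_0_at_top[OF filterlim_real_sequentially] k])
  then have "(\<lambda>N. \<bar>?S ((?k N)^2) / real ((?k N)^2)\<bar> + 2 * B * inverse (real (?k N))) \<longlonglongrightarrow> 0" by simp
  then show ?thesis
    by (rule Lim_null_comparison[rotated])
       (use eventually_ge_at_top[of 1] in \<open>eventually_elim, use bound in simp\<close>)
qed

context prob_space
begin

text \<open>Term N + 1 adds its square, at most B^2, and twice its correlation with the earlier
  terms. That correlation is at most N / 2^N \<le> 1 once N \<ge> j, and at most j B^2 before. These
  contributions make up the constant per step.\<close>

lemma square_integral_bound:
  fixes a :: "nat \<Rightarrow> 'a \<Rightarrow> real"
  assumes m: "\<And>n. a n \<in> borel_measurable M" and B: "\<And>n x. x \<in> space M \<Longrightarrow> \<bar>a n x\<bar> \<le> B"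
    and cor: "\<And>m n. j \<le> n \<Longrightarrow> m \<le> n \<Longrightarrow> \<bar>expectation (\<lambda>x. a m x * a (Suc n) x)\<bar> \<le> 1 / 2 ^ n"
  shows "expectation (\<lambda>x. (\<Sum>n=1..N. a n x)\<^sup>2) \<le> (2 + B\<^sup>2 + 2 * real j * B\<^sup>2) * real N"
proof (induction N)
  case (Suc N)
  let ?S = "\<lambda>x. \<Sum>n=1..N. a n x" and ?b = "a (Suc N)"
  obtain x0 where "x0 \<in> space M" using not_empty by blast
  then have B0: "0 \<le> B" using B[of x0 0] by linarith
  have prodB: "\<bar>a m x * a n x\<bar> \<le> B\<^sup>2" if "x \<in> space M" for m n x
    unfolding abs_mult power2_eq_square by (intro mult_mono B that B0) auto
  have int: "integrable M (\<lambda>x. a m x * a n x)" for m n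
    by (rule integrable_const_bound[of _ "B\<^sup>2"]) (use prodB m in auto)
  have intS: "integrable M (\<lambda>x. ?S x * ?b x)"
    unfolding sum_distrib_right by (intro Bochner_Integration.integrable_sum int)
  have intS2: "integrable M (\<lambda>x. (?S x)\<^sup>2)"
    unfolding power2_eq_square sum_product by (intro Bochner_Integration.integrable_sum int)
  have b2: "expectation (\<lambda>x. (?b x)\<^sup>2) \<le> B\<^sup>2"
  proof -
    have "expectation (\<lambda>x. (?b x)\<^sup>2) \<le> expectation (\<lambda>x. B\<^sup>2)"
      using int[of "Suc N" "Suc N"] prodB[of _ "Suc N" "Suc N"]
      by (intro integral_mono) (auto simp: power2_eq_square)
    then show ?thesis by (simp add: prob_space)
  qed
  have corB: "\<bar>expectation (\<lambda>x. a m x * ?b x)\<bar> \<le> B\<^sup>2" for m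
  proof -
    have "\<bar>expectation (\<lambda>x. a m x * ?b x)\<bar> \<le> expectation (\<lambda>x. \<bar>a m x * ?b x\<bar>)" by (rule integral_abs_bound)
    also have "\<dots> \<le> expectation (\<lambda>x. B\<^sup>2)" using int prodB by (intro integral_mono integrable_abs) auto
    finally show ?thesis by (simp add: prob_space)
  qed
  have cross: "expectation (\<lambda>x. ?S x * ?b x) \<le> 1 + real j * B\<^sup>2"
  proof -
    have "expectation (\<lambda>x. ?S x * ?b x) = (\<Sum>n=1..N. expectation (\<lambda>x. a n x * ?b x))"
      unfolding sum_distrib_right by (intro Bochner_Integration.integral_sum int)
    also have "\<dots> \<le> 1 + real j * B\<^sup>2"
    proof (cases "j \<le> N")
      case True
      have "(\<Sum>n=1..N. expectation (\<lambda>x. a n x * ?b x)) \<le> (\<Sum>n=1..N. 1 / 2 ^ N)"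
        using cor[OF True] by (intro sum_mono) (simp add: abs_le_iff)
      also have "\<dots> = real N / 2 ^ N" by simp
      also have "\<dots> \<le> 1"
        using less_exp[of N] by (simp add: divide_le_eq_1)
      finally show ?thesis by (simp add: add_increasing2)
    next
      case False
      have "(\<Sum>n=1..N. expectation (\<lambda>x. a n x * ?b x)) \<le> (\<Sum>n=1..N. B\<^sup>2)"
        using corB by (intro sum_mono) (simp add: abs_le_iff)
      also have "\<dots> = real N * B\<^sup>2" by simp
      also have "\<dots> \<le> real j * B\<^sup>2" using False by (intro mult_right_mono) auto
      finally show ?thesis by simp
    qed
    finally show ?thesis .
  qed
  have "expectation (\<lambda>x. (\<Sum>n=1..Suc N. a n x)\<^sup>2) = expectation (\<lambda>x. (?S x)\<^sup>2 + 2 * (?S x * ?b x) + (?b x)\<^sup>2)"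
    by (rule Bochner_Integration.integral_cong) (simp_all add: power2_sum)
  also have "\<dots> = expectation (\<lambda>x. (?S x)\<^sup>2) + 2 * expectation (\<lambda>x. ?S x * ?b x) + expectation (\<lambda>x. (?b x)\<^sup>2)"
    using intS intS2 int[of "Suc N" "Suc N"] by (simp add: power2_eq_square)
  also have "\<dots> \<le> (2 + B\<^sup>2 + 2 * real j * B\<^sup>2) * real N + 2 * (1 + real j * B\<^sup>2) + B\<^sup>2"
    using add_mono[OF add_mono[OF Suc mult_left_mono[OF cross, of 2]] b2] by simp
  also have "\<dots> = (2 + B\<^sup>2 + 2 * real j * B\<^sup>2) * real (Suc N)" by (simp add: algebra_simps)
  finally show ?case .
qed simp

text \<open>The second moment of the average over N terms is at most K / N, which is summable along
  the squares N = (k + 1)^2. Hence the squared averages are summable almost everywhere and tend to 0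
  there, and boundedness fills the gaps between squares.\<close>

lemma averages_tendsto_0_AE:
  fixes a :: "nat \<Rightarrow> 'a \<Rightarrow> real"
  assumes m: "\<And>n. a n \<in> borel_measurable M" and B: "\<And>n x. x \<in> space M \<Longrightarrow> \<bar>a n x\<bar> \<le> B"
    and cor: "\<And>m n. j \<le> n \<Longrightarrow> m \<le> n \<Longrightarrow> \<bar>expectation (\<lambda>x. a m x * a (Suc n) x)\<bar> \<le> 1 / 2 ^ n"
  shows "AE x in M. (\<lambda>N. (\<Sum>n=1..N. a n x) / real N) \<longlonglongrightarrow> 0"
proof -
  define K where "K = 2 + B\<^sup>2 + 2 * real j * B\<^sup>2"
  let ?A = "\<lambda>k x. ((\<Sum>n=1..(Suc k)^2. a n x) / real ((Suc k)^2))\<^sup>2"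
  have mA: "?A k \<in> borel_measurable M" for k using m by measurable
  have bA: "\<bar>\<Sum>n=1..N. a n x\<bar> \<le> real N * B" if "x \<in> space M" for N x
  proof -
    have "\<bar>\<Sum>n=1..N. a n x\<bar> \<le> (\<Sum>n=1..N. B)"
      by (rule order_trans[OF sum_abs]) (intro sum_mono B that)
    then show ?thesis by simp
  qed
  have iA: "integrable M (?A k)" for k
  proof (rule integrable_const_bound[of _ "B\<^sup>2"])
    show "AE x in M. norm (?A k x) \<le> B\<^sup>2"
    proof (rule AE_I2)
      fix x assume x: "x \<in> space M"
      have pos: "0 < real ((Suc k)^2)" by simp
      have "\<bar>(\<Sum>n=1..(Suc k)^2. a n x) / real ((Suc k)^2)\<bar> \<le> B"
        using bA[OF x, of "(Suc k)^2"] pos by (simp only: abs_divide pos_divide_le_eq abs_of_pos mult.commute)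
      then show "norm (?A k x) \<le> B\<^sup>2"
        by (simp only: real_norm_def abs_power2) (metis abs_ge_zero power2_abs power_mono)
    qed
  qed (rule mA)
  have EA: "expectation (?A k) \<le> K * (1 / (real (Suc k))^2)" for k
  proof -
    have "expectation (?A k) = expectation (\<lambda>x. (\<Sum>n=1..(Suc k)^2. a n x)\<^sup>2) / (real ((Suc k)^2))\<^sup>2"
      by (simp add: power_divide)
    also have "\<dots> \<le> K * real ((Suc k)^2) / (real ((Suc k)^2))\<^sup>2"
      unfolding K_def by (intro divide_right_mono square_integral_bound[OF m B cor]) auto
    also have "\<dots> = K * (1 / (real (Suc k))^2)"
    proof -
      have "K * n / n\<^sup>2 = K * (1 / n)" if "0 < n" for n :: real
        using that by (simp add: power2_eq_square)
      from this[of "(real (Suc k))^2"] show ?thesis by (simp only: of_nat_power) simp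
    qed
    finally show ?thesis .
  qed
  have sm: "summable (\<lambda>k. K * (1 / (real (Suc k))^2))"
    by (rule summable_mult) (use inverse_power_summable[of 2, where 'a = real] summable_Suc_iff[of "\<lambda>k. inverse (real k ^ 2)"] in \<open>simp add: divide_inverse\<close>)
  have "(\<integral>\<^sup>+x. (\<Sum>k. ennreal (?A k x)) \<partial>M) = (\<Sum>k. \<integral>\<^sup>+x. ennreal (?A k x) \<partial>M)"
    by (rule nn_integral_suminf) (use mA in measurable)
  also have "\<dots> = (\<Sum>k. ennreal (expectation (?A k)))"
    by (intro suminf_cong nn_integral_eq_integral iA) simp
  also have "\<dots> \<le> (\<Sum>k. ennreal (K * (1 / (real (Suc k))^2)))"
    by (intro suminf_le ennreal_leI EA) auto
  also have "\<dots> = ennreal (\<Sum>k. K * (1 / (real (Suc k))^2))"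
    by (rule suminf_ennreal2[OF _ sm]) (simp add: K_def)
  also have "\<dots> < \<infinity>" by simp
  finally have "(\<integral>\<^sup>+x. (\<Sum>k. ennreal (?A k x)) \<partial>M) \<noteq> \<infinity>" by simp
  then have "AE x in M. (\<Sum>k. ennreal (?A k x)) \<noteq> \<infinity>"
    by (intro nn_integral_PInf_AE) (use mA in measurable)
  then show ?thesis
  proof (rule AE_mp, intro AE_I2 impI)
    fix x assume x: "x \<in> space M" and fin: "(\<Sum>k. ennreal (?A k x)) \<noteq> \<infinity>"
    have "summable (\<lambda>k. ?A k x)" by (rule summable_suminf_not_top) (use fin in auto)
    then have "(\<lambda>k. ?A k x) \<longlonglongrightarrow> 0" by (rule summable_LIMSEQ_zero)
    from tendsto_real_sqrt[OF this]
    have "(\<lambda>k. \<bar>(\<Sum>n=1..(Suc k)^2. a n x) / real ((Suc k)^2)\<bar>) \<longlonglongrightarrow> 0"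
      by (simp only: real_sqrt_abs real_sqrt_zero)
    then have "(\<lambda>k. (\<Sum>n=1..(Suc k)^2. a n x) / real ((Suc k)^2)) \<longlonglongrightarrow> 0" by (rule tendsto_rabs_zero_cancel)
    then have "(\<lambda>k. (\<Sum>n=1..k^2. a n x) / real (k^2)) \<longlonglongrightarrow> 0" by (rule LIMSEQ_imp_Suc)
    then show "(\<lambda>N. (\<Sum>n=1..N. a n x) / real N) \<longlonglongrightarrow> 0"
      by (rule average_tendsto_0_if_square_averages[rotated]) (rule B[OF x])
  qed
qed

text \<open>There is neither a rate nor uniformity in i. At stage n the next index has to serve only
  i \<le> n, so each fixed i is under control from stage i on; this i is the parameter
  \<open>j\<close> of the averaging lemma.\<close>

lemma decorrelated_subsequence:
  fixes \<phi> :: "nat \<Rightarrow> nat \<Rightarrow> 'a \<Rightarrow> real"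
  assumes m: "\<And>i n. \<phi> i n \<in> borel_measurable M" and B: "\<And>i n x. x \<in> space M \<Longrightarrow> \<bar>\<phi> i n x\<bar> \<le> B i"
    and cor: "\<And>i m. (\<lambda>n. expectation (\<lambda>x. \<phi> i m x * \<phi> i n x)) \<longlonglongrightarrow> 0"
  obtains s :: "nat \<Rightarrow> nat" where "strict_mono s"
    "\<And>i. AE x in M. (\<lambda>N. (\<Sum>n=1..N. \<phi> i (s n) x) / real N) \<longlonglongrightarrow> 0"
proof -
  have "\<exists>k>S. \<forall>i\<le>n. \<forall>m\<le>S. \<bar>expectation (\<lambda>x. \<phi> i m x * \<phi> i k x)\<bar> \<le> 1 / 2 ^ n" for S n
  proof -
    have "\<forall>\<^sub>F k in sequentially. \<bar>expectation (\<lambda>x. \<phi> i m x * \<phi> i k x)\<bar> \<le> 1 / 2 ^ n" for i m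
      using order_tendstoD(2)[OF tendsto_rabs_zero[OF cor[of i m]], of "1 / 2 ^ n"]
      by (auto elim: eventually_mono)
    then have "\<forall>\<^sub>F k in sequentially. \<forall>i\<in>{..n}. \<forall>m\<in>{..S}. \<bar>expectation (\<lambda>x. \<phi> i m x * \<phi> i k x)\<bar> \<le> 1 / 2 ^ n"
      by (intro eventually_ball_finite ballI) auto
    with eventually_gt_at_top[of S]
    have "\<forall>\<^sub>F k in sequentially. k > S \<and> (\<forall>i\<in>{..n}. \<forall>m\<in>{..S}. \<bar>expectation (\<lambda>x. \<phi> i m x * \<phi> i k x)\<bar> \<le> 1 / 2 ^ n)"
      by eventually_elim simp
    then obtain k where "k > S \<and> (\<forall>i\<in>{..n}. \<forall>m\<in>{..S}. \<bar>expectation (\<lambda>x. \<phi> i m x * \<phi> i k x)\<bar> \<le> 1 / 2 ^ n)"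
      using eventually_happens'[OF sequentially_bot] by blast
    then show ?thesis by auto
  qed
  then obtain nxt where nxt: "\<And>S n. nxt S n > S"
    "\<And>S n i m. i \<le> n \<Longrightarrow> m \<le> S \<Longrightarrow> \<bar>expectation (\<lambda>x. \<phi> i m x * \<phi> i (nxt S n) x)\<bar> \<le> 1 / 2 ^ n" by metis
  \<comment> \<open>Correlations are made small with all indices up to the last one chosen, so the
    recursion has to remember only that index.\<close>
  define s where "s = rec_nat 0 (\<lambda>n S. nxt S n)"
  have s: "s (Suc n) = nxt (s n) n" for n by (simp add: s_def)
  have mono: "strict_mono s" unfolding strict_mono_Suc_iff s using nxt(1) by blast
  have "AE x in M. (\<lambda>N. (\<Sum>n=1..N. \<phi> i (s n) x) / real N) \<longlonglongrightarrow> 0" for i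
  proof (rule averages_tendsto_0_AE[OF m B])
    fix m n assume "i \<le> n" "m \<le> n"
    then show "\<bar>expectation (\<lambda>x. \<phi> i (s m) x * \<phi> i (s (Suc n)) x)\<bar> \<le> 1 / 2 ^ n"
      unfolding s by (intro nxt(2)) (use strict_mono_less_eq[OF mono] in auto)
  qed
  with mono show thesis by (rule that)
qed

end

section \<open>The homogeneous space of a discrete subgroup\<close>

locale discrete_quotient = lie_grp G for G :: "('g, 'e::euclidean_space) lie_data" (structure) +
  fixes \<Gamma> :: "'g set"
  assumes discrete: "discrete_subgroup G \<Gamma>"
begin

abbreviation X where "X \<equiv> coset_space G \<Gamma>"
abbreviation p where "p x \<equiv> x <#\<^bsub>G\<^esub> \<Gamma>"
abbreviation act where "act g z \<equiv> g <#\<^bsub>G\<^esub> z"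

lemma \<Gamma>: "subgroup \<Gamma> G"
  using discrete by (simp add: discrete_subgroup_def)

lemma \<Gamma>_carrier: "\<gamma> \<in> \<Gamma> \<Longrightarrow> \<gamma> \<in> carrier G"
  using subgroup.subset[OF \<Gamma>] by auto

lemma topspace_X: "topspace X = p ` carrier G"
  unfolding topspace_coset_space[OF lie_group] LCOSETS_def by auto

lemma act_p: "g \<in> carrier G \<Longrightarrow> x \<in> carrier G \<Longrightarrow> act g (p x) = p (g \<otimes> x)"
  by (rule lcos_m_assoc[OF subgroup.subset[OF \<Gamma>]])

lemma act_closed: "g \<in> carrier G \<Longrightarrow> z \<in> topspace X \<Longrightarrow> act g z \<in> topspace X"
  by (auto simp: topspace_X act_p)

lemma act_act: "g \<in> carrier G \<Longrightarrow> h \<in> carrier G \<Longrightarrow> z \<in> topspace X \<Longrightarrow> act g (act h z) = act (g \<otimes> h) z"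
  by (auto simp: topspace_X act_p m_assoc)

lemma act_one: "z \<in> topspace X \<Longrightarrow> act \<one> z = z"
  by (auto simp: topspace_X act_p)

lemma p_mult_\<Gamma>: "x \<in> carrier G \<Longrightarrow> \<gamma> \<in> \<Gamma> \<Longrightarrow> p (x \<otimes> \<gamma>) = p x"
  using act_p[OF _ \<Gamma>_carrier, of x \<gamma>] coset_join3[OF \<Gamma>_carrier \<Gamma>, of \<gamma>] by simp

lemma p_eq_imp: 
  assumes "x \<in> carrier G" "y \<in> carrier G" "p x = p y"
  shows "inv x \<otimes> y \<in> \<Gamma>"
proof -
  have "y \<in> p x" using lcos_self[OF assms(2) \<Gamma>] assms(3) by simp
  then obtain \<gamma> where "\<gamma> \<in> \<Gamma>" "y = x \<otimes> \<gamma>" by (auto simp: l_coset_def)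
  then show ?thesis using assms(1) \<Gamma>_carrier by (simp add: m_assoc[symmetric])
qed

lemma p_continuous: "continuous_map T X p"
  by (rule continuous_map_coset)

text \<open>The preimage of the image of W is the union of its right translates by \<Gamma>, each of
  which is open.\<close>

lemma p_open:
  assumes W: "openin T W"
  shows "openin X (p ` W)"
proof -
  have Wc: "W \<subseteq> carrier G" using openin_subset[OF W] by simp
  have "{x \<in> topspace T. p x \<in> p ` W} = (\<Union>\<gamma>\<in>\<Gamma>. {x \<in> topspace T. x \<otimes> \<gamma> \<in> W})"
  proof (safe)
    fix x w assume x: "x \<in> topspace T" "p x = p w" "w \<in> W"
    then have "inv x \<otimes> w \<in> \<Gamma>" using p_eq_imp Wc by auto
    moreover have "x \<otimes> (inv x \<otimes> w) = w" using x Wc by (auto simp: m_assoc[symmetric])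
    ultimately have "inv x \<otimes> w \<in> \<Gamma> \<and> x \<otimes> (inv x \<otimes> w) \<in> W" using x(3) by simp
    then show "x \<in> (\<Union>\<gamma>\<in>\<Gamma>. {x \<in> topspace T. x \<otimes> \<gamma> \<in> W})" using x(1) by blast
  next
    fix x \<gamma> assume "x \<in> topspace T" "\<gamma> \<in> \<Gamma>" "x \<otimes> \<gamma> \<in> W"
    then show "p x \<in> p ` W" using p_mult_\<Gamma>[of x \<gamma>] by (metis imageI topspace_T)
  qed
  moreover have "openin T {x \<in> topspace T. x \<otimes> \<gamma> \<in> W}" if "\<gamma> \<in> \<Gamma>" for \<gamma>
    using openin_continuous_map_preimage[OF continuous_mult[OF continuous_map_id continuous_const_map[OF \<Gamma>_carrier[OF that]]] W]
    by simp
  ultimately have "openin T {x \<in> topspace T. p x \<in> p ` W}" by auto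
  then show ?thesis using Wc by (auto simp: openin_coset_space LCOSETS_def)
qed

lemma continuous_map_quotient:
  assumes "continuous_map T Y (\<lambda>x. f (p x))"
  shows "continuous_map X Y f"
  unfolding continuous_map_def
proof (intro conjI allI impI)
  show "f \<in> topspace X \<rightarrow> topspace Y"
    using assms by (auto simp: continuous_map_def topspace_X)
  fix U assume "openin Y U"
  from openin_continuous_map_preimage[OF assms this]
  have "openin T {x \<in> topspace T. f (p x) \<in> U}" .
  moreover have "{x \<in> topspace T. p x \<in> {z \<in> topspace X. f z \<in> U}} = {x \<in> topspace T. f (p x) \<in> U}"
    by (auto simp: topspace_X)
  ultimately show "openin X {z \<in> topspace X. f z \<in> U}"
    using topspace_coset_space[OF lie_group] by (auto simp: openin_coset_space)
qed

lemma act_continuous: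
  assumes "g \<in> carrier G"
  shows "continuous_map X X (act g)"
proof (rule continuous_map_quotient, rule continuous_map_eq)
  show "continuous_map T X (\<lambda>x. p (g \<otimes> x))"
    using continuous_map_compose[OF continuous_mult[OF continuous_const_map[OF assms] continuous_map_id] p_continuous]
    by (simp add: o_def)
qed (use assms in \<open>simp add: act_p\<close>)

lemma mult_box:
  assumes h: "continuous_map (prod_topology T T) Y h" and S: "openin Y S" "h (x, y) \<in> S"
    and xy: "x \<in> carrier G" "y \<in> carrier G"
  obtains A B where "openin T A" "openin T B" "x \<in> A" "y \<in> B" "\<And>a b. a \<in> A \<Longrightarrow> b \<in> B \<Longrightarrow> h (a, b) \<in> S"
proof -
  have "openin (prod_topology T T) {q \<in> topspace (prod_topology T T). h q \<in> S}"
    by (rule openin_continuous_map_preimage[OF h S(1)])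
  moreover have "(x, y) \<in> {q \<in> topspace (prod_topology T T). h q \<in> S}" using S(2) xy by simp
  ultimately obtain A B where "openin T A" "openin T B" "x \<in> A" "y \<in> B"
    "A \<times> B \<subseteq> {q \<in> topspace (prod_topology T T). h q \<in> S}"
    unfolding openin_prod_topology_alt by meson
  then show thesis by (intro that[of A B]) auto
qed

lemma inv_mult_continuous: "continuous_map (prod_topology T T) T (\<lambda>q. inv (fst q) \<otimes> snd q)"
  by (intro continuous_mult continuous_inv continuous_map_fst continuous_map_snd)

text \<open>Take a neighbourhood W of 1 that meets \<Gamma> only in 1. Near x, elements of \<Gamma>
  have quotients in W and therefore coincide, so at most one point has to be removed from a
  neighbourhood of x.\<close>

lemma \<Gamma>_closed: "openin T (carrier G - \<Gamma>)"
proof (subst openin_subopen, intro ballI)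
  fix x assume x: "x \<in> carrier G - \<Gamma>"
  have one: "\<one> \<in> \<Gamma>" using subgroup.one_closed[OF \<Gamma>] .
  have "openin (subtopology T \<Gamma>) {\<one>}"
    using discrete one by (simp add: discrete_subgroup_def)
  then obtain W where W: "openin T W" "{\<one>} = W \<inter> \<Gamma>" by (auto simp: openin_subtopology)
  obtain A B where AB: "openin T A" "openin T B" "x \<in> A" "x \<in> B"
    "\<And>a b. a \<in> A \<Longrightarrow> b \<in> B \<Longrightarrow> inv a \<otimes> b \<in> W"
    using mult_box[OF inv_mult_continuous W(1), of x x] x W(2) by auto
  have uniq: "a = b" if "a \<in> A \<inter> \<Gamma>" "b \<in> B \<inter> \<Gamma>" for a b
  proof -
    have c: "a \<in> carrier G" "b \<in> carrier G" using that \<Gamma>_carrier by auto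
    have "inv a \<otimes> b \<in> W \<inter> \<Gamma>"
      using AB(5) that subgroup.m_closed[OF \<Gamma>] subgroup.m_inv_closed[OF \<Gamma>] by auto
    then have "inv a \<otimes> b = \<one>" using W(2) by auto
    then show ?thesis using c by (metis inv_closed inv_equality inv_inv)
  qed
  show "\<exists>S. openin T S \<and> x \<in> S \<and> S \<subseteq> carrier G - \<Gamma>"
  proof (cases "A \<inter> B \<inter> \<Gamma> = {}")
    case True
    have "A \<inter> B \<subseteq> carrier G" using openin_subset[OF AB(1)] by auto
    then show ?thesis using True AB by (intro exI[of _ "A \<inter> B"]) auto
  next
    case False
    then obtain \<gamma> where \<gamma>: "\<gamma> \<in> A \<inter> B \<inter> \<Gamma>" by blast
    have "closedin T {\<gamma>}" using \<gamma> \<Gamma>_carrier by (intro closedin_Hausdorff_singleton[OF Hausdorff_T]) auto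
    then have "openin T (A \<inter> B - {\<gamma>})" using AB by (intro openin_diff openin_Int)
    moreover have "A \<inter> B - {\<gamma>} \<subseteq> carrier G - \<Gamma>" using uniq \<gamma> openin_subset[OF AB(1)] by auto
    moreover have "x \<in> A \<inter> B - {\<gamma>}" using AB x \<gamma> by auto
    ultimately show ?thesis by blast
  qed
qed

text \<open>Cosets of x and y are distinct when inv x y is outside \<Gamma>. As \<Gamma> is closed,
  this persists on neighbourhoods of x and y, whose images are open and disjoint.\<close>

lemma Hausdorff_X: "Hausdorff_space X"
  unfolding Hausdorff_space_def
proof (intro allI impI)
  fix z w assume zw: "z \<in> topspace X \<and> w \<in> topspace X \<and> z \<noteq> w"
  then obtain x y where xy: "x \<in> carrier G" "y \<in> carrier G" "z = p x" "w = p y" by (auto simp: topspace_X)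
  have "inv x \<otimes> y \<notin> \<Gamma>"
  proof
    assume "inv x \<otimes> y \<in> \<Gamma>"
    from p_mult_\<Gamma>[OF xy(1) this] have "p y = p x" using xy by (simp add: m_assoc[symmetric])
    then show False using zw xy by simp
  qed
  then obtain A B where AB: "openin T A" "openin T B" "x \<in> A" "y \<in> B"
    "\<And>a b. a \<in> A \<Longrightarrow> b \<in> B \<Longrightarrow> inv a \<otimes> b \<in> carrier G - \<Gamma>"
    using mult_box[OF inv_mult_continuous \<Gamma>_closed, of x y] xy by auto
  have "disjnt (p ` A) (p ` B)"
    unfolding disjnt_iff
  proof (intro allI notI)
    fix q assume "q \<in> p ` A \<and> q \<in> p ` B"
    then obtain a b where ab: "a \<in> A" "b \<in> B" "p a = p b" by auto
    then have "inv a \<otimes> b \<in> \<Gamma>"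
      using openin_subset[OF AB(1)] openin_subset[OF AB(2)] by (intro p_eq_imp) auto
    then show False using AB(5)[OF ab(1,2)] by simp
  qed
  then show "\<exists>U V. openin X U \<and> openin X V \<and> z \<in> U \<and> w \<in> V \<and> disjnt U V"
    using p_open[OF AB(1)] p_open[OF AB(2)] AB xy by blast
qed

text \<open>A compact ball in the identity chart is translated to x and projected; the projection is
  open, so the image is a neighbourhood.\<close>

lemma locally_compact_X: "locally_compact_space X"
  unfolding locally_compact_space_def
proof
  fix z assume "z \<in> topspace X"
  then obtain x where x: "x \<in> carrier G" "z = p x" by (auto simp: topspace_X)
  obtain r where r: "r > 0" "cball E r \<subseteq> dom"
    using open_dom E_dom open_contains_cball by metis
  define V where "V = {y \<in> U0. crd y \<in> ball E r}"
  have V: "openin T V" unfolding V_def by (rule chart_preimage_openin[OF id_chart open_ball])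
  define W where "W = {y \<in> topspace T. inv x \<otimes> y \<in> V}"
  have W: "openin T W"
    unfolding W_def using openin_continuous_map_preimage[OF continuous_mult[OF continuous_const_map[OF inv_closed[OF x(1)]] continuous_map_id] V]
    by simp
  have "continuous_map T X (\<lambda>y. p (x \<otimes> y))"
    using continuous_map_compose[OF continuous_mult[OF continuous_const_map[OF x(1)] continuous_map_id] p_continuous]
    by (simp add: o_def)
  from image_compactin[OF compactin_c_cball[OF r(2)] this]
  have K: "compactin X ((\<lambda>y. p (x \<otimes> y)) ` c ` cball E r)" .
  have "x \<in> W" using x r one_U0 by (simp add: W_def V_def E_def)
  moreover have "p ` W \<subseteq> (\<lambda>y. p (x \<otimes> y)) ` c ` cball E r"
  proof
    fix q assume "q \<in> p ` W"
    then obtain y where y: "y \<in> W" "q = p y" by blast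
    then have yc: "y \<in> carrier G" and v: "inv x \<otimes> y \<in> U0" "crd (inv x \<otimes> y) \<in> ball E r" by (auto simp: W_def V_def)
    have "inv x \<otimes> y = c (crd (inv x \<otimes> y))" using v by simp
    then have "inv x \<otimes> y \<in> c ` cball E r" using v(2) by (metis ball_subset_cball imageI subsetD)
    moreover have "x \<otimes> (inv x \<otimes> y) = y" using x(1) yc by (simp add: m_assoc[symmetric])
    ultimately show "q \<in> (\<lambda>y. p (x \<otimes> y)) ` c ` cball E r" using y(2) by (metis imageI)
  qed
  ultimately show "\<exists>U K. openin X U \<and> compactin X K \<and> z \<in> U \<and> U \<subseteq> K"
    using p_open[OF W] K x(2) by blast
qed

lemma second_countable_X:
  obtains \<B> where "countable \<B>" "\<And>B. B \<in> \<B> \<Longrightarrow> openin X B"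
    "\<And>U x. openin X U \<Longrightarrow> x \<in> U \<Longrightarrow> \<exists>B\<in>\<B>. x \<in> B \<and> B \<subseteq> U"
proof -
  obtain \<A> where \<A>: "countable \<A>" "\<And>B. B \<in> \<A> \<Longrightarrow> openin T B"
    "\<And>U x. openin T U \<Longrightarrow> x \<in> U \<Longrightarrow> \<exists>B\<in>\<A>. x \<in> B \<and> B \<subseteq> U"
    using lie_group unfolding lie_group_def by metis
  show thesis
  proof (rule that[of "(\<lambda>B. p ` B) ` \<A>"])
    show "countable ((\<lambda>B. p ` B) ` \<A>)" using \<A>(1) by simp
    show "openin X B" if "B \<in> (\<lambda>B. p ` B) ` \<A>" for B using that p_open \<A>(2) by auto
    fix U z assume U: "openin X U" "z \<in> U"
    then have "z \<in> topspace X" using openin_subset by blast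
    then obtain x where x: "x \<in> carrier G" "z = p x" by (auto simp: topspace_X)
    have "openin T {x \<in> topspace T. p x \<in> U}" by (rule openin_continuous_map_preimage[OF p_continuous U(1)])
    moreover have "x \<in> {x \<in> topspace T. p x \<in> U}" using x U by simp
    ultimately obtain B where "B \<in> \<A>" "x \<in> B" "B \<subseteq> {x \<in> topspace T. p x \<in> U}" using \<A>(3) by blast
    then have "p ` B \<in> (\<lambda>B. p ` B) ` \<A>" "z \<in> p ` B" "p ` B \<subseteq> U" using x(2) by auto
    then show "\<exists>B\<in>(\<lambda>B. p ` B) ` \<A>. z \<in> B \<and> B \<subseteq> U" by (intro bexI[of _ "p ` B"] conjI)
  qed
qed

section \<open>Compactly supported functions on the quotient under the action\<close>

lemma Cc_fun_act:
  assumes f: "Cc_fun X f" and g: "g \<in> carrier G"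
  shows "Cc_fun X (\<lambda>z. f (act g z))"
proof -
  obtain C where C: "compactin X C" "\<forall>x\<in>topspace X - C. f x = 0" and fc: "continuous_map X euclideanreal f"
    using f by (auto simp: Cc_fun_def)
  have "continuous_map X euclideanreal (\<lambda>z. f (act g z))"
    using continuous_map_compose[OF act_continuous[OF g] fc] by (simp add: o_def)
  moreover have "compactin X (act (inv g) ` C)"
    by (rule image_compactin[OF C(1) act_continuous]) (use g in simp)
  moreover have "f (act g z) = 0" if z: "z \<in> topspace X - act (inv g) ` C" for z
  proof -
    have "act (inv g) (act g z) = z" using z g act_act[of "inv g" g z] act_one by simp
    then have "act g z \<notin> C" using z by (metis DiffD2 imageI)
    then show ?thesis using C(2) act_closed[OF g] z by auto
  qed
  ultimately show ?thesis by (auto simp: Cc_fun_def)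
qed

lemma act_limit:
  assumes y: "limitin T y \<one> F" "\<And>n. y n \<in> carrier G" and z: "z \<in> topspace X"
  shows "limitin X (\<lambda>n. act (y n) z) z F"
proof -
  obtain x where x: "x \<in> carrier G" "z = p x" using z by (auto simp: topspace_X)
  have "limitin T (\<lambda>n. y n \<otimes> x) (\<one> \<otimes> x) F"
    by (rule limitin_mult[OF y(1)]) (use x in simp)
  from continuous_map_limit[OF p_continuous this] show ?thesis
    using x y(2) by (simp add: o_def act_p)
qed

text \<open>Finitely many neighbourhoods cover the compact set outside which f vanishes. A point
  outside it may be moved into it, and then the estimate is applied at the image with the inverse
  element; this is why \<open>w n\<close> and \<open>inv (w n)\<close> are treated together.\<close>

lemma Cc_fun_uniformly_continuous:
  assumes f: "Cc_fun X f" and w: "limitin T w \<one> sequentially" "\<And>n. w n \<in> carrier G" and e: "0 < e"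
  shows "\<forall>\<^sub>F n in sequentially. \<forall>z\<in>topspace X. \<bar>f (act (w n) z) - f z\<bar> < e"
proof -
  obtain C where C: "compactin X C" "\<forall>x\<in>topspace X - C. f x = 0" and fc: "continuous_map X euclideanreal f"
    using f by (auto simp: Cc_fun_def)
  have fp: "continuous_map T euclideanreal (\<lambda>x. f (p x))"
    using continuous_map_compose[OF p_continuous fc] by (simp add: o_def)
  have hc: "continuous_map (prod_topology T T) euclideanreal (\<lambda>q. f (p (fst q \<otimes> snd q)) - f (p (snd q)))"
    using continuous_map_compose[OF continuous_mult[OF continuous_map_fst continuous_map_snd] fp]
      continuous_map_compose[OF continuous_map_snd fp, of T]
    by (intro continuous_map_diff) (simp_all add: o_def)
  have "\<exists>Z. openin X Z \<and> z \<in> Z \<and> (\<forall>\<^sub>F n in sequentially. \<forall>q\<in>Z. \<bar>f (act (w n) q) - f q\<bar> < e \<and> \<bar>f (act (inv (w n)) q) - f q\<bar> < e)"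
    if "z \<in> C" for z
  proof -
    have "z \<in> topspace X" using that compactin_subset_topspace[OF C(1)] by auto
    then obtain x where x: "x \<in> carrier G" "z = p x" by (auto simp: topspace_X)
    obtain A B where AB: "openin T A" "openin T B" "\<one> \<in> A" "x \<in> B"
      "\<And>a b. a \<in> A \<Longrightarrow> b \<in> B \<Longrightarrow> f (p (a \<otimes> b)) - f (p b) \<in> {-e<..<e}"
      using mult_box[OF hc, of "{-e<..<e}" \<one> x] x(1) e by auto
    have near: "\<bar>f (act a q) - f q\<bar> < e" if "a \<in> A" "q \<in> p ` B" for a q
    proof -
      obtain b where b: "b \<in> B" "q = p b" using \<open>q \<in> p ` B\<close> by blast
      have "a \<in> carrier G" "b \<in> carrier G" using openin_subset[OF AB(1)] openin_subset[OF AB(2)] that b by auto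
      then show ?thesis using AB(5)[OF that(1) b(1)] b(2) by (simp add: act_p abs_less_iff)
    qed
    have "\<forall>\<^sub>F n in sequentially. w n \<in> A" using w(1) AB by (simp add: limitin_def)
    moreover have "\<forall>\<^sub>F n in sequentially. inv (w n) \<in> A"
      using limitin_inv[OF w(1)] AB by (simp add: limitin_def)
    ultimately have "\<forall>\<^sub>F n in sequentially. \<forall>q\<in>p ` B. \<bar>f (act (w n) q) - f q\<bar> < e \<and> \<bar>f (act (inv (w n)) q) - f q\<bar> < e"
      by eventually_elim (use near in blast)
    then show ?thesis using p_open[OF AB(2)] AB(4) x(2) by blast
  qed
  then have "\<forall>z\<in>C. \<exists>Z. openin X Z \<and> z \<in> Z \<and> (\<forall>\<^sub>F n in sequentially. \<forall>q\<in>Z. \<bar>f (act (w n) q) - f q\<bar> < e \<and> \<bar>f (act (inv (w n)) q) - f q\<bar> < e)"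
    by blast
  from bchoice[OF this] obtain Z where Z': "\<forall>z\<in>C. openin X (Z z) \<and> z \<in> Z z \<and>
    (\<forall>\<^sub>F n in sequentially. \<forall>q\<in>Z z. \<bar>f (act (w n) q) - f q\<bar> < e \<and> \<bar>f (act (inv (w n)) q) - f q\<bar> < e)" ..
  have Z: "\<And>z. z \<in> C \<Longrightarrow> openin X (Z z)" "\<And>z. z \<in> C \<Longrightarrow> z \<in> Z z"
    "\<And>z. z \<in> C \<Longrightarrow> \<forall>\<^sub>F n in sequentially. \<forall>q\<in>Z z. \<bar>f (act (w n) q) - f q\<bar> < e \<and> \<bar>f (act (inv (w n)) q) - f q\<bar> < e"
    using Z' by simp_all
  have "\<exists>\<F>. finite \<F> \<and> \<F> \<subseteq> Z ` C \<and> C \<subseteq> \<Union>\<F>"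
    by (rule compactinD[OF C(1)]) (use Z in auto)
  then obtain S where S: "finite S" "S \<subseteq> C" "C \<subseteq> \<Union>(Z ` S)" by (metis finite_subset_image)
  have "\<forall>\<^sub>F n in sequentially. \<forall>z\<in>S. \<forall>q\<in>Z z. \<bar>f (act (w n) q) - f q\<bar> < e \<and> \<bar>f (act (inv (w n)) q) - f q\<bar> < e"
    using S Z(3) by (intro eventually_ball_finite) auto
  then show ?thesis
  proof eventually_elim
    case (elim n)
    then have near: "\<bar>f (act (w n) q) - f q\<bar> < e" "\<bar>f (act (inv (w n)) q) - f q\<bar> < e" if "q \<in> C" for q
      using S(3) that by blast+
    show ?case
    proof
      fix z assume z: "z \<in> topspace X"
      have z': "act (w n) z \<in> topspace X" using act_closed[OF w(2) z] .
      have inv_w: "act (inv (w n)) (act (w n) z) = z" using act_act[of "inv (w n)" "w n" z] w(2)[of n] z act_one by simp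
      consider "z \<in> C" | "act (w n) z \<in> C" | "z \<notin> C" "act (w n) z \<notin> C" by blast
      then show "\<bar>f (act (w n) z) - f z\<bar> < e"
      proof cases
        case 1
        then show ?thesis by (rule near)
      next
        case 2
        from near(2)[OF this] show ?thesis unfolding inv_w by (simp add: abs_minus_commute)
      next
        case 3
        then show ?thesis using C(2) z z' e by simp
      qed
    qed
  qed
qed

section \<open>Decorrelation and equidistribution\<close>

context
  fixes \<mu> :: "'g set measure" and g y :: "nat \<Rightarrow> 'g" and u :: 'g
  assumes \<mu>: "prob_space \<mu>" "sets \<mu> = sets (borel_of X)"
    and g: "\<And>n. g n \<in> carrier G" and y: "\<And>n. y n \<in> carrier G" and u: "u \<in> carrier G"
    and inv: "\<And>n. invariant_under G (y n) \<mu>"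
    and y1: "limitin T y \<one> sequentially"
    and lim: "limitin T (\<lambda>n. g n \<otimes> y n \<otimes> inv (g n)) u sequentially"
begin

lemma space_\<mu>: "space \<mu> = topspace X"
  using sets_eq_imp_space_eq[OF \<mu>(2)] by (simp add: space_borel_of)

lemma Cc_fun_measurable: "Cc_fun X f \<Longrightarrow> f \<in> borel_measurable \<mu>"
  using borel_of_measurable_real[OF \<mu>(2)] by (simp add: Cc_fun_def)

definition shift_diff where "shift_diff f n z = f (act u (act (g n) z)) - f (act (g n) z)"

lemma shift_diff_Cc: "Cc_fun X f \<Longrightarrow> Cc_fun X (\<lambda>z. f (act u (act (g n) z)))" "Cc_fun X f \<Longrightarrow> Cc_fun X (\<lambda>z. f (act (g n) z))"
  using Cc_fun_act[OF Cc_fun_act[OF _ u] g] Cc_fun_act[OF _ g] by auto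

lemma shift_diff_continuous: "Cc_fun X f \<Longrightarrow> continuous_map X euclideanreal (shift_diff f n)"
  unfolding shift_diff_def[abs_def] using shift_diff_Cc
  by (intro continuous_map_diff) (auto simp: Cc_fun_def)

lemma shift_diff_measurable: "Cc_fun X f \<Longrightarrow> shift_diff f n \<in> borel_measurable \<mu>"
  by (rule borel_of_measurable_real[OF \<mu>(2) shift_diff_continuous])

text \<open>As \<open>g n \<otimes> y n\<close> is close to \<open>u \<otimes> g n\<close>, the function \<open>shift_diff f n\<close> is uniformly close to
  the difference of \<open>f (g n z)\<close> and its translate by \<open>y n\<close>; by invariance of \<open>\<mu>\<close> the translation
  moves to the other factor, where it tends to the identity.\<close>

lemma shift_diff_decorrelates:
  assumes f: "Cc_fun X f"
  shows "(\<lambda>n. integral\<^sup>L \<mu> (\<lambda>z. shift_diff f m z * shift_diff f n z)) \<longlonglongrightarrow> 0"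
proof -
  interpret prob_space \<mu> by (rule \<mu>(1))
  obtain B where B: "0 \<le> B" "\<And>z. z \<in> topspace X \<Longrightarrow> \<bar>f z\<bar> \<le> B" using Cc_fun_bounded[OF f] by blast
  define \<psi> where "\<psi> = shift_diff f m"
  have \<psi>m: "\<psi> \<in> borel_measurable \<mu>" unfolding \<psi>_def by (rule shift_diff_measurable[OF f])
  have \<psi>B: "\<bar>\<psi> z\<bar> \<le> 2 * B" if "z \<in> topspace X" for z
    using B(2)[OF act_closed[OF u act_closed[OF g[of m] that]]] B(2)[OF act_closed[OF g[of m] that]]
    by (simp add: \<psi>_def shift_diff_def)
  let ?u = "\<lambda>n. g n \<otimes> y n \<otimes> inv (g n)"
  have uc: "?u n \<in> carrier G" for n using g y by simp
  define \<alpha> where "\<alpha> n z = f (act u (act (g n) z)) - f (act (?u n) (act (g n) z))" for n z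
  define \<beta> where "\<beta> n z = (\<psi> (act (inv (y n)) z) - \<psi> z) * f (act (g n) z)" for n z
  have uy: "act (?u n) (act (g n) z) = act (g n) (act (y n) z)" if "z \<in> topspace X" for n z
    using act_act[OF uc g that, of n n] act_act[OF g y that, of n n] g[of n] y[of n] by (simp add: m_assoc)
  have am: "(\<lambda>z. act h z) \<in> measurable \<mu> \<mu>" if "h \<in> carrier G" for h
    by (rule borel_of_measurable_map[OF \<mu>(2) \<mu>(2) act_continuous[OF that]])
  have \<alpha>m: "\<alpha> n \<in> borel_measurable \<mu>" for n
    unfolding \<alpha>_def[abs_def]
    using Cc_fun_measurable[OF Cc_fun_act[OF Cc_fun_act[OF f u] g]] Cc_fun_measurable[OF Cc_fun_act[OF Cc_fun_act[OF f uc] g]]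
    by (intro borel_measurable_diff) auto
  have fgm: "(\<lambda>z. f (act (g n) z)) \<in> borel_measurable \<mu>" for n by (rule Cc_fun_measurable[OF Cc_fun_act[OF f g]])
  have fgB: "\<bar>f (act (g n) z)\<bar> \<le> B" if "z \<in> topspace X" for n z by (rule B(2)[OF act_closed[OF g that]])
  have \<psi>ym: "(\<lambda>z. \<psi> (act (inv (y n)) z)) \<in> borel_measurable \<mu>" for n
    by (rule measurable_compose[OF am \<psi>m]) (use y in simp)
  have \<psi>yB: "\<bar>\<psi> (act (inv (y n)) z)\<bar> \<le> 2 * B" if "z \<in> topspace X" for n z
    by (intro \<psi>B act_closed that inv_closed y)
  have int: "integrable \<mu> h" if "h \<in> borel_measurable \<mu>" "\<And>z. z \<in> topspace X \<Longrightarrow> \<bar>h z\<bar> \<le> K" for h and K :: real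
    by (rule integrable_const_bound[of _ K]) (use that in \<open>auto simp: space_\<mu>\<close>)
  have small\<alpha>: "\<forall>\<^sub>F n in sequentially. \<forall>z\<in>topspace X. \<bar>\<alpha> n z\<bar> < e" if e: "0 < e" for e
  proof -
    have "limitin T (\<lambda>n. ?u n \<otimes> inv u) (u \<otimes> inv u) sequentially"
      by (rule limitin_mult[OF lim]) (use u in simp)
    then have l1: "limitin T (\<lambda>n. ?u n \<otimes> inv u) \<one> sequentially" using u by simp
    have "\<forall>\<^sub>F n in sequentially. \<forall>z\<in>topspace X. \<bar>f (act (?u n \<otimes> inv u) z) - f z\<bar> < e"
      by (rule Cc_fun_uniformly_continuous[OF f l1 _ e]) (use uc u in simp)
    then show ?thesis
    proof eventually_elim
      case (elim n)
      show ?case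
      proof
        fix z assume z: "z \<in> topspace X"
        let ?z = "act u (act (g n) z)"
        have "act (?u n \<otimes> inv u) ?z = act (?u n) (act (g n) z)"
          using act_act[OF _ u act_closed[OF g z], of "?u n \<otimes> inv u" n] u uc[of n] by (simp add: m_assoc)
        moreover have "?z \<in> topspace X" by (intro act_closed u g z)
        ultimately show "\<bar>\<alpha> n z\<bar> < e" using elim by (force simp: \<alpha>_def abs_minus_commute)
      qed
    qed
  qed
  have I1: "(\<lambda>n. expectation (\<lambda>z. \<psi> z * \<alpha> n z)) \<longlonglongrightarrow> 0"
  proof (rule tendstoI)
    fix e :: real assume e: "0 < e"
    \<comment> \<open>Ensures 2 * B * d < e, also for B = 0.\<close>
    define d where "d = e / (2 * (2 * B + 1))"
    have d: "0 < d" using e B(1) by (simp add: d_def)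
    show "\<forall>\<^sub>F n in sequentially. dist (expectation (\<lambda>z. \<psi> z * \<alpha> n z)) 0 < e"
      using small\<alpha>[OF d]
    proof eventually_elim
      case (elim n)
      have b: "\<bar>\<psi> z * \<alpha> n z\<bar> \<le> 2 * B * d" if "z \<in> topspace X" for z
      proof -
        have "\<bar>\<alpha> n z\<bar> \<le> d" using elim that by force
        then show ?thesis unfolding abs_mult by (intro mult_mono \<psi>B that) (use B(1) in auto)
      qed
      have i: "integrable \<mu> (\<lambda>z. \<psi> z * \<alpha> n z)"
        by (rule int[OF _ b]) (intro borel_measurable_times \<psi>m \<alpha>m)
      have "\<bar>expectation (\<lambda>z. \<psi> z * \<alpha> n z)\<bar> \<le> expectation (\<lambda>z. \<bar>\<psi> z * \<alpha> n z\<bar>)" by (rule integral_abs_bound)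
      also have "\<dots> \<le> expectation (\<lambda>z. 2 * B * d)"
        by (intro integral_mono integrable_abs i) (use b in \<open>auto simp: space_\<mu>\<close>)
      also have "\<dots> = 2 * B * d" by (simp add: prob_space)
      also have "\<dots> < e" using e B(1) by (simp add: d_def field_simps add_pos_nonneg)
      finally show ?case by simp
    qed
  qed
  have bB: "\<bar>\<psi> (act (inv (y n)) z) - \<psi> z\<bar> \<le> 4 * B" if "z \<in> topspace X" for n z
    using \<psi>yB[OF that, of n] \<psi>B[OF that] by linarith
  \<comment> \<open>The factor f (g n z) varies with n and is merely bounded. The smallness comes
    from \<open>\<psi>\<close>, in which the index m is fixed: it is continuous along y_n^-1 z -> z,
    and dominated convergence applies.\<close>
  have I2: "(\<lambda>n. expectation (\<beta> n)) \<longlonglongrightarrow> 0"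
  proof (rule Lim_null_comparison)
    have "(\<lambda>n. expectation (\<lambda>z. \<bar>\<psi> (act (inv (y n)) z) - \<psi> z\<bar>)) \<longlonglongrightarrow> expectation (\<lambda>z. 0)"
    proof (rule integral_dominated_convergence[where w = "\<lambda>_. 4 * B"])
      show "AE z in \<mu>. (\<lambda>n. \<bar>\<psi> (act (inv (y n)) z) - \<psi> z\<bar>) \<longlonglongrightarrow> 0"
      proof (rule AE_I2)
        fix z assume "z \<in> space \<mu>"
        then have z: "z \<in> topspace X" by (simp add: space_\<mu>)
        have "limitin T (\<lambda>n. inv (y n)) \<one> sequentially" using limitin_inv[OF y1] by simp
        from act_limit[OF this inv_closed[OF y] z]
        have "limitin X (\<lambda>n. act (inv (y n)) z) z sequentially" .
        from continuous_map_limit[OF shift_diff_continuous[OF f] this, of m]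
        have "(\<lambda>n. \<psi> (act (inv (y n)) z)) \<longlonglongrightarrow> \<psi> z" by (simp add: \<psi>_def o_def)
        then have "(\<lambda>n. \<psi> (act (inv (y n)) z) - \<psi> z) \<longlonglongrightarrow> 0" by (simp add: LIM_zero_iff)
        then show "(\<lambda>n. \<bar>\<psi> (act (inv (y n)) z) - \<psi> z\<bar>) \<longlonglongrightarrow> 0" by (rule tendsto_rabs_zero)
      qed
      show "AE z in \<mu>. norm \<bar>\<psi> (act (inv (y n)) z) - \<psi> z\<bar> \<le> 4 * B" for n
        by (rule AE_I2) (use bB in \<open>simp add: space_\<mu>\<close>)
      show "(\<lambda>z. \<bar>\<psi> (act (inv (y n)) z) - \<psi> z\<bar>) \<in> borel_measurable \<mu>" for n
        by (intro borel_measurable_abs borel_measurable_diff \<psi>ym \<psi>m)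
    qed auto
    from tendsto_mult_right_zero[OF this[simplified], of B]
    show "(\<lambda>n. B * expectation (\<lambda>z. \<bar>\<psi> (act (inv (y n)) z) - \<psi> z\<bar>)) \<longlonglongrightarrow> 0" .
    show "\<forall>\<^sub>F n in sequentially. norm (expectation (\<beta> n)) \<le> B * expectation (\<lambda>z. \<bar>\<psi> (act (inv (y n)) z) - \<psi> z\<bar>)"
    proof (rule always_eventually, rule allI)
      fix n
      have i1: "integrable \<mu> (\<lambda>z. \<psi> (act (inv (y n)) z) - \<psi> z)"
        by (rule int[OF _ bB]) (intro borel_measurable_diff \<psi>ym \<psi>m)
      have b: "\<bar>\<beta> n z\<bar> \<le> \<bar>\<psi> (act (inv (y n)) z) - \<psi> z\<bar> * B" if "z \<in> topspace X" for z
        unfolding \<beta>_def abs_mult by (intro mult_left_mono fgB that) simp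
      have i2: "integrable \<mu> (\<beta> n)"
      proof (rule int)
        show "\<beta> n \<in> borel_measurable \<mu>" unfolding \<beta>_def[abs_def]
          by (intro borel_measurable_times borel_measurable_diff \<psi>ym \<psi>m fgm)
        show "\<bar>\<beta> n z\<bar> \<le> 4 * B * B" if "z \<in> topspace X" for z
          using b[OF that] mult_right_mono[OF bB[OF that] B(1), of n] by linarith
      qed
      have "\<bar>expectation (\<beta> n)\<bar> \<le> expectation (\<lambda>z. \<bar>\<beta> n z\<bar>)" by (rule integral_abs_bound)
      also have "\<dots> \<le> expectation (\<lambda>z. \<bar>\<psi> (act (inv (y n)) z) - \<psi> z\<bar> * B)"
        by (intro integral_mono integrable_abs i2 integrable_mult_left i1) (use b in \<open>auto simp: space_\<mu>\<close>)
      finally show "norm (expectation (\<beta> n)) \<le> B * expectation (\<lambda>z. \<bar>\<psi> (act (inv (y n)) z) - \<psi> z\<bar>)"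
        by (simp add: mult.commute)
    qed
  qed
  have eq: "expectation (\<lambda>z. \<psi> z * shift_diff f n z) = expectation (\<lambda>z. \<psi> z * \<alpha> n z) + expectation (\<beta> n)" for n
  proof -
    have ym: "(\<lambda>z. act (y n) z) \<in> measurable \<mu> \<mu>" by (rule am[OF y])
    have fgym: "(\<lambda>z. f (act (g n) (act (y n) z))) \<in> borel_measurable \<mu>"
      by (rule measurable_compose[OF ym fgm])
    have fgyB: "\<bar>f (act (g n) (act (y n) z))\<bar> \<le> B" if "z \<in> topspace X" for z
      by (rule fgB[OF act_closed[OF y that]])
    have prodB: "\<bar>a * b\<bar> \<le> 2 * B * B" if "\<bar>a\<bar> \<le> 2 * B" "\<bar>b\<bar> \<le> B" for a b
      unfolding abs_mult using that B(1) by (intro mult_mono) auto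
    let ?k = "\<lambda>z. \<psi> (act (inv (y n)) z) * f (act (g n) z)"
    have km: "?k \<in> borel_measurable \<mu>" by (intro borel_measurable_times \<psi>ym fgm)
    have i1: "integrable \<mu> (\<lambda>z. \<psi> z * f (act (g n) (act (y n) z)))"
      by (rule int[of _ "2 * B * B"]) (intro borel_measurable_times \<psi>m fgym, intro prodB \<psi>B fgyB)
    have i2: "integrable \<mu> (\<lambda>z. \<psi> z * f (act (g n) z))"
      by (rule int[of _ "2 * B * B"]) (intro borel_measurable_times \<psi>m fgm, intro prodB \<psi>B fgB)
    have i3: "integrable \<mu> ?k"
      by (rule int[of _ "2 * B * B"]) (rule km, intro prodB \<psi>yB fgB)
    have \<alpha>B: "\<bar>\<alpha> n z\<bar> \<le> 2 * B" if "z \<in> topspace X" for z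
      using B(2)[OF act_closed[OF u act_closed[OF g[of n] that]]] fgyB[OF that] by (simp add: \<alpha>_def uy[OF that])
    have i4: "integrable \<mu> (\<lambda>z. \<psi> z * \<alpha> n z)"
    proof (rule int)
      show "\<bar>\<psi> z * \<alpha> n z\<bar> \<le> 2 * B * (2 * B)" if "z \<in> topspace X" for z
        unfolding abs_mult using \<alpha>B[OF that] \<psi>B[OF that] B(1) by (intro mult_mono) auto
    qed (intro borel_measurable_times \<psi>m \<alpha>m)
    have "expectation (\<lambda>z. \<psi> z * shift_diff f n z)
        = expectation (\<lambda>z. \<psi> z * \<alpha> n z + (\<psi> z * f (act (g n) (act (y n) z)) - \<psi> z * f (act (g n) z)))"
      by (rule Bochner_Integration.integral_cong)
         (auto simp: space_\<mu> \<alpha>_def shift_diff_def uy algebra_simps)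
    also have "\<dots> = expectation (\<lambda>z. \<psi> z * \<alpha> n z) + (expectation (\<lambda>z. \<psi> z * f (act (g n) (act (y n) z)))
        - expectation (\<lambda>z. \<psi> z * f (act (g n) z)))"
      using i1 i2 i4 by simp
    \<comment> \<open>Writing z as y^-1 y z presents the integrand as a function of y z, to which
      invariance of the measure applies.\<close>
    also have "expectation (\<lambda>z. \<psi> z * f (act (g n) (act (y n) z))) = expectation (\<lambda>z. ?k (act (y n) z))"
    proof (rule Bochner_Integration.integral_cong[OF refl])
      fix z assume "z \<in> space \<mu>"
      then have z: "z \<in> topspace X" by (simp add: space_\<mu>)
      have "act (inv (y n)) (act (y n) z) = z" using act_act[of "inv (y n)" "y n" z] y[of n] z act_one by simp
      then show "\<psi> z * f (act (g n) (act (y n) z)) = ?k (act (y n) z)" by simp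
    qed
    also have "expectation (\<lambda>z. ?k (act (y n) z)) = integral\<^sup>L (distr \<mu> \<mu> (\<lambda>z. act (y n) z)) ?k"
      by (rule integral_distr[OF ym km, symmetric])
    also have "\<dots> = expectation ?k" using inv[of n] by (simp add: invariant_under_def)
    also have "expectation ?k - expectation (\<lambda>z. \<psi> z * f (act (g n) z)) = expectation (\<beta> n)"
      unfolding \<beta>_def using i2 i3 by (simp add: left_diff_distrib)
    finally show ?thesis .
  qed
  show ?thesis
    using tendsto_add[OF I1 I2] by (simp add: eq \<psi>_def[symmetric])
qed

text \<open>The case N = 0, which a subsequence of indices may contain, is covered: both sides are
  0.\<close>

lemma integral_empirical_measure:
  assumes s: "\<And>n. s n \<in> topspace X" and f: "Cc_fun X f"
  shows "integral\<^sup>L (empirical_measure X s N) f = (\<Sum>n=1..N. f (s n)) / real N"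
proof -
  have "s \<in> measurable (uniform_count_measure {1..N}) (borel_of X)"
    using s by (intro measurableI) (auto simp: space_uniform_count_measure sets_uniform_count_measure space_borel_of)
  moreover have "f \<in> borel_measurable (borel_of X)"
    using borel_of_measurable_real[of "borel_of X" X f] f by (simp add: Cc_fun_def)
  ultimately show ?thesis
    unfolding empirical_measure_def by (simp add: integral_distr integral_uniform_count_measure)
qed

text \<open>Each test function and its translate by u have compact support, so their integrals pass
  to any weak-* limit even when mass escapes, and the vanishing averages say that they agree. The
  limit and its image under u are finite measures with the same integrals of all the determining
  functions, hence equal; countability of that family leaves a single null set.\<close>

lemma subsequence_equidistributes:
  obtains s :: "nat \<Rightarrow> nat" where "strict_mono s"
    "AE x in \<mu>. \<forall>\<nu>. weak_star_limit_point X (empirical_measure X (\<lambda>n. act (g (s n)) x)) \<nu> \<longrightarrow>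
       invariant_under G u \<nu>"
proof -
  obtain \<B> where \<B>: "countable \<B>" "\<And>B. B \<in> \<B> \<Longrightarrow> openin X B"
    "\<And>U x. openin X U \<Longrightarrow> x \<in> U \<Longrightarrow> \<exists>B\<in>\<B>. x \<in> B \<and> B \<subseteq> U"
    using second_countable_X by blast
  obtain F :: "nat \<Rightarrow> 'g set \<Rightarrow> real" where F: "\<And>i. Cc_fun X (F i)"
    and det: "\<And>\<nu> \<nu>'. finite_measure \<nu> \<Longrightarrow> finite_measure \<nu>' \<Longrightarrow> sets \<nu> = sets (borel_of X) \<Longrightarrow>
       sets \<nu>' = sets (borel_of X) \<Longrightarrow> (\<And>i. integral\<^sup>L \<nu> (F i) = integral\<^sup>L \<nu>' (F i)) \<Longrightarrow> \<nu> = \<nu>'"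
    using exists_determining_functions[OF Hausdorff_X locally_compact_X \<B>] by blast
  have "\<forall>i. \<exists>B. \<forall>z\<in>topspace X. \<bar>F i z\<bar> \<le> B" using Cc_fun_bounded[OF F] by metis
  then obtain B where B: "\<And>i z. z \<in> topspace X \<Longrightarrow> \<bar>F i z\<bar> \<le> B i" by metis
  have bd: "\<bar>shift_diff (F i) n z\<bar> \<le> 2 * B i" if "z \<in> space \<mu>" for i n z
  proof -
    have z: "z \<in> topspace X" using that by (simp add: space_\<mu>)
    show ?thesis
      using B[OF act_closed[OF u act_closed[OF g[of n] z]], of i] B[OF act_closed[OF g[of n] z], of i]
      by (simp add: shift_diff_def)
  qed
  obtain s where s: "strict_mono s"
    "\<And>i. AE x in \<mu>. (\<lambda>N. (\<Sum>n=1..N. shift_diff (F i) (s n) x) / real N) \<longlonglongrightarrow> 0"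
    using prob_space.decorrelated_subsequence[OF \<mu>(1), of "\<lambda>i. shift_diff (F i)" "\<lambda>i. 2 * B i"]
      shift_diff_measurable[OF F] bd shift_diff_decorrelates[OF F] by blast
  have "AE x in \<mu>. \<forall>i. (\<lambda>N. (\<Sum>n=1..N. shift_diff (F i) (s n) x) / real N) \<longlonglongrightarrow> 0"
    unfolding AE_all_countable using s(2) by blast
  then have "AE x in \<mu>. \<forall>\<nu>. weak_star_limit_point X (empirical_measure X (\<lambda>n. act (g (s n)) x)) \<nu> \<longrightarrow>
       invariant_under G u \<nu>"
  proof (rule AE_mp, intro AE_I2 impI allI)
    fix x \<nu>
    assume x: "x \<in> space \<mu>" and avg: "\<forall>i. (\<lambda>N. (\<Sum>n=1..N. shift_diff (F i) (s n) x) / real N) \<longlonglongrightarrow> 0"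
      and wl: "weak_star_limit_point X (empirical_measure X (\<lambda>n. act (g (s n)) x)) \<nu>"
    let ?e = "empirical_measure X (\<lambda>n. act (g (s n)) x)"
    have xt: "x \<in> topspace X" using x by (simp add: space_\<mu>)
    have gx: "act (g (s n)) x \<in> topspace X" for n by (rule act_closed[OF g xt])
    obtain r where r: "strict_mono r" "weak_star_limit X (\<lambda>j. ?e (r j)) \<nu>"
      and fin: "finite_measure \<nu>" and sets: "sets \<nu> = sets (borel_of X)"
      using wl by (auto simp: weak_star_limit_point_def)
    have um: "(\<lambda>z. act u z) \<in> measurable \<nu> \<nu>"
      by (rule borel_of_measurable_map[OF sets sets act_continuous[OF u]])
    have eq: "integral\<^sup>L \<nu> (\<lambda>z. F i (act u z)) = integral\<^sup>L \<nu> (F i)" for i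
    proof -
      have Fu: "Cc_fun X (\<lambda>z. F i (act u z))" by (rule Cc_fun_act[OF F u])
      have "(\<lambda>j. integral\<^sup>L (?e (r j)) (\<lambda>z. F i (act u z)) - integral\<^sup>L (?e (r j)) (F i)) \<longlonglongrightarrow>
          integral\<^sup>L \<nu> (\<lambda>z. F i (act u z)) - integral\<^sup>L \<nu> (F i)"
        using r(2) Fu F[of i] by (intro tendsto_diff) (auto simp: weak_star_limit_def)
      moreover have "integral\<^sup>L (?e N) (\<lambda>z. F i (act u z)) - integral\<^sup>L (?e N) (F i)
          = (\<Sum>n=1..N. shift_diff (F i) (s n) x) / real N" for N
        unfolding integral_empirical_measure[OF gx Fu] integral_empirical_measure[OF gx F]
        by (simp add: shift_diff_def sum_subtractf diff_divide_distrib)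
      moreover have "(\<lambda>j. (\<Sum>n=1..r j. shift_diff (F i) (s n) x) / real (r j)) \<longlonglongrightarrow> 0"
        using LIMSEQ_subseq_LIMSEQ[OF avg[rule_format, of i] r(1)] by (simp add: o_def)
      ultimately show ?thesis using LIMSEQ_unique by fastforce
    qed
    show "invariant_under G u \<nu>"
      unfolding invariant_under_def
    proof (rule det[OF _ fin _ sets])
      interpret finite_measure \<nu> by (rule fin)
      show "finite_measure (distr \<nu> \<nu> (\<lambda>z. act u z))" by (rule finite_measure_distr[OF um])
      show "sets (distr \<nu> \<nu> (\<lambda>z. act u z)) = sets (borel_of X)" by (simp add: sets)
      fix i
      have "F i \<in> borel_measurable \<nu>" using borel_of_measurable_real[OF sets] F[of i] by (simp add: Cc_fun_def)
      then show "integral\<^sup>L (distr \<nu> \<nu> (\<lambda>z. act u z)) (F i) = integral\<^sup>L \<nu> (F i)"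
        by (simp add: integral_distr[OF um] eq)
    qed
  qed
  with s(1) show thesis by (rule that)
qed

end

end

theorem theoremA1:
  fixes G :: "('g, 'e::euclidean_space) lie_data"
    and \<sigma> \<theta> :: "'g \<Rightarrow> 'g"
    and H K A \<Gamma> :: "'g set"
    and \<aa> :: "'e set"
    and N :: "'e \<Rightarrow> real"
    and \<mu>\<^sub>H :: "'g set measure"
    and g k a h :: "nat \<Rightarrow> 'g"
  assumes "lie_group G" and "connected_space (topol G)" and "semisimple G"
    and "finite (group_center G)"
    and "group_involution G \<sigma>" and "H = {x \<in> carrier G. \<sigma> x = x}"
    and "cartan_involution G \<theta>" and "\<forall>x\<in>carrier G. \<sigma> (\<theta> x) = \<theta> (\<sigma> x)"
    and "maximal_compact_subgroup G K"
    and "lie_algebra_of G K = eigenspace 1 (differential G \<theta>)"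
    and "maximal_abelian_in G
           (eigenspace (-1) (differential G \<sigma>) \<inter> eigenspace (-1) (differential G \<theta>)) \<aa>"
    and "A = lie_exp G ` \<aa>"
    and "is_norm N"
    and "irreducible_lattice G \<Gamma>"
    and "closedin (coset_space G \<Gamma>) {x <#\<^bsub>G\<^esub> \<Gamma> | x. x \<in> H}"
    and "prob_space \<mu>\<^sub>H" and "sets \<mu>\<^sub>H = sets (borel_of (coset_space G \<Gamma>))"
    and "\<forall>x\<in>H. invariant_under G x \<mu>\<^sub>H"
    and "emeasure \<mu>\<^sub>H {x <#\<^bsub>G\<^esub> \<Gamma> | x. x \<in> H} = 1"
    and "\<forall>n\<ge>1. g n \<in> carrier G"
    and "tends_to_infinity (coset_space G H) (\<lambda>n. g n <#\<^bsub>G\<^esub> H)"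
    and "\<exists>l>0. \<exists>C. \<forall>n\<ge>1. op_norm N (Ad G (g n)) \<le> C * exp (l * real n)"
    and "\<forall>n\<ge>1. k n \<in> K \<and> a n \<in> A \<and> h n \<in> H \<and> g n = k n \<otimes>\<^bsub>G\<^esub> a n \<otimes>\<^bsub>G\<^esub> h n"
    and "\<exists>C. \<forall>n\<ge>1. op_norm N (Ad G (inv\<^bsub>G\<^esub> (h n))) \<le> C"
  shows "\<exists>r. strict_mono r \<and> ratner_sequence G \<Gamma> \<mu>\<^sub>H (\<lambda>n. g (r n))"
proof -
  interpret group G using assms(1) by (simp add: lie_group_def)
  interpret lie_grp G by standard (rule assms(1))
  interpret S: symmetric_lie_grp G \<sigma> \<theta> by standard (use assms(5,7,8) in auto)
  interpret Q: discrete_quotient G \<Gamma>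
    by standard (use assms(14) in \<open>simp add: irreducible_lattice_def lattice_in_def\<close>)
  have H: "subgroup H G"
    unfolding assms(6)
    by (rule subgroupI)
       (auto simp: lie_hom_mult[OF S.hom_\<sigma>] lie_hom_inv[OF S.hom_\<sigma>] intro!: exI[of _ "\<one>\<^bsub>G\<^esub>"] lie_hom_one[OF S.hom_\<sigma>])
  have K: "compactin (topol G) K" "subgroup K G"
    using assms(9) by (auto simp: maximal_compact_subgroup_def)
  \<comment> \<open>The implication makes the choice total; the value at index 0 is
    arbitrary.\<close>
  have "\<forall>n. \<exists>X. 1 \<le> n \<longrightarrow> X \<in> \<aa> \<and> a n = lie_exp G X" using assms(12,23) by blast
  then obtain X where X: "\<And>n. 1 \<le> n \<Longrightarrow> X n \<in> \<aa> \<and> a n = lie_exp G (X n)" by metis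
  have aX: "differential G \<sigma> v = - v" "differential G \<theta> v = - v" if "v \<in> \<aa>" for v
    using assms(11) that by (auto simp: maximal_abelian_in_def eigenspace_def)
  have g: "k n \<in> K \<and> h n \<in> carrier G \<and> \<sigma> (h n) = h n \<and> differential G \<sigma> (X n) = - X n \<and>
      differential G \<theta> (X n) = - X n \<and> g n = k n \<otimes>\<^bsub>G\<^esub> lie_exp G (X n) \<otimes>\<^bsub>G\<^esub> h n" if "1 \<le> n" for n
    using assms(6,23) X[OF that] aX that by auto
  obtain C where C: "\<And>n. 1 \<le> n \<Longrightarrow> op_norm N (Ad G (inv\<^bsub>G\<^esub> (h n))) \<le> C" using assms(24) by blast
  obtain B where B: "\<And>n v. 1 \<le> n \<Longrightarrow> norm (Ad G (inv\<^bsub>G\<^esub> (h n)) v) \<le> B * norm v"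
  proof (rule op_norm_bounded_imp_norm[OF assms(13), of "{1..}" "\<lambda>n. Ad G (inv\<^bsub>G\<^esub> (h n))" C])
    show "linear (Ad G (inv\<^bsub>G\<^esub> (h n)))" if "n \<in> {1..}" for n
      by (rule Ad_linear) (use g[of n] that in simp)
  qed (use C in auto)
  have inf: "filterlim (\<lambda>n. norm (X n)) at_top sequentially"
    by (rule lie_exp_factor_to_infinity[OF assms(21) H K(1)]) (use assms(23) X in auto)
  obtain r u y where r: "strict_mono r" "\<And>n. 1 \<le> r n" and u: "u \<in> carrier G" "u \<noteq> \<one>\<^bsub>G\<^esub>"
    and y: "\<And>n. y n \<in> carrier G \<and> \<sigma> (y n) = y n" "limitin (topol G) y \<one>\<^bsub>G\<^esub> sequentially"
    and lim: "limitin (topol G) (\<lambda>n. g (r n) \<otimes>\<^bsub>G\<^esub> y n \<otimes>\<^bsub>G\<^esub> inv\<^bsub>G\<^esub> (g (r n))) u sequentially"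
    by (rule S.conjugates_limit_exists[OF g K B inf]) (assumption, assumption, rule that)
  have gc: "g (r n) \<in> carrier G" for n using assms(20) r(2) by blast
  have uni: "Ad_unipotent G u"
    by (rule Ad_unipotent_limit[OF gc _ y(2) lim]) (use y in simp)
  \<comment> \<open>The elements \<open>y n\<close> are fixed by \<sigma> and so lie in
    \<open>H\<close>, which gives the invariance of the measure under them.\<close>
  obtain s where s: "strict_mono s" "AE x in \<mu>\<^sub>H. \<forall>\<nu>. weak_star_limit_point (coset_space G \<Gamma>)
      (empirical_measure (coset_space G \<Gamma>) (\<lambda>n. g (r (s n)) <#\<^bsub>G\<^esub> x)) \<nu> \<longrightarrow> invariant_under G u \<nu>"
    by (rule Q.subsequence_equidistributes[OF assms(16,17) gc _ u(1) _ y(2) lim])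
       (use y(1) assms(6,18) in auto)
  have "strict_mono (\<lambda>n. r (s n))" using r(1) s(1) by (simp add: strict_mono_def)
  moreover have "ratner_sequence G \<Gamma> \<mu>\<^sub>H (\<lambda>n. g (r (s n)))"
    unfolding ratner_sequence_def using u uni s(2) by blast
  ultimately show ?thesis by blast
qed

end
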